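(* Let $\varphi:[0,2\pi]\to\mathbb{R}$ be a continuous, strictly increasing and strictly concave function with $\varphi(0)=0$ and $\varphi(2\pi)=1$. Let $f\in H(\Lambda(\varphi))$ with $\|f\|_{H(\Lambda(\varphi))}=1$, and assume that the function $\mu:=|\tilde f|$, where $\tilde f(t):=f(e^{it})$ is the nontangential boundary limit of $f$, is constant on some subset of positive Lebesgue measure of the interval $[0,2\pi]$. Then $f$ is an extreme point of the closed unit ball of the space $H(\Lambda(\varphi))$.
   Context: Let $m$ be Lebesgue measure on $[0,2\pi]$. For a measurable $x:[0,2\pi]\to\mathbb{C}$, the decreasing rearrangement of $|x|$ is $x^*(t):=\inf\{\tau\ge 0: m\{s\in[0,2\pi]:|x(s)|>\tau\}\le t\}$, $0<t\le 2\pi$. The Lorentz space $\Lambda(\varphi)=\Lambda(\varphi)[0,2\pi]$ consists of all measurable $x:[0,2\pi]\to\mathbb{C}$ with $\|x\|_{\Lambda(\varphi)}:=\int_0^{2\pi}x^*(t)\,d\varphi(t)<\infty$. Let $\mathbb{D}=\{z\in\mathbb{C}:|z|<1\}$. The Hardy-Lorentz space $H(\Lambda(\varphi))$ consists of all analytic functions $f:\mathbb{D}\to\mathbb{C}$ with $\|f\|_{H(\Lambda(\varphi))}:=\sup_{0\le r<1}\|f_r\|_{\Lambda(\varphi)}<\infty$, where $f_r(t):=f(re^{it})$, $t\in[0,2\pi]$. Every such $f$ belongs to the classical Hardy space $H^1$ and hence has nontangential limits $f(e^{it}):=\lim_{z\to e^{it}}f(z)$ for almost all $t\in[0,2\pi]$.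 A function $\varphi$ on $[0,2\pi]$ is strictly concave if $\varphi((1-\alpha)t_1+\alpha t_2)>(1-\alpha)\varphi(t_1)+\alpha\varphi(t_2)$ for all $\alpha\in(0,1)$ and all $t_1\ne t_2$ in $[0,2\pi]$. A point $x_0$ of the closed unit ball $\{x:\|x\|\le 1\}$ of a Banach space is extreme if it is not the midpoint of any nondegenerate segment contained in the ball. *)

theory Defs
  imports "HOL-Analysis.Analysis"
begin

definition strictly_concave_on :: "real set \<Rightarrow> (real \<Rightarrow> real) \<Rightarrow> bool" where
  "strictly_concave_on S \<phi> \<longleftrightarrow>
     (\<forall>\<alpha>\<in>{0<..<1}. \<forall>t1\<in>S. \<forall>t2\<in>S. t1 \<noteq> t2 \<longrightarrow>
        \<phi> ((1 - \<alpha>) * t1 + \<alpha> * t2) > (1 - \<alpha>) * \<phi> t1 + \<alpha> * \<phi> t2)"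

(* Meaningful for measurable x and t > 0: the set under the infimum is then nonempty, because
   the interval has finite measure. *)
definition decr_rearr :: "(real \<Rightarrow> complex) \<Rightarrow> real \<Rightarrow> real" where
  "decr_rearr x t =
     Inf {\<tau>. 0 \<le> \<tau> \<and> emeasure lebesgue {s\<in>{0..2*pi}. cmod (x s) > \<tau>} \<le> ennreal t}"

(* interval_measure expects a monotone function on the whole line, so phi is continued by
   constants outside [0, 2 pi], which adds no mass. For phi continuous the point 0 carries no
   mass either, and the integral over (0, 2 pi] is the Stieltjes integral with respect to phi. *)
definition lorentz_norm :: "(real \<Rightarrow> real) \<Rightarrow> (real \<Rightarrow> complex) \<Rightarrow> ennreal" where
  "lorentz_norm \<phi> x =
     (\<integral>\<^sup>+t\<in>{0<..2*pi}. ennreal (decr_rearr x t)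
        \<partial>interval_measure (\<lambda>t. \<phi> (max 0 (min (2*pi) t))))"

definition hardy_lorentz_norm :: "(real \<Rightarrow> real) \<Rightarrow> (complex \<Rightarrow> complex) \<Rightarrow> ennreal" where
  "hardy_lorentz_norm \<phi> f = (SUP r\<in>{0..<1}. lorentz_norm \<phi> (\<lambda>t. f (of_real r * cis t)))"

(* An analytic function on the disc is represented by any total function that is analytic there;
   values outside the disc are irrelevant, and two such functions are the same element of the
   space iff they agree on the disc. *)
definition hardy_lorentz :: "(real \<Rightarrow> real) \<Rightarrow> (complex \<Rightarrow> complex) set" where
  "hardy_lorentz \<phi> = {f. f analytic_on ball 0 1 \<and> hardy_lorentz_norm \<phi> f < \<infinity>}"

definition hardy_lorentz_unit_ball :: "(real \<Rightarrow> real) \<Rightarrow> (complex \<Rightarrow> complex) set" where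
  "hardy_lorentz_unit_ball \<phi> = {f \<in> hardy_lorentz \<phi>. hardy_lorentz_norm \<phi> f \<le> 1}"

(* The library's extreme_point_of needs a real_vector type, and would distinguish functions that
   differ only outside the disc. *)
definition extreme_in_hardy_lorentz_ball ::
    "(real \<Rightarrow> real) \<Rightarrow> (complex \<Rightarrow> complex) \<Rightarrow> bool" where
  "extreme_in_hardy_lorentz_ball \<phi> f \<longleftrightarrow>
     f \<in> hardy_lorentz_unit_ball \<phi> \<and>
     \<not> (\<exists>g h. (\<exists>z\<in>ball 0 1. g z \<noteq> h z) \<and>
          (\<forall>u\<in>{0..1::real}.
             (\<lambda>z. of_real (1 - u) * g z + of_real u * h z) \<in> hardy_lorentz_unit_ball \<phi>) \<and>
          (\<forall>z\<in>ball 0 1. f z = (g z + h z) / 2))"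

definition stolz_region :: "complex \<Rightarrow> real \<Rightarrow> complex set" where
  "stolz_region \<zeta> a = {z \<in> ball 0 1. cmod (z - \<zeta>) < a * (1 - cmod z)}"

definition has_nontangential_limit ::
    "(complex \<Rightarrow> complex) \<Rightarrow> complex \<Rightarrow> complex \<Rightarrow> bool" where
  "has_nontangential_limit f \<zeta> L \<longleftrightarrow>
     (\<forall>a>1. (f \<longlongrightarrow> L) (at \<zeta> within stolz_region \<zeta> a))"

(* Unspecified at the points t where there is no nontangential limit; for f in H^1 these form a
   null set. *)
definition boundary_value :: "(complex \<Rightarrow> complex) \<Rightarrow> real \<Rightarrow> complex" where
  "boundary_value f t = (THE L. has_nontangential_limit f (cis t) L)"

lemma has_nontangential_limit_unique:
  assumes "cmod \<zeta> = 1" "has_nontangential_limit f \<zeta> L" "has_nontangential_limit f \<zeta> M"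
  shows "L = M"
proof -
  have "\<zeta> islimpt stolz_region \<zeta> 2"
    unfolding islimpt_approachable
  proof (intro allI impI)
    fix e :: real assume "e > 0"
    define d where "d = min (e/2) (1/2)"
    define z where "z = of_real (1 - d) * \<zeta>"
    have d: "0 < d" "d < e" "d \<le> 1/2" using \<open>e > 0\<close> by (auto simp: d_def min_def)
    have nz: "cmod z = 1 - d" using d assms(1)
      by (simp add: z_def norm_mult del: of_real_diff)
    have "z - \<zeta> = - (of_real d * \<zeta>)" by (simp add: z_def algebra_simps)
    then have nd: "cmod (z - \<zeta>) = d" using d assms(1) by (simp add: norm_mult)
    have "z \<in> stolz_region \<zeta> 2" using nz nd d by (simp add: stolz_region_def)
    moreover have "z \<noteq> \<zeta>" using nd d by auto
    moreover have "dist z \<zeta> < e" using nd d by (simp add: dist_norm)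
    ultimately show "\<exists>x'\<in>stolz_region \<zeta> 2. x' \<noteq> \<zeta> \<and> dist x' \<zeta> < e" by blast
  qed
  then have "at \<zeta> within stolz_region \<zeta> 2 \<noteq> bot"
    by (simp add: trivial_limit_within)
  moreover have "(f \<longlongrightarrow> L) (at \<zeta> within stolz_region \<zeta> 2)"
    using assms(2) by (simp add: has_nontangential_limit_def)
  moreover have "(f \<longlongrightarrow> M) (at \<zeta> within stolz_region \<zeta> 2)"
    using assms(3) by (simp add: has_nontangential_limit_def)
  ultimately show ?thesis by (rule tendsto_unique)
qed

end

theory Submission
  imports Defs "HOL-Complex_Analysis.Complex_Analysis"
begin

text \<open>Let \<open>f = (g + h) / 2\<close> with \<open>g\<close>, \<open>h\<close> in the unit ball, and write \<open>N\<close> for the Lorentz norm, which is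
  the Choquet integral \<open>\<integral> \<phi> (m {x > \<tau>}) d\<tau>\<close>.  As \<open>r \<rightarrow> 1\<close> the deficit \<open>N g\<^sub>r + N h\<^sub>r - 2 N f\<^sub>r\<close> tends to \<open>0\<close>.
  Strict monotonicity and strict concavity of \<open>\<phi>\<close> bound this deficit from below by quantities that
  survive almost everywhere convergence on the circle.  Hence the boundary values satisfy
  \<open>|g + h| = |g| + |h|\<close>, and \<open>|g|\<close>, \<open>|h|\<close> are never ordered oppositely on sets of positive measure.  Where
  \<open>|f|\<close> is constant, \<open>|g|\<close> and \<open>|h|\<close> have constant sum, so both are constant there, and \<open>g = k f\<close> on a boundary set
  of positive measure.  Boundary uniqueness gives \<open>g = k f\<close> in the disc, and the norms force \<open>k = 1\<close>.
  Working with the deficit for \<open>r < 1\<close> avoids representing functions by their boundary values.\<close>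

text \<open>The norm is a supremum over r < 1 while the hypothesis lives on the circle, and almost
  everywhere convergence alone carries norms in neither direction. Only a one-sided link is used: a
  strict inequality between boundary limits on a set of positive measure holds, for all radii of a
  sequence close to 1, on sets of measure at least a fixed \<eta>, and there it costs a fixed
  \<delta> in the norm. That \<delta> is uniform because \<phi> is continuous on a compact interval.
  The deficit tends to 0 because the circle norms of f increase with r to 1 while those of g and h
  stay at most 1; the increase rests on rotation invariance and subadditivity of the norm, and
  subadditivity is proved combinatorially, for functions with integer values. The two facts about
  H^1, nontangential limits and boundary uniqueness, are first proved for bounded functions and
  carried over by writing f as a quotient of bounded functions. For bounded functions the limits
  come from differentiating a Lipschitz primitive along the circle.\<close>

section \<open>Almost everywhere differentiability of Lipschitz functions\<close>

text \<open>A closed interval is the closed ball about its midpoint, so this is the Vitali covering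
  theorem for balls. The predicate \<open>P\<close> will carry a bound on the slope over the
  interval; since the intervals offered at a point are arbitrarily short, those that leave
  \<open>G\<close> can be discarded.\<close>

lemma Vitali_covering_intervals:
  fixes S G :: "real set"
  assumes "open G" "S \<subseteq> G"
    and fine: "\<And>x d. x \<in> S \<Longrightarrow> 0 < d \<Longrightarrow> \<exists>a b. a < b \<and> x \<in> {a..b} \<and> b - a < d \<and> P a b"
  obtains C where "countable C" "\<And>a b. (a, b) \<in> C \<Longrightarrow> a < b \<and> P a b \<and> {a..b} \<subseteq> G"
    "disjoint_family_on (\<lambda>(a, b). {a..b}) C" "negligible (S - (\<Union>(a, b)\<in>C. {a..b}))"
proof -
  define K where "K = {(a, b). a < b \<and> P a b \<and> {a..b} \<subseteq> G}"
  define m where "m = (\<lambda>(a::real, b). (a + b) / 2)"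
  define r where "r = (\<lambda>(a::real, b). (b - a) / 2)"
  have cb: "cball (m i) (r i) = (\<lambda>(a, b). {a..b}) i" for i
    by (cases i) (auto simp: m_def r_def cball_eq_atLeastAtMost field_simps)
  have 1: "0 < r i" if "i \<in> K" for i using that by (auto simp: K_def r_def)
  have 2: "\<exists>i. i \<in> K \<and> x \<in> cball (m i) (r i) \<and> r i < d" if x: "x \<in> S" "0 < d" for x d
  proof -
    obtain e where e: "e > 0" "ball x e \<subseteq> G" using assms(1,2) x by (meson open_contains_ball subsetD)
    obtain a b where ab: "a < b" "x \<in> {a..b}" "b - a < min d e" "P a b"
      using fine[OF x(1), of "min d e"] e x by auto
    have "{a..b} \<subseteq> ball x e" using ab by (auto simp: dist_real_def)
    with e have "(a, b) \<in> K" using ab by (auto simp: K_def)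
    moreover have "r (a, b) < d" using ab x by (auto simp: r_def)
    ultimately show ?thesis using ab cb[of "(a,b)"] by (intro exI[of _ "(a,b)"]) auto
  qed
  obtain C where C: "countable C" "C \<subseteq> K"
     "pairwise (\<lambda>i j. disjnt (cball (m i) (r i)) (cball (m j) (r j))) C"
     "negligible(S - (\<Union>i \<in> C. cball (m i) (r i)))"
    using Vitali_covering_theorem_cballs[of K r S m] 1 2 by blast
  show thesis
  proof
    show "countable C" by fact
    show "a < b \<and> P a b \<and> {a..b} \<subseteq> G" if "(a, b) \<in> C" for a b
      using that C(2) by (auto simp: K_def)
    show "disjoint_family_on (\<lambda>(a, b). {a..b}) C"
      using C(3) unfolding cb by (auto simp: disjoint_family_on_def pairwise_def disjnt_def)
    show "negligible (S - (\<Union>(a, b)\<in>C. {a..b}))"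
      using C(4) unfolding cb by simp
  qed
qed

text \<open>The infimum is the outer measure of \<open>E\<close>, used because the exceptional sets
  of differentiation are not known to be measurable. Adding the null set \<open>E - H\<close> to
  \<open>H\<close> leaves its measure unchanged and gives a measurable set containing
  \<open>E\<close>, which outer regularity approximates by open sets.\<close>

lemma emeasure_lebesgue_outer_le:
  fixes E H :: "real set"
  assumes "H \<in> sets lebesgue" "negligible (E - H)"
  shows "(INF G\<in>{G. open G \<and> E \<subseteq> G}. emeasure lebesgue G) \<le> emeasure lebesgue H"
proof (rule ennreal_le_epsilon)
  fix e :: real assume e: "0 < e"
  have N: "E - H \<in> null_sets lebesgue" using assms(2) by (simp add: negligible_iff_null_sets)
  have "H \<union> (E - H) \<in> sets lebesgue" by (rule sets.Un[OF assms(1) null_setsD2[OF N]])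
  from sets_lebesgue_outer_open[OF this e]
  obtain T where T: "open T" "H \<union> (E - H) \<subseteq> T" "T - (H \<union> (E-H)) \<in> lmeasurable"
     "emeasure lebesgue (T - (H \<union> (E-H))) < ennreal e" by blast
  have "(INF G\<in>{G. open G \<and> E \<subseteq> G}. emeasure lebesgue G) \<le> emeasure lebesgue T"
    using T by (intro INF_lower) auto
  also have "\<dots> = emeasure lebesgue ((H \<union> (T - (H \<union> (E-H)))) \<union> (E - H))"
    using T by (intro arg_cong[where f="emeasure lebesgue"]) auto
  also have "\<dots> = emeasure lebesgue (H \<union> (T - (H \<union> (E-H))))"
    using assms T N by (intro emeasure_Un_null_set) auto
  also have "\<dots> \<le> emeasure lebesgue H + emeasure lebesgue (T - (H \<union> (E-H)))"
    using assms T by (intro emeasure_subadditive) auto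
  also have "\<dots> \<le> emeasure lebesgue H + ennreal e"
    using T by (intro add_left_mono) auto
  finally show "(INF G\<in>{G. open G \<and> E \<subseteq> G}. emeasure lebesgue G) \<le> emeasure lebesgue H + ennreal e" .
qed

text \<open>Intervals of slope at most \<open>p\<close> that cover \<open>E\<close> inside an open
  \<open>G\<close> have a total increment of \<open>F\<close> of at most \<open>p\<close> times the
  length of \<open>G\<close>. Covering \<open>E\<close> once more, inside those, by intervals of
  slope at least \<open>q\<close> gives a total increment of at least \<open>q\<close> times the
  outer measure \<open>M\<close> of \<open>E\<close>. As \<open>G\<close> shrinks to
  \<open>E\<close>, this yields \<open>q * M \<le> p * M\<close>. The Stieltjes measure of
  \<open>F\<close> makes the two totals comparable by plain inclusion.\<close>

lemma negligible_two_slopes: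
  fixes F :: "real \<Rightarrow> real" and E :: "real set"
  assumes "mono F" "continuous_on UNIV F" "0 \<le> p" "p < q" "bounded E"
    and low: "\<And>x d. x \<in> E \<Longrightarrow> 0 < d \<Longrightarrow>
       \<exists>a b. a < b \<and> x \<in> {a..b} \<and> b - a < d \<and> F b - F a \<le> p * (b - a)"
    and upp: "\<And>x d. x \<in> E \<Longrightarrow> 0 < d \<Longrightarrow>
       \<exists>a b. a < b \<and> x \<in> {a..b} \<and> b - a < d \<and> q * (b - a) \<le> F b - F a"
  shows "negligible E"
proof -
  define M where "M = (INF G\<in>{G. open G \<and> E \<subseteq> G}. emeasure lebesgue G)"
  let ?\<mu> = "interval_measure F"
  have mono: "x \<le> y \<Longrightarrow> F x \<le> F y" for x y using assms(1) by (auto dest: monoD)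
  have muI: "emeasure ?\<mu> {a..b} = ennreal (F b - F a)" if "a < b" for a b
    using emeasure_interval_measure_Icc[OF _ mono assms(2), of a b] that by auto
  have leI: "emeasure lebesgue {a..b} = ennreal (b - a)" if "a < b" for a b :: real
    using that by simp
  obtain B where B: "E \<subseteq> ball 0 B" using assms(5) bounded_subset_ballD by blast
  have "M \<le> emeasure lebesgue (ball (0::real) B)" unfolding M_def using B by (intro INF_lower) auto
  also have "\<dots> < \<infinity>" using emeasure_lborel_ball_finite[of "0::real" B] by (simp add: less_top)
  finally have Mfin: "M < \<infinity>" .
  have key: "ennreal q * M \<le> ennreal p * emeasure lebesgue G" if G: "open G" "E \<subseteq> G" for G
  proof -
    obtain C where C: "countable C" "\<And>a b. (a, b) \<in> C \<Longrightarrow> a < b \<and> F b - F a \<le> p * (b - a) \<and> {a..b} \<subseteq> G"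
      "disjoint_family_on (\<lambda>(a, b). {a..b}) C" "negligible (E - (\<Union>(a, b)\<in>C. {a..b}))"
      using Vitali_covering_intervals[OF G, of "\<lambda>a b. F b - F a \<le> p * (b - a)"] low by blast
    \<comment> \<open>The second covering must take place inside an open set; passing to open
      intervals loses only countably many endpoints.\<close>
    define G' where "G' = (\<Union>(a, b)\<in>C. {a<..<b})"
    have G': "open G'" unfolding G'_def by auto
    have G'sub: "G' \<subseteq> (\<Union>(a, b)\<in>C. {a..b})" unfolding G'_def by fastforce
    have "(\<Union>(a, b)\<in>C. {a..b}) - G' \<subseteq> fst ` C \<union> snd ` C"
      unfolding G'_def by (force simp: image_iff less_le)
    moreover have "negligible (fst ` C \<union> snd ` C)"
      unfolding negligible_iff_null_sets
      using C(1) by (intro null_sets_completionI countable_imp_null_set_lborel) auto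
    ultimately have N: "negligible ((\<Union>(a, b)\<in>C. {a..b}) - G')"
      by (rule negligible_subset[rotated])
    have EG': "negligible (E - G')"
      by (rule negligible_subset[OF negligible_Un[OF C(4) N]]) auto
    obtain D where D: "countable D" "\<And>a b. (a, b) \<in> D \<Longrightarrow> a < b \<and> q * (b - a) \<le> F b - F a \<and> {a..b} \<subseteq> G'"
      "disjoint_family_on (\<lambda>(a, b). {a..b}) D" "negligible (E \<inter> G' - (\<Union>(a, b)\<in>D. {a..b}))"
    proof (rule Vitali_covering_intervals[OF G' Int_lower2[of E G'], of "\<lambda>a b. q * (b - a) \<le> F b - F a"])
      show "\<exists>a b. a < b \<and> x \<in> {a..b} \<and> b - a < d \<and> q * (b - a) \<le> F b - F a"
        if "x \<in> E \<inter> G'" "0 < d" for x d using upp[of x d] that by auto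
    qed (rule that)
    have ED: "negligible (E - (\<Union>(a, b)\<in>D. {a..b}))"
      by (rule negligible_subset[OF negligible_Un[OF EG' D(4)]]) auto
    have meas: "(case i of (a, b) \<Rightarrow> {a..b}) \<in> sets lebesgue" "(case i of (a, b) \<Rightarrow> {a..b}) \<in> sets ?\<mu>" for i :: "real \<times> real"
      by (cases i; simp)+
    have sm: "emeasure lebesgue (\<Union>(a, b)\<in>C. {a..b}) = (\<integral>\<^sup>+i. emeasure lebesgue (case i of (a, b) \<Rightarrow> {a..b}) \<partial>count_space C)"
             "emeasure ?\<mu> (\<Union>(a, b)\<in>C. {a..b}) = (\<integral>\<^sup>+i. emeasure ?\<mu> (case i of (a, b) \<Rightarrow> {a..b}) \<partial>count_space C)"
             "emeasure lebesgue (\<Union>(a, b)\<in>D. {a..b}) = (\<integral>\<^sup>+i. emeasure lebesgue (case i of (a, b) \<Rightarrow> {a..b}) \<partial>count_space D)"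
             "emeasure ?\<mu> (\<Union>(a, b)\<in>D. {a..b}) = (\<integral>\<^sup>+i. emeasure ?\<mu> (case i of (a, b) \<Rightarrow> {a..b}) \<partial>count_space D)"
      using C D meas by (intro emeasure_UN_countable; force)+
    have uC: "(\<Union>(a, b)\<in>C. {a..b}) \<in> sets lebesgue" "(\<Union>(a, b)\<in>C. {a..b}) \<in> sets ?\<mu>"
      "(\<Union>(a, b)\<in>D. {a..b}) \<in> sets lebesgue" "(\<Union>(a, b)\<in>D. {a..b}) \<in> sets ?\<mu>"
      using C D meas by (intro sets.countable_UN'; force)+
    have "ennreal q * M \<le> ennreal q * emeasure lebesgue (\<Union>(a, b)\<in>D. {a..b})"
      unfolding M_def by (intro mult_left_mono emeasure_lebesgue_outer_le uC ED) auto
    also have "\<dots> = (\<integral>\<^sup>+i. ennreal q * emeasure lebesgue (case i of (a, b) \<Rightarrow> {a..b}) \<partial>count_space D)"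
      unfolding sm by (rule nn_integral_cmult[symmetric]) simp
    also have "\<dots> \<le> (\<integral>\<^sup>+i. emeasure ?\<mu> (case i of (a, b) \<Rightarrow> {a..b}) \<partial>count_space D)"
    proof (intro nn_integral_mono, clarsimp simp del: emeasure_completion, goal_cases)
      case (1 a b)
      then show ?case using D(2)[OF 1] assms(3,4)
        by (simp add: muI ennreal_mult[symmetric] ennreal_leI)
    qed
    also have "\<dots> = emeasure ?\<mu> (\<Union>(a, b)\<in>D. {a..b})" unfolding sm ..
    also have "\<dots> \<le> emeasure ?\<mu> (\<Union>(a, b)\<in>C. {a..b})"
      using D(2) G'sub uC by (intro emeasure_mono) blast+
    also have "\<dots> = (\<integral>\<^sup>+i. emeasure ?\<mu> (case i of (a, b) \<Rightarrow> {a..b}) \<partial>count_space C)" unfolding sm ..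
    also have "\<dots> \<le> (\<integral>\<^sup>+i. ennreal p * emeasure lebesgue (case i of (a, b) \<Rightarrow> {a..b}) \<partial>count_space C)"
    proof (intro nn_integral_mono, clarsimp simp del: emeasure_completion, goal_cases)
      case (1 a b)
      then show ?case using C(2)[OF 1] assms(3,4)
        by (simp add: muI ennreal_mult[symmetric] ennreal_leI)
    qed
    also have "\<dots> = ennreal p * emeasure lebesgue (\<Union>(a, b)\<in>C. {a..b})"
      unfolding sm by (rule nn_integral_cmult) simp
    also have "\<dots> \<le> ennreal p * emeasure lebesgue G"
      using C(2) G by (intro mult_left_mono emeasure_mono) (auto simp: borel_open)
    finally show ?thesis .
  qed
  obtain m where m: "M = ennreal m" "m \<ge> 0" using Mfin by (cases M) auto
  have "q * m \<le> p * m"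
  proof (rule field_le_epsilon)
    fix e :: real assume e: "0 < e"
    define d where "d = e / (p + 1)"
    have d: "0 < d" "p * d \<le> e" using e assms(3) by (auto simp: d_def field_simps)
    have "M < ennreal (m + d)" using m d by (simp add: ennreal_less_iff)
    then obtain G where G: "open G" "E \<subseteq> G" "emeasure lebesgue G < ennreal (m + d)"
      unfolding M_def INF_less_iff by auto
    have "ennreal q * M \<le> ennreal p * ennreal (m + d)"
      using key[OF G(1,2)] G(3) by (meson less_imp_le mult_left_mono order_trans zero_le)
    then have "q * m \<le> p * (m + d)"
      using assms(3,4) m d by (simp add: ennreal_mult[symmetric] del: ennreal_plus)
    then show "q * m \<le> p * m + e" using d by (simp add: algebra_simps)
  qed
  then have "m = 0" using assms(4) m by (metis mult_le_cancel_right not_le order_antisym_conv)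
  then have M0: "M = 0" using m by simp
  show ?thesis unfolding negligible_outer
  proof (intro allI impI)
    fix e :: real assume "e > 0"
    then have "M < ennreal e" using M0 by simp
    then obtain G where G: "open G" "E \<subseteq> G" "emeasure lebesgue G < ennreal e"
      unfolding M_def INF_less_iff by auto
    have "G \<in> lmeasurable" using G by (intro fmeasurableI) (auto simp: borel_open less_top[symmetric] dest: less_trans)
    moreover have "measure lebesgue G < e"
      using G(3) \<open>e > 0\<close> emeasure_eq_measure2[OF \<open>G \<in> lmeasurable\<close>] by (simp add: ennreal_less_iff)
    ultimately show "\<exists>T. E \<subseteq> T \<and> T \<in> lmeasurable \<and> measure lebesgue T < e"
      using G by blast
  qed
qed

text \<open>The limit is the supremum of the eventual lower bounds: if values above some larger
  number kept occurring, two rationals in between would violate \<open>gap\<close>. Rational levels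
  make the exceptional set of differentiation a countable union.\<close>

lemma tendsto_if_no_gap:
  fixes Q :: "'a \<Rightarrow> real"
  assumes bdd: "\<forall>\<^sub>F x in F. \<bar>Q x\<bar> \<le> L" and "F \<noteq> bot"
    and gap: "\<And>p q. p \<in> \<rat> \<Longrightarrow> q \<in> \<rat> \<Longrightarrow> p < q \<Longrightarrow>
       \<not> ((\<exists>\<^sub>F x in F. Q x < p) \<and> (\<exists>\<^sub>F x in F. q < Q x))"
  shows "\<exists>c. (Q \<longlongrightarrow> c) F"
proof -
  define A where "A = {p. \<forall>\<^sub>F x in F. p \<le> Q x}"
  have A1: "-L \<in> A" unfolding A_def using bdd by (auto elim!: eventually_mono)
  have A2: "p \<le> L" if "p \<in> A" for p
  proof -
    have "\<forall>\<^sub>F x in F. p \<le> L" using that bdd unfolding A_def mem_Collect_eq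
      by eventually_elim auto
    then show ?thesis using \<open>F \<noteq> bot\<close> by simp
  qed
  have bddA: "bdd_above A" using A2 by (auto simp: bdd_above_def)
  show ?thesis
  proof (intro exI[of _ "Sup A"] order_tendstoI)
    fix a assume "a < Sup A"
    then obtain p where "p \<in> A" "a < p" using less_cSup_iff[OF _ bddA] A1 by blast
    then show "\<forall>\<^sub>F x in F. a < Q x" unfolding A_def by (auto elim!: eventually_mono)
  next
    fix a assume "Sup A < a"
    obtain p where p: "p \<in> \<rat>" "Sup A < p" "p < a" using Rats_dense_in_real[OF \<open>Sup A < a\<close>] by blast
    obtain q where q: "q \<in> \<rat>" "p < q" "q < a" using Rats_dense_in_real[OF \<open>p < a\<close>] by blast
    have "p \<notin> A" using p cSup_upper[OF _ bddA] by force
    then have "\<exists>\<^sub>F x in F. Q x < p" unfolding A_def frequently_def by (simp add: not_less)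
    then have "\<not> (\<exists>\<^sub>F x in F. q < Q x)" using gap[OF p(1) q(1,2)] by blast
    then have "\<forall>\<^sub>F x in F. Q x \<le> q" by (simp add: frequently_def not_less)
    then show "\<forall>\<^sub>F x in F. Q x < a" using q by (auto elim!: eventually_mono)
  qed
qed

text \<open>The Lipschitz constant bounds the difference quotients, so where they do not converge
  they oscillate across a pair of rationals, and \<open>negligible_two_slopes\<close> applies to
  each pair.\<close>

lemma mono_lipschitz_differentiable_ae:
  fixes F :: "real \<Rightarrow> real"
  assumes "mono F" "L-lipschitz_on UNIV F" "bounded S"
  shows "negligible {x\<in>S. \<not> (\<exists>D. (F has_real_derivative D) (at x))}"
proof -
  define Q where "Q = (\<lambda>x y. (F y - F x) / (y - x))"
  define E where "E = (\<lambda>p q. {x\<in>S. (\<exists>\<^sub>F y in at x. Q x y < p) \<and> (\<exists>\<^sub>F y in at x. q < Q x y)})"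
  have mono: "x \<le> y \<Longrightarrow> F x \<le> F y" for x y using assms(1) by (auto dest: monoD)
  have Qnn: "Q x y \<ge> 0" for x y
    unfolding Q_def using mono[of x y] mono[of y x] by (cases "x \<le> y") (auto simp: divide_nonpos_nonpos)
  have QL: "\<bar>Q x y\<bar> \<le> L" for x y
  proof (cases "x = y")
    case True then show ?thesis using lipschitz_on_nonneg[OF assms(2)] by (simp add: Q_def)
  next
    case False
    then show ?thesis using lipschitz_onD[OF assms(2), of y x]
      by (simp add: Q_def dist_real_def divide_le_eq)
  qed
  have freq: "\<exists>a b. a < b \<and> x \<in> {a..b} \<and> b - a < d \<and> P ((F b - F a) / (b - a))"
    if "\<exists>\<^sub>F y in at x. P (Q x y)" "0 < d" for x d P
  proof -
    from that have "\<exists>y. y \<noteq> x \<and> dist y x < d \<and> P (Q x y)"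
      unfolding frequently_at by blast
    then obtain y where y: "y \<noteq> x" "dist y x < d" "P (Q x y)" by blast
    show ?thesis
    proof (cases "x < y")
      case True then show ?thesis using y by (intro exI[of _ x] exI[of _ y]) (auto simp: Q_def dist_real_def)
    next
      case False
      have "(F y - F x) / (y - x) = (F x - F y) / (x - y)" by (metis minus_diff_eq minus_divide_divide)
      then show ?thesis using y False by (intro exI[of _ y] exI[of _ x]) (auto simp: Q_def dist_real_def)
    qed
  qed
  have neg: "negligible (E p q)" if "p < q" for p q
  proof (cases "p > 0")
    case False
    then have "E p q = {}" using Qnn unfolding E_def
      by (auto simp: frequently_def) (smt (verit, best) always_eventually)
    then show ?thesis by simp
  next
    case True
    show ?thesis
    proof (rule negligible_two_slopes[of F p q])
      show "continuous_on UNIV F" using assms(2) by (rule lipschitz_on_continuous_on)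
      show "bounded (E p q)" using assms(3) by (rule bounded_subset) (auto simp: E_def)
      show "\<exists>a b. a < b \<and> x \<in> {a..b} \<and> b - a < d \<and> F b - F a \<le> p * (b - a)"
        if "x \<in> E p q" "0 < d" for x d
        using freq[of "\<lambda>v. v < p" x d] that unfolding E_def by (fastforce simp: divide_less_eq)
      show "\<exists>a b. a < b \<and> x \<in> {a..b} \<and> b - a < d \<and> q * (b - a) \<le> F b - F a"
        if "x \<in> E p q" "0 < d" for x d
        using freq[of "\<lambda>v. q < v" x d] that unfolding E_def by (fastforce simp: less_divide_eq)
    qed (use assms that True in auto)
  qed
  have "{x\<in>S. \<not> (\<exists>D. (F has_real_derivative D) (at x))} \<subseteq> (\<Union>(p,q)\<in>{(p,q). p \<in> \<rat> \<and> q \<in> \<rat> \<and> p < q}. E p q)"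
  proof (rule subsetI, rule ccontr)
    fix x assume x: "x \<in> {x\<in>S. \<not> (\<exists>D. (F has_real_derivative D) (at x))}"
      and "x \<notin> (\<Union>(p,q)\<in>{(p,q). p \<in> \<rat> \<and> q \<in> \<rat> \<and> p < q}. E p q)"
    then have "\<exists>c. (Q x \<longlongrightarrow> c) (at x)"
      using QL by (intro tendsto_if_no_gap[where L = L]) (auto simp: E_def)
    then show False using x unfolding Q_def has_field_derivative_iff by auto
  qed
  moreover have "negligible (\<Union>(p,q)\<in>{(p,q). p \<in> \<rat> \<and> q \<in> \<rat> \<and> p < q}. E p q)"
  proof (rule negligible_countable_Union)
    have "countable (\<rat> \<times> \<rat> :: (real \<times> real) set)" by (simp add: countable_rat)
    then show "countable ((\<lambda>(p,q). E p q) ` {(p,q). p \<in> \<rat> \<and> q \<in> \<rat> \<and> p < q})"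
      by (intro countable_image) (erule countable_subset[rotated], auto)
  qed (use neg in auto)
  ultimately show ?thesis using negligible_subset by blast
qed

text \<open>Adding \<open>L * x\<close> makes the function monotone, at the price of doubling the
  Lipschitz constant.\<close>

lemma lipschitz_differentiable_ae:
  fixes G :: "real \<Rightarrow> real"
  assumes "L-lipschitz_on UNIV G" "bounded S"
  shows "negligible {x\<in>S. \<not> (\<exists>D. (G has_real_derivative D) (at x))}"
proof -
  let ?F = "\<lambda>x. G x + L * x"
  have L: "L \<ge> 0" using assms(1) by (rule lipschitz_on_nonneg)
  have G: "\<bar>G x - G y\<bar> \<le> L * \<bar>x - y\<bar>" for x y
    using lipschitz_onD[OF assms(1), of x y] by (simp add: dist_real_def)
  have "mono ?F"
  proof (rule monoI)
    fix x y :: real assume "x \<le> y"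
    then show "?F x \<le> ?F y" using G[of x y] by (simp add: algebra_simps)
  qed
  moreover have "(2 * L)-lipschitz_on UNIV ?F"
  proof (rule lipschitz_onI)
    fix x y show "dist (?F x) (?F y) \<le> 2 * L * dist x y"
    proof -
      have "\<bar>(G x - G y) + L * (x - y)\<bar> \<le> \<bar>G x - G y\<bar> + \<bar>L * (x - y)\<bar>" by (rule abs_triangle_ineq)
      also have "\<dots> \<le> 2 * L * \<bar>x - y\<bar>" using G[of x y] L by (simp add: abs_mult)
      finally show ?thesis by (simp add: dist_real_def algebra_simps)
    qed
  qed (use L in auto)
  ultimately have "negligible {x\<in>S. \<not> (\<exists>D. (?F has_real_derivative D) (at x))}"
    using assms(2) by (rule mono_lipschitz_differentiable_ae)
  moreover have "\<exists>D. (G has_real_derivative D) (at x)" if "(?F has_real_derivative D) (at x)" for x D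
  proof -
    have "((\<lambda>x. ?F x - L * x) has_real_derivative (D - L * 1)) (at x)"
      by (rule DERIV_diff[OF that DERIV_cmult[OF DERIV_ident]])
    then show ?thesis by auto
  qed
  ultimately show ?thesis by (elim negligible_subset) blast
qed

lemma lipschitz_vector_differentiable_ae:
  fixes G :: "real \<Rightarrow> complex"
  assumes "L-lipschitz_on UNIV G" "bounded S"
  shows "negligible {x\<in>S. \<not> (\<exists>D. (G has_vector_derivative D) (at x))}"
proof -
  have L: "L \<ge> 0" using assms(1) by (rule lipschitz_on_nonneg)
  have "\<bar>Re (G x) - Re (G y)\<bar> \<le> L * \<bar>x - y\<bar> \<and> \<bar>Im (G x) - Im (G y)\<bar> \<le> L * \<bar>x - y\<bar>" for x y
    using lipschitz_onD[OF assms(1), of x y] abs_Re_le_cmod[of "G x - G y"] abs_Im_le_cmod[of "G x - G y"]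
    by (simp add: dist_norm)
  then have "L-lipschitz_on UNIV (\<lambda>x. Re (G x))" "L-lipschitz_on UNIV (\<lambda>x. Im (G x))"
    using L by (auto intro!: lipschitz_onI simp: dist_real_def)
  from negligible_Un[OF this[THEN lipschitz_differentiable_ae[OF _ assms(2)]]]
  show ?thesis
  proof (rule negligible_subset, safe, goal_cases)
    case (1 x)
    then have "\<exists>D E. ((\<lambda>x. Re (G x)) has_real_derivative D) (at x) \<and> ((\<lambda>x. Im (G x)) has_real_derivative E) (at x)"
      by blast
    then obtain D E where "((\<lambda>x. Re (G x)) has_real_derivative D) (at x)" "((\<lambda>x. Im (G x)) has_real_derivative E) (at x)"
      by blast
    then have "(G has_vector_derivative Complex D E) (at x)"
      by (simp add: has_vector_derivative_complex_iff)
    then show ?case using 1 by blast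
  qed
qed

section \<open>Poisson and Herglotz integrals\<close>

abbreviation circle_measure :: "real measure" where
  "circle_measure \<equiv> lebesgue_on {0..2*pi}"

definition poisson_kernel :: "complex \<Rightarrow> real \<Rightarrow> real" where
  "poisson_kernel z t = (1 - (cmod z)\<^sup>2) / (cmod (cis t - z))\<^sup>2"

text \<open>Banach-valued, since it is applied to holomorphic functions as well as to their moduli.
  The factor 1 / (2 pi) sits here, so \<open>poisson_kernel\<close> has mean 1 over the
  circle.\<close>

definition poisson :: "(real \<Rightarrow> 'a) \<Rightarrow> complex \<Rightarrow> 'a::{banach,second_countable_topology}" where
  "poisson u z = (1 / (2*pi)) *\<^sub>R (\<integral>t. poisson_kernel z t *\<^sub>R u t \<partial>circle_measure)"

lemma finite_measure_circle: "finite_measure circle_measure"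
  by (rule finite_measure_lebesgue_on) auto

lemma measure_circle [simp]: "measure circle_measure {0..2*pi} = 2 * pi"
  by (simp add: measure_restrict_space)

lemma cis_minus_nonzero: "cmod z < 1 \<Longrightarrow> cis t - z \<noteq> 0"
  by (metis eq_iff_diff_eq_0 less_irrefl norm_cis)

lemma poisson_kernel_nonneg: "cmod z < 1 \<Longrightarrow> 0 \<le> poisson_kernel z t"
  unfolding poisson_kernel_def by (intro divide_nonneg_nonneg) (auto simp: abs_square_le_1)

lemma one_minus_le_cis_minus: "1 - cmod z \<le> cmod (cis t - z)"
  using norm_triangle_ineq2[of "cis t" z] by simp

lemma cis_minus_le: "cmod (cis t - z) \<le> 1 + cmod z"
  using norm_triangle_ineq4[of "cis t" z] by simp

lemma poisson_kernel_le:
  assumes "cmod z < 1"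
  shows "poisson_kernel z t \<le> 1 / (1 - cmod z)\<^sup>2"
  unfolding poisson_kernel_def
proof (rule frac_le)
  show "(1 - cmod z)\<^sup>2 \<le> (cmod (cis t - z))\<^sup>2"
    using one_minus_le_cis_minus[of z t] assms by (intro power_mono) auto
qed (use assms in \<open>auto simp: abs_square_le_1\<close>)

lemma poisson_kernel_ge:
  assumes "cmod z < 1"
  shows "(1 - (cmod z)\<^sup>2) / 4 \<le> poisson_kernel z t"
  unfolding poisson_kernel_def
proof (rule divide_left_mono)
  have "(cmod (cis t - z))\<^sup>2 \<le> 2\<^sup>2"
    using cis_minus_le[of t z] assms by (intro power_mono) auto
  then show "(cmod (cis t - z))\<^sup>2 \<le> 4" by simp
qed (use assms cis_minus_nonzero[OF assms] in \<open>auto simp: abs_square_le_1\<close>)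

lemma continuous_on_poisson_kernel: "cmod z < 1 \<Longrightarrow> continuous_on A (poisson_kernel z)"
  unfolding poisson_kernel_def[abs_def]
  by (intro continuous_intros) (auto dest: cis_minus_nonzero)

lemma measurable_poisson_kernel: "cmod z < 1 \<Longrightarrow> poisson_kernel z \<in> borel_measurable circle_measure"
  by (intro continuous_imp_measurable_on_sets_lebesgue continuous_on_poisson_kernel) auto

lemma poisson_kernel_integrable:
  fixes u :: "real \<Rightarrow> 'a::{banach,second_countable_topology}"
  assumes "integrable circle_measure u" "cmod z < 1"
  shows "integrable circle_measure (\<lambda>t. poisson_kernel z t *\<^sub>R u t)"
proof (rule Bochner_Integration.integrable_bound)
  show "integrable circle_measure (\<lambda>t. (1 / (1 - cmod z)\<^sup>2) *\<^sub>R u t)" using assms by simp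
  show "(\<lambda>t. poisson_kernel z t *\<^sub>R u t) \<in> borel_measurable circle_measure"
    using assms measurable_poisson_kernel by (intro borel_measurable_scaleR) auto
  show "AE t in circle_measure. norm (poisson_kernel z t *\<^sub>R u t) \<le> norm ((1 / (1 - cmod z)\<^sup>2) *\<^sub>R u t)"
  proof (rule AE_I2)
    fix t
    have "\<bar>poisson_kernel z t\<bar> * norm (u t) \<le> (1 / (1 - cmod z)\<^sup>2) * norm (u t)"
      using poisson_kernel_le[OF assms(2), of t] poisson_kernel_nonneg[OF assms(2), of t]
      by (intro mult_right_mono) auto
    then show "norm (poisson_kernel z t *\<^sub>R u t) \<le> norm ((1 / (1 - cmod z)\<^sup>2) *\<^sub>R u t)" by simp
  qed
qed

text \<open>Cauchy's formula for the product of \<open>f (r w)\<close> with \<open>(1 - |z|\<^sup>2) / (1 - cnj z w)\<close>,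
  a function whose value at \<open>w = z\<close> is \<open>f (r z)\<close>.\<close>

lemma poisson_formula:
  assumes f: "f holomorphic_on ball 0 1" and r: "0 \<le> r" "r < 1" and z: "cmod z < 1"
  shows "poisson (\<lambda>t. f (of_real r * cis t)) z = f (of_real r * z)"
proof -
  define h where "h = (\<lambda>w. f (of_real r * w) * ((1 - of_real ((cmod z)\<^sup>2)) / (1 - cnj z * w)))"
  have nz: "1 - cnj z * w \<noteq> 0" if "cmod w \<le> 1" for w
  proof
    assume "1 - cnj z * w = 0"
    then have "cmod (cnj z * w) = 1" by simp
    moreover have "cmod z * cmod w \<le> cmod z" using that by (simp add: mult_left_le)
    ultimately show False using z by (simp add: norm_mult)
  qed
  have "(\<lambda>w. f (of_real r * w)) holomorphic_on cball 0 1"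
  proof (rule holomorphic_on_compose_gen[OF _ f, unfolded o_def])
    show "(*) (complex_of_real r) ` cball 0 1 \<subseteq> ball 0 1"
      using r by (auto simp: norm_mult) (smt (verit, ccfv_SIG) mult_left_le)
  qed (auto intro!: holomorphic_intros)
  then have h: "h holomorphic_on cball 0 1"
    unfolding h_def by (intro holomorphic_intros) (use nz in auto)
  have hz: "h z = f (of_real r * z)"
  proof -
    have "1 - complex_of_real ((cmod z)\<^sup>2) = 1 - cnj z * z"
      by (subst complex_norm_square) (simp add: mult.commute)
    then show ?thesis using nz[of z] z unfolding h_def by simp
  qed
  have "((\<lambda>u. h u / (u - z)) has_contour_integral (2 * of_real pi * \<i> * h z)) (part_circlepath 0 1 0 (2*pi))"
    using Cauchy_integral_circlepath_simple[OF h] z unfolding circlepath_def by simp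
  then have I: "((\<lambda>t. h (cis t) / (cis t - z) * \<i> * cis t) has_integral (2 * of_real pi * \<i> * h z)) {0..2*pi}"
    by (subst (asm) has_contour_integral_part_circlepath_iff) auto
  \<comment> \<open>On the circle |w| = 1 one has 1 - cnj z w = w cnj (w - z), which turns the
    Cauchy kernel times the auxiliary factor into the Poisson kernel.\<close>
  have eq: "h (cis t) / (cis t - z) * \<i> * cis t = \<i> * (poisson_kernel z t *\<^sub>R f (of_real r * cis t))" for t
  proof -
    have "cis t * (1 - cnj (cis t) * z) = cis t - z"
      by (simp add: algebra_simps) (simp add: cis_cnj cis_mult)
    moreover have "(cis t - z) * cnj (cis t - z) = of_real ((cmod (cis t - z))\<^sup>2)"
      by (rule complex_norm_square[symmetric])
    moreover have "(1 - cnj z * cis t) = cis t * cnj (cis t - z)"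
      by (simp add: algebra_simps cis_cnj cis_mult)
    ultimately have "(1 - cnj z * cis t) * (cis t - z) = cis t * of_real ((cmod (cis t - z))\<^sup>2)"
      by (simp add: mult_ac)
    then have "cis t / ((1 - cnj z * cis t) * (cis t - z)) = 1 / of_real ((cmod (cis t - z))\<^sup>2)"
      by simp
    moreover have "h (cis t) / (cis t - z) * \<i> * cis t = \<i> * f (of_real r * cis t) * (1 - of_real ((cmod z)\<^sup>2)) *
       (cis t / ((1 - cnj z * cis t) * (cis t - z)))"
      unfolding h_def by (simp add: field_simps)
    ultimately show ?thesis
      unfolding poisson_kernel_def scaleR_conv_of_real by (simp add: field_simps)
  qed
  have "((\<lambda>t. \<i> * (poisson_kernel z t *\<^sub>R f (of_real r * cis t))) has_integral (2 * of_real pi * \<i> * h z)) {0..2*pi}"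
    using I unfolding eq .
  from has_integral_mult_right[OF this, of "-\<i>"]
  have J: "((\<lambda>t. poisson_kernel z t *\<^sub>R f (of_real r * cis t)) has_integral (2 * of_real pi * h z)) {0..2*pi}"
  proof -
    have e1: "- \<i> * (\<i> * w) = w" for w by (simp flip: mult.assoc)
    have e2: "2 * of_real pi * \<i> * h z = \<i> * (2 * of_real pi * h z)" by simp
    show "((\<lambda>t. - \<i> * (\<i> * (poisson_kernel z t *\<^sub>R f (of_real r * cis t)))) has_integral (- \<i> * (2 * of_real pi * \<i> * h z))) {0..2*pi} \<Longrightarrow> ?thesis"
      by (simp only: e1 e2)
  qed
  have "continuous_on {0..2*pi} (\<lambda>t. f (of_real r * cis t))"
  proof (rule continuous_on_compose2[OF holomorphic_on_imp_continuous_on[OF f]])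
    show "(\<lambda>t. of_real r * cis t) ` {0..2*pi} \<subseteq> ball 0 1" using r by (auto simp: norm_mult)
  qed (auto intro!: continuous_intros)
  then have "integrable circle_measure (\<lambda>t. poisson_kernel z t *\<^sub>R f (of_real r * cis t))"
    using z by (intro continuous_imp_integrable_real continuous_intros continuous_on_poisson_kernel)
  from lebesgue_integral_eq_integral[OF this]
  have "(\<integral>t. poisson_kernel z t *\<^sub>R f (of_real r * cis t) \<partial>circle_measure) = 2 * of_real pi * h z"
    using integral_unique[OF J] by simp
  then show ?thesis using hz unfolding poisson_def by (simp add: scaleR_conv_of_real)
qed

text \<open>The mean of the kernel is read off from \<open>poisson_formula\<close> for the constant
  function 1.\<close>

lemma poisson_const:
  assumes "cmod z < 1"
  shows "poisson (\<lambda>_. c) z = (c::real)"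
proof -
  have "poisson (\<lambda>t. 1::complex) z = 1"
    using poisson_formula[of "\<lambda>_. 1" 0 z] assms by simp
  then have "complex_of_real ((1/(2*pi)) * (\<integral>t. poisson_kernel z t \<partial>circle_measure)) = of_real 1"
    unfolding poisson_def scaleR_conv_of_real mult_1_right integral_complex_of_real of_real_mult of_real_1 .
  then have "(1/(2*pi)) * (\<integral>t. poisson_kernel z t \<partial>circle_measure) = 1"
    unfolding of_real_eq_iff .
  moreover have "poisson (\<lambda>_. c) z = c * ((1/(2*pi)) * (\<integral>t. poisson_kernel z t \<partial>circle_measure))"
    unfolding poisson_def by simp
  ultimately show ?thesis by simp
qed

lemma poisson_mono:
  fixes u v :: "real \<Rightarrow> real"
  assumes "integrable circle_measure u" "integrable circle_measure v" "cmod z < 1"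
    and "\<And>t. t \<in> {0..2*pi} \<Longrightarrow> u t \<le> v t"
  shows "poisson u z \<le> poisson v z"
  unfolding poisson_def scaleR_conv_of_real
proof (intro mult_left_mono integral_mono)
  show "integrable circle_measure (\<lambda>t. of_real (poisson_kernel z t) * u t)"
       "integrable circle_measure (\<lambda>t. of_real (poisson_kernel z t) * v t)"
    using poisson_kernel_integrable[OF assms(1,3)] poisson_kernel_integrable[OF assms(2,3)] by auto
qed (use assms poisson_kernel_nonneg in \<open>auto intro!: mult_left_mono\<close>)

lemma norm_poisson_le:
  fixes u :: "real \<Rightarrow> 'a::{banach,second_countable_topology}"
  assumes "cmod z < 1"
  shows "norm (poisson u z) \<le> poisson (\<lambda>t. norm (u t)) z"
proof -
  have "norm (poisson u z) \<le> (1/(2*pi)) * (\<integral>t. norm (poisson_kernel z t *\<^sub>R u t) \<partial>circle_measure)"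
    unfolding poisson_def norm_scaleR by (intro mult_mono integral_norm_bound[THEN order_trans] order_refl) auto
  also have "\<dots> = poisson (\<lambda>t. norm (u t)) z"
    unfolding poisson_def using poisson_kernel_nonneg[OF assms] by simp
  finally show ?thesis .
qed

lemma poisson_diff:
  fixes u v :: "real \<Rightarrow> 'a::{banach,second_countable_topology}"
  assumes "integrable circle_measure u" "integrable circle_measure v" "cmod z < 1"
  shows "poisson (\<lambda>t. u t - v t) z = poisson u z - poisson v z"
  unfolding poisson_def
  using poisson_kernel_integrable[OF assms(1,3)] poisson_kernel_integrable[OF assms(2,3)]
  by (simp add: algebra_simps)

lemma poisson_dominated_convergence:
  fixes u :: "nat \<Rightarrow> real \<Rightarrow> 'a::{banach,second_countable_topology}"
  assumes "\<And>n. u n \<in> borel_measurable circle_measure" "v \<in> borel_measurable circle_measure"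
    and "AE t in circle_measure. (\<lambda>n. u n t) \<longlonglongrightarrow> v t"
    and "\<And>n t. t \<in> {0..2*pi} \<Longrightarrow> norm (u n t) \<le> B" and z: "cmod z < 1"
  shows "(\<lambda>n. poisson (u n) z) \<longlonglongrightarrow> poisson v z"
  unfolding poisson_def
proof (intro tendsto_scaleR tendsto_const integral_dominated_convergence)
  interpret finite_measure circle_measure by (rule finite_measure_circle)
  show "integrable circle_measure (\<lambda>t. poisson_kernel z t *\<^sub>R B)"
    by (intro poisson_kernel_integrable z) simp
  show "AE t in circle_measure. norm (poisson_kernel z t *\<^sub>R u n t) \<le> poisson_kernel z t *\<^sub>R B" for n
    using assms(4) poisson_kernel_nonneg[OF z] by (intro AE_I2) (auto intro!: mult_left_mono)
  show "AE t in circle_measure. (\<lambda>n. poisson_kernel z t *\<^sub>R u n t) \<longlonglongrightarrow> poisson_kernel z t *\<^sub>R v t"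
    using assms(3) by eventually_elim (intro tendsto_intros)
qed (use assms measurable_poisson_kernel in auto)

text \<open>Near \<zeta> the data are close to \<open>L\<close> and the kernel has mean 1; at
  distance at least d from \<zeta> the kernel is at most (1 - |z|^2) / (d/2)^2 once z is within d/2
  of \<zeta>, and this tends to 0. Closeness is measured on the circle and not in the parameter t,
  so the two ends of [0, 2 pi] are not special.\<close>

lemma poisson_tendsto_boundary:
  fixes u :: "real \<Rightarrow> 'a::{banach,second_countable_topology}"
  assumes u: "u \<in> borel_measurable circle_measure" and B: "\<And>t. t \<in> {0..2*pi} \<Longrightarrow> norm (u t) \<le> B"
    and cont: "\<And>e. 0 < e \<Longrightarrow> \<exists>d>0. \<forall>t\<in>{0..2*pi}. cmod (cis t - \<zeta>) < d \<longrightarrow> norm (u t - L) \<le> e"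
    and \<zeta>: "cmod \<zeta> = 1"
  shows "(poisson u \<longlongrightarrow> L) (at \<zeta> within ball 0 1)"
proof (rule tendstoI)
  interpret finite_measure circle_measure by (rule finite_measure_circle)
  fix e :: real assume e: "0 < e"
  obtain d where d: "d > 0" "\<And>t. t \<in> {0..2*pi} \<Longrightarrow> cmod (cis t - \<zeta>) < d \<Longrightarrow> norm (u t - L) \<le> e/2"
    using cont[of "e/2"] e by auto
  define C where "C = B + norm L"
  have B0: "B \<ge> 0" using order_trans[OF norm_ge_zero B[of 0]] by simp
  then have C0: "C \<ge> 0" by (auto simp: C_def)
  have uint: "integrable circle_measure u"
    using u B by (intro integrable_const_bound[of _ B] AE_I2) auto
  have "((\<lambda>z. e/2 + C * ((1 - (cmod z)\<^sup>2) / (d/2)\<^sup>2)) \<longlongrightarrow> e/2 + C * ((1 - (cmod \<zeta>)\<^sup>2) / (d/2)\<^sup>2)) (at \<zeta> within ball 0 1)"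
    by (intro tendsto_intros) (use d in auto)
  then have "\<forall>\<^sub>F z in at \<zeta> within ball 0 1. e/2 + C * ((1 - (cmod z)\<^sup>2) / (d/2)\<^sup>2) < e"
    by (rule order_tendstoD) (use e \<zeta> in auto)
  moreover have "\<forall>\<^sub>F z in at \<zeta> within ball 0 1. z \<in> ball 0 1 \<and> dist z \<zeta> < d/2"
    using d unfolding eventually_at by (intro exI[of _ "d/2"]) auto
  ultimately show "\<forall>\<^sub>F z in at \<zeta> within ball 0 1. dist (poisson u z) L < e"
  proof eventually_elim
    case (elim z)
    then have z: "cmod z < 1" by auto
    have int: "integrable circle_measure (\<lambda>t. norm (u t - L))" using uint by simp
    have "poisson (\<lambda>_. L) z = L"
      using poisson_const[OF z, of 1]
      by (simp add: poisson_def continuous_imp_integrable_real continuous_on_poisson_kernel z)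
    then have "norm (poisson u z - L) = norm (poisson (\<lambda>t. u t - L) z)"
      using poisson_diff[OF uint _ z, of "\<lambda>_. L"] by simp
    also have "\<dots> \<le> poisson (\<lambda>t. norm (u t - L)) z" by (rule norm_poisson_le[OF z])
    also have "\<dots> \<le> (1/(2*pi)) * (\<integral>t. poisson_kernel z t * (e/2) + C * ((1 - (cmod z)\<^sup>2) / (d/2)\<^sup>2) \<partial>circle_measure)"
      unfolding poisson_def real_scaleR_def
    proof (intro mult_left_mono integral_mono)
      show "integrable circle_measure (\<lambda>t. poisson_kernel z t * norm (u t - L))"
        using poisson_kernel_integrable[OF int z] by simp
      have "integrable circle_measure (\<lambda>t. poisson_kernel z t * (e/2))"
        using poisson_kernel_integrable[of "\<lambda>_. e/2" z] z by simp
      then show "integrable circle_measure (\<lambda>t. poisson_kernel z t * (e/2) + C * ((1 - (cmod z)\<^sup>2) / (d/2)\<^sup>2))"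
        by (intro Bochner_Integration.integrable_add) auto
      fix t assume t: "t \<in> space circle_measure"
      have z1: "0 \<le> 1 - (cmod z)\<^sup>2" using z by (simp add: abs_square_le_1)
      show "poisson_kernel z t * norm (u t - L) \<le> poisson_kernel z t * (e/2) + C * ((1 - (cmod z)\<^sup>2) / (d/2)\<^sup>2)"
      proof (cases "cmod (cis t - \<zeta>) < d")
        case True
        then have "poisson_kernel z t * norm (u t - L) \<le> poisson_kernel z t * (e/2)"
          using d t poisson_kernel_nonneg[OF z] by (intro mult_left_mono) auto
        moreover have "0 \<le> C * ((1 - (cmod z)\<^sup>2) / (d/2)\<^sup>2)" using C0 z1 by simp
        ultimately show ?thesis by linarith
      next
        case False
        have "cmod (cis t - \<zeta>) \<le> cmod (cis t - z) + cmod (z - \<zeta>)"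
          using norm_triangle_ineq[of "cis t - z" "z - \<zeta>"] by simp
        then have "d/2 \<le> cmod (cis t - z)" using False elim by (auto simp: dist_norm)
        then have "poisson_kernel z t \<le> (1 - (cmod z)\<^sup>2) / (d/2)\<^sup>2"
          unfolding poisson_kernel_def using d z1 by (intro frac_le power_mono) auto
        moreover have "norm (u t - L) \<le> C"
          using norm_triangle_ineq4[of "u t" L] B[of t] t by (auto simp: C_def)
        ultimately have "poisson_kernel z t * norm (u t - L) \<le> ((1 - (cmod z)\<^sup>2) / (d/2)\<^sup>2) * C"
          using poisson_kernel_nonneg[OF z] z1 by (intro mult_mono) auto
        moreover have "0 \<le> poisson_kernel z t * (e/2)" using poisson_kernel_nonneg[OF z] e by simp
        ultimately show ?thesis by (simp add: mult.commute)
      qed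
    qed auto
    also have "\<dots> = poisson (\<lambda>_. e/2) z + C * ((1 - (cmod z)\<^sup>2) / (d/2)\<^sup>2)"
    proof -
      have "(1/(2*pi)) * (\<integral>t. poisson_kernel z t * (e/2) + K \<partial>circle_measure) = poisson (\<lambda>_. e/2) z + K" for K
        using poisson_kernel_integrable[of "\<lambda>_. e/2" z] z
        by (simp add: poisson_def distrib_left)
      then show ?thesis .
    qed
    also have "\<dots> < e" using elim poisson_const[OF z, of "e/2"] by simp
    finally show ?case by (simp add: dist_norm)
  qed
qed

text \<open>The holomorphic completion of the Poisson integral of real data. Its exponential is a
  zero-free function of prescribed modulus, and its real part will serve as a harmonic
  majorant.\<close>

definition herglotz :: "(real \<Rightarrow> real) \<Rightarrow> complex \<Rightarrow> complex" where
  "herglotz u z = (1 / (2*pi)) *\<^sub>R (\<integral>t. u t *\<^sub>R ((cis t + z) / (cis t - z)) \<partial>circle_measure)"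

lemma continuous_on_herglotz_integrand:
  assumes "continuous_on {0..2*pi} u" "cmod z < 1"
  shows "continuous_on {0..2*pi} (\<lambda>t. u t *\<^sub>R ((cis t + z) / (cis t - z)))"
  by (intro continuous_intros assms) (use cis_minus_nonzero[OF assms(2)] in auto)

lemma herglotz_holomorphic:
  assumes "continuous_on {0..2*pi} u"
  shows "herglotz u holomorphic_on ball 0 1"
proof -
  let ?D = "\<lambda>z t. u t *\<^sub>R (2 * cis t / (cis t - z)\<^sup>2)"
  have "(\<lambda>z. integral (cbox 0 (2*pi)) (\<lambda>t. u t *\<^sub>R ((cis t + z) / (cis t - z)))) holomorphic_on ball 0 1"
  proof (rule leibniz_rule_holomorphic[where fx = ?D])
    fix z :: complex and t :: real assume z: "z \<in> ball 0 1"
    then have nz: "cis t - z \<noteq> 0" by (intro cis_minus_nonzero) simp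
    have "((\<lambda>z. (cis t + z) / (cis t - z)) has_field_derivative
      ((0 + 1) * (cis t - z) - (cis t + z) * (0 - 1)) / ((cis t - z) * (cis t - z))) (at z within ball 0 1)"
      by (intro derivative_intros) (use nz in auto)
    moreover have "((0 + 1) * (cis t - z) - (cis t + z) * (0 - 1)) / ((cis t - z) * (cis t - z)) = 2 * cis t / (cis t - z)\<^sup>2"
      by (simp add: power2_eq_square)
    ultimately show "((\<lambda>z. u t *\<^sub>R ((cis t + z) / (cis t - z))) has_field_derivative ?D z t) (at z within ball 0 1)"
      unfolding scaleR_conv_of_real by (intro DERIV_cmult) simp
  next
    fix z :: complex assume "z \<in> ball 0 1"
    then show "(\<lambda>t. u t *\<^sub>R ((cis t + z) / (cis t - z))) integrable_on cbox 0 (2*pi)"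
      using continuous_on_herglotz_integrand[OF assms] by (intro integrable_continuous) auto
  next
    have "continuous_on (ball 0 1 \<times> {0..2*pi}) (\<lambda>p. u (snd p))"
      by (rule continuous_on_compose2[OF assms continuous_on_snd]) (auto intro: continuous_on_id)
    then show "continuous_on (ball 0 1 \<times> cbox 0 (2*pi)) (\<lambda>(z, t). ?D z t)"
      unfolding split_beta cbox_interval
      by (intro continuous_intros) (auto dest!: cis_minus_nonzero)
  qed auto
  moreover have "herglotz u z = (1/(2*pi)) *\<^sub>R integral (cbox 0 (2*pi)) (\<lambda>t. u t *\<^sub>R ((cis t + z) / (cis t - z)))"
    if "z \<in> ball 0 1" for z
    unfolding herglotz_def
    using lebesgue_integral_eq_integral[OF continuous_imp_integrable_real[OF continuous_on_herglotz_integrand[OF assms]], of z] that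
    by simp
  ultimately show ?thesis
    unfolding scaleR_conv_of_real
    by (elim holomorphic_transform[OF holomorphic_on_mult[OF holomorphic_on_const[of "of_real (1/(2*pi))"]]]) simp
qed

lemma Re_herglotz_kernel:
  assumes "cmod z < 1"
  shows "Re ((cis t + z) / (cis t - z)) = poisson_kernel z t"
proof -
  have "(cis t + z) / (cis t - z) = (cis t + z) * cnj (cis t - z) / of_real ((cmod (cis t - z))\<^sup>2)"
    by (subst complex_norm_square) (use cis_minus_nonzero[OF assms] in \<open>simp add: divide_simps\<close>)
  then have "Re ((cis t + z) / (cis t - z)) = Re ((cis t + z) * cnj (cis t - z)) / (cmod (cis t - z))\<^sup>2"
    by (simp only: Re_divide_of_real)
  also have "Re ((cis t + z) * cnj (cis t - z)) = 1 - (cmod z)\<^sup>2"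
  proof -
    have "(cos t)\<^sup>2 + (sin t)\<^sup>2 = 1" by simp
    then show ?thesis
      unfolding cmod_power2 by (simp add: power2_eq_square algebra_simps)
  qed
  finally show ?thesis by (simp add: poisson_kernel_def)
qed

lemma Re_herglotz:
  assumes "continuous_on {0..2*pi} u" "cmod z < 1"
  shows "Re (herglotz u z) = poisson u z"
proof -
  have "integrable circle_measure (\<lambda>t. u t *\<^sub>R ((cis t + z) / (cis t - z)))"
    by (intro continuous_imp_integrable_real continuous_on_herglotz_integrand assms)
  then have "Re (\<integral>t. u t *\<^sub>R ((cis t + z) / (cis t - z)) \<partial>circle_measure) = (\<integral>t. Re (u t *\<^sub>R ((cis t + z) / (cis t - z))) \<partial>circle_measure)"
    by (rule Bochner_Integration.integral_Re[symmetric])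
  also have "\<dots> = (\<integral>t. poisson_kernel z t *\<^sub>R u t \<partial>circle_measure)"
    using Re_herglotz_kernel[OF assms(2)] by (simp add: mult.commute del: Re_divide)
  finally show ?thesis by (simp add: herglotz_def poisson_def)
qed

text \<open>Only |z| and the mean of \<open>u\<close> enter, so a family of such integrals with
  bounded means is locally bounded.\<close>

lemma norm_herglotz_le:
  assumes "continuous_on {0..2*pi} u" "cmod z < 1" "\<And>t. t \<in> {0..2*pi} \<Longrightarrow> 0 \<le> u t"
  shows "cmod (herglotz u z) \<le> (\<integral>t. u t \<partial>circle_measure) / (pi * (1 - cmod z))"
proof -
  have "cmod (\<integral>t. u t *\<^sub>R ((cis t + z) / (cis t - z)) \<partial>circle_measure) \<le> (\<integral>t. u t * (2 / (1 - cmod z)) \<partial>circle_measure)"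
  proof (rule Bochner_Integration.integral_norm_bound_integral)
    show "integrable circle_measure (\<lambda>t. u t *\<^sub>R ((cis t + z) / (cis t - z)))"
      by (intro continuous_imp_integrable_real continuous_on_herglotz_integrand assms)
    show "integrable circle_measure (\<lambda>t. u t * (2 / (1 - cmod z)))"
      by (intro continuous_imp_integrable_real continuous_intros assms(1))
    fix t assume t: "t \<in> space circle_measure"
    have "cmod ((cis t + z) / (cis t - z)) \<le> 2 / (1 - cmod z)"
      unfolding norm_divide
      using norm_triangle_ineq[of "cis t" z] one_minus_le_cis_minus[of z t] assms(2)
      by (intro frac_le) auto
    then show "cmod (u t *\<^sub>R ((cis t + z) / (cis t - z))) \<le> u t * (2 / (1 - cmod z))"
      using assms(3)[of t] t by (simp add: mult_left_mono del: times_divide_eq_right)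
  qed
  also have "\<dots> = (\<integral>t. u t \<partial>circle_measure) * (2 / (1 - cmod z))" by simp
  finally have "(1/(2*pi)) * cmod (\<integral>t. u t *\<^sub>R ((cis t + z) / (cis t - z)) \<partial>circle_measure) \<le>
     (1/(2*pi)) * ((\<integral>t. u t \<partial>circle_measure) * (2 / (1 - cmod z)))" by (intro mult_left_mono) auto
  then show ?thesis unfolding herglotz_def norm_scaleR using assms(2) by (simp add: field_simps)
qed

section \<open>Fatou's theorem for bounded holomorphic functions\<close>

text \<open>This turns Fatou's theorem into a question of differentiability: a primitive of a
  bounded function is Lipschitz, hence extends to the closed disc, and its values along the circle
  are differentiable almost everywhere.\<close>

lemma bounded_holomorphic_lipschitz_primitive:
  assumes A: "A holomorphic_on ball 0 1" and C: "\<And>z. z \<in> ball 0 1 \<Longrightarrow> cmod (A z) \<le> C"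
  obtains Q where "\<And>z. z \<in> ball 0 1 \<Longrightarrow> (Q has_field_derivative A z) (at z)" "C-lipschitz_on (cball 0 1) Q"
proof -
  obtain P where P: "\<And>z. z \<in> ball 0 1 \<Longrightarrow> (P has_field_derivative A z) (at z within ball 0 1)"
    using holomorphic_convex_primitive'[OF convex_ball open_ball A] by blast
  have "C \<ge> 0" using order_trans[OF norm_ge_zero C[of 0]] by simp
  then have "C-lipschitz_on (ball 0 1) P"
    using field_differentiable_bound[OF convex_ball P C] by (intro lipschitz_onI) (auto simp: dist_norm)
  from lipschitz_extend_closure[OF this]
  obtain Q where Q: "C-lipschitz_on (cball 0 1) Q" "\<And>z. z \<in> ball 0 1 \<Longrightarrow> Q z = P z" by auto
  have "(Q has_field_derivative A z) (at z)" if z: "z \<in> ball 0 1" for z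
  proof -
    have "(P has_field_derivative A z) (at z)" using P[OF z] z at_within_open[of z "ball 0 1"] by simp
    then show ?thesis
      using has_field_derivative_transform_within_open[of P "A z" z "ball 0 1" Q] z Q(2) by auto
  qed
  then show thesis using Q(1) that by blast
qed

text \<open>A point near \<open>cis t0\<close> may have its parameter t near t0 + 2 pi, so another
  argument s close to t0 is produced. It comes from the principal logarithm of w =
  \<open>cis (t - t0)\<close>: the derivative of \<open>Ln\<close> at 1 is 1, whence |Ln w| \<le> 2
  |w - 1| near 1.\<close>

lemma cis_increment_lift:
  assumes "0 < \<delta>"
  shows "\<exists>d>0. \<forall>t. cmod (cis t - cis t0) < d \<longrightarrow>
           (\<exists>s. cis s = cis t \<and> \<bar>s - t0\<bar> < \<delta> \<and> \<bar>s - t0\<bar> \<le> 2 * cmod (cis t - cis t0))"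
proof -
  have "(Ln has_field_derivative inverse 1) (at 1)" by (rule has_field_derivative_Ln) simp
  then have "((\<lambda>w. cmod ((Ln w - Ln 1) / (w - 1))) \<longlongrightarrow> cmod (inverse 1)) (at 1)"
    unfolding has_field_derivative_iff by (rule tendsto_norm)
  then have "\<forall>\<^sub>F w in at 1. cmod (Ln w / (w - 1)) < 2"
    using order_tendstoD(2)[of _ _ _ 2] by fastforce
  then obtain d where d: "d > 0" "\<And>w. w \<noteq> 1 \<Longrightarrow> dist w 1 < d \<Longrightarrow> cmod (Ln w / (w - 1)) < 2"
    unfolding eventually_at by auto
  show ?thesis
  proof (rule exI[of _ "min d (\<delta>/2)"], intro conjI allI impI)
    fix t assume t: "cmod (cis t - cis t0) < min d (\<delta>/2)"
    define w where "w = cis (t - t0)"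
    have wm: "cmod (w - 1) = cmod (cis t - cis t0)"
    proof -
      have "cis t - cis t0 = cis t0 * (w - 1)" by (simp add: w_def algebra_simps cis_mult)
      then show ?thesis by (simp add: norm_mult)
    qed
    have w0: "w \<noteq> 0" by (simp add: w_def)
    have "Re (Ln w) = 0" using w0 by (simp add: w_def)
    then have eq: "cis (Im (Ln w)) = w"
      using exp_Ln[OF w0] by (metis exp_eq_polar exp_zero mult_1 of_real_1)
    have "cmod (Ln w) \<le> 2 * cmod (w - 1)"
      using d(2)[of w] t wm by (cases "w = 1") (auto simp: dist_norm norm_divide divide_less_eq split: if_splits)
    then have "\<bar>Im (Ln w)\<bar> \<le> 2 * cmod (cis t - cis t0)"
      using abs_Im_le_cmod[of "Ln w"] wm by linarith
    moreover have "cis (t0 + Im (Ln w)) = cis t"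
      using eq by (simp add: w_def flip: cis_mult) (simp add: cis_mult)
    ultimately show "\<exists>s. cis s = cis t \<and> \<bar>s - t0\<bar> < \<delta> \<and> \<bar>s - t0\<bar> \<le> 2 * cmod (cis t - cis t0)"
      using t by (intro exI[of _ "t0 + Im (Ln w)"]) auto
  qed (use d assms in auto)
qed

lemma norm_scaled_less_1:
  assumes "0 \<le> r" "r \<le> 1" "cmod z < 1"
  shows "cmod (of_real r * z) < 1"
proof -
  have "r * cmod z \<le> 1 * cmod z" using assms by (intro mult_right_mono) auto
  then show ?thesis using assms by (simp add: norm_mult)
qed

lemma countable_cis_fibre: "countable {t. cis t = cis s}"
proof (rule countable_subset)
  show "{t. cis t = cis s} \<subseteq> range (\<lambda>n::int. s + 2 * pi * of_int n)"
  proof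
    fix t assume "t \<in> {t. cis t = cis s}"
    then have "sin t = sin s \<and> cos t = cos s" by (simp add: complex_eq_iff)
    then show "t \<in> range (\<lambda>n::int. s + 2 * pi * of_int n)" unfolding sin_cos_eq_iff by auto
  qed
qed simp

text \<open>This one sequence of radii is used throughout, because measurability and dominated
  convergence work with sequences. The shift \<open>n + 2\<close> keeps the first radius
  positive.\<close>

lemma approach_radius:
  fixes \<rho> :: "nat \<Rightarrow> real"
  defines "\<rho> \<equiv> \<lambda>n. 1 - 1 / real (n + 2)"
  shows "0 \<le> \<rho> n" "0 < \<rho> n" "\<rho> n < 1" "\<rho> \<longlonglongrightarrow> 1"
proof -
  show "0 \<le> \<rho> n" "0 < \<rho> n" "\<rho> n < 1" by (auto simp: \<rho>_def)
  have "(\<lambda>n. 1 - 1 / real (n + 2)) \<longlonglongrightarrow> 1 - 0"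
    by (intro tendsto_diff tendsto_const LIMSEQ_ignore_initial_segment[of "\<lambda>n. 1 / real n" 0 2] lim_1_over_n)
  then show "\<rho> \<longlonglongrightarrow> 1" by (simp add: \<rho>_def)
qed

text \<open>Where the boundary function of the primitive \<open>Q\<close> is differentiable, the difference quotient of
  \<open>Q\<close>, corrected by its limit, is a bounded Poisson integral of a function continuous at the boundary point,
  hence \<open>Q\<close> is differentiable there from inside the disc.  Cauchy's estimate on discs of radius comparable to
  the distance from the boundary transfers this to the derivative \<open>A\<close>.\<close>

lemma nontangential_limit_of_derivative:
  assumes Q': "\<And>z. z \<in> ball 0 1 \<Longrightarrow> (Q has_field_derivative A z) (at z)"
    and lip: "C-lipschitz_on (cball 0 1) Q"
    and D: "((\<lambda>t. Q (cis t)) has_vector_derivative D) (at t0)"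
  shows "has_nontangential_limit A (cis t0) (D / (\<i> * cis t0))"
proof -
  define \<zeta> where "\<zeta> = cis t0"
  \<comment> \<open>The chain rule would give D as the derivative of \<open>Q\<close> at \<zeta>
    times i \<zeta>, so c is the only candidate for the limit.\<close>
  define c where "c = D / (\<i> * \<zeta>)"
  define R where "R = (\<lambda>z. Q z - Q \<zeta> - c * (z - \<zeta>))"
  \<comment> \<open>Division by zero gives \<open>q \<zeta> = 0\<close>, which is also the limit to
    be proved, so the bound and the continuity estimate hold at \<zeta> as well.\<close>
  define q where "q = (\<lambda>z. R z / (z - \<zeta>))"
  define K where "K = C + cmod c"
  have z1: "cmod \<zeta> = 1" by (simp add: \<zeta>_def)
  have Qc: "continuous_on (cball 0 1) Q" using lip by (rule lipschitz_on_continuous_on)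
  have K0: "K \<ge> 0" using lipschitz_on_nonneg[OF lip] by (simp add: K_def)
  have RK: "cmod (R z) \<le> K * cmod (z - \<zeta>)" if "cmod z \<le> 1" for z
  proof -
    have "cmod (R z) \<le> cmod (Q z - Q \<zeta>) + cmod (c * (z - \<zeta>))" unfolding R_def by (rule norm_triangle_ineq4)
    also have "cmod (Q z - Q \<zeta>) \<le> C * cmod (z - \<zeta>)"
      using lipschitz_onD[OF lip, of z \<zeta>] that z1 by (simp add: dist_norm)
    finally show ?thesis by (simp add: K_def norm_mult distrib_right)
  qed
  have qK: "cmod (q z) \<le> K" if "cmod z \<le> 1" for z
    using RK[OF that] K0 by (cases "z = \<zeta>") (auto simp: q_def norm_divide divide_le_eq)
  have R': "(R has_field_derivative (A z - c)) (at z)" if "z \<in> ball 0 1" for z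
  proof -
    have "(R has_field_derivative (A z - 0 - c * (1 - 0))) (at z)"
      unfolding R_def by (intro DERIV_diff DERIV_cmult Q' that DERIV_const DERIV_ident)
    then show ?thesis by simp
  qed
  have Rhol: "R holomorphic_on ball 0 1"
  proof (rule holomorphic_onI)
    fix z :: complex assume z: "z \<in> ball 0 1"
    show "R field_differentiable at z within ball 0 1"
      using has_field_derivative_at_within[OF R'[OF z]] unfolding field_differentiable_def by blast
  qed
  have qhol: "q holomorphic_on ball 0 1"
    unfolding q_def using Rhol z1 by (intro holomorphic_intros) auto
  have Rcirc: "continuous_on UNIV (\<lambda>t. R (r *\<^sub>R cis t))" if "0 \<le> r" "r \<le> 1" for r
    unfolding R_def using that
    by (intro continuous_intros continuous_on_compose2[OF Qc]) auto
  have qmeas: "(\<lambda>t. q (r *\<^sub>R cis t)) \<in> borel_measurable circle_measure" if "0 \<le> r" "r \<le> 1" for r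
    unfolding q_def
    by (intro borel_measurable_divide continuous_imp_measurable_on_sets_lebesgue continuous_on_subset[OF Rcirc[OF that]] continuous_intros) auto
  have qcont: "\<exists>d>0. \<forall>t\<in>{0..2*pi}. cmod (cis t - \<zeta>) < d \<longrightarrow> norm (q (cis t) - 0) \<le> e" if e: "0 < e" for e
  proof -
    have "((\<lambda>t. R (cis t)) has_vector_derivative (D - 0 - c * (\<i> * cis t0 - 0))) (at t0)"
      unfolding R_def
    proof (intro has_vector_derivative_diff D has_vector_derivative_const has_vector_derivative_mult_right)
      have "(cis has_vector_derivative (\<i> * cis t0)) (at t0)"
        unfolding cis.ctr[abs_def] has_vector_derivative_complex_iff
        by (auto intro!: derivative_eq_intros)
      then show "(cis has_vector_derivative (\<i> * cis t0)) (at t0)" .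
    qed
    moreover have "D - 0 - c * (\<i> * cis t0 - 0) = 0" by (simp add: c_def \<zeta>_def)
    ultimately have "((\<lambda>t. R (cis t)) has_derivative (\<lambda>h. 0)) (at t0)"
      by (simp add: has_vector_derivative_def)
    then have "\<forall>e>0. \<exists>d>0. \<forall>y. norm (y - t0) < d \<longrightarrow> cmod (R (cis y) - R (cis t0) - 0) \<le> e * norm (y - t0)"
      unfolding has_derivative_at_alt by blast
    from this[rule_format, OF half_gt_zero[OF e]]
    obtain \<delta> where \<delta>: "\<delta> > 0" "\<And>t. \<bar>t - t0\<bar> < \<delta> \<Longrightarrow> cmod (R (cis t) - R (cis t0)) \<le> e/2 * \<bar>t - t0\<bar>"
      by auto
    obtain d where d: "d > 0" "\<And>t. cmod (cis t - cis t0) < d \<Longrightarrow>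
           (\<exists>s. cis s = cis t \<and> \<bar>s - t0\<bar> < \<delta> \<and> \<bar>s - t0\<bar> \<le> 2 * cmod (cis t - cis t0))"
      using cis_increment_lift[OF \<delta>(1), of t0] by blast
    have "norm (q (cis t)) \<le> e" if t: "cmod (cis t - \<zeta>) < d" for t
    proof -
      obtain s where s: "cis s = cis t" "\<bar>s - t0\<bar> < \<delta>" "\<bar>s - t0\<bar> \<le> 2 * cmod (cis t - cis t0)"
        using d(2) t \<zeta>_def by blast
      have "R (cis t0) = 0" by (simp add: R_def \<zeta>_def)
      then have "cmod (R (cis t)) \<le> e/2 * \<bar>s - t0\<bar>" using \<delta>(2)[OF s(2)] s(1) by simp
      also have "\<dots> \<le> e/2 * (2 * cmod (cis t - cis t0))" using s e by (intro mult_left_mono) auto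
      finally show ?thesis using e by (cases "cis t = \<zeta>") (auto simp: q_def norm_divide divide_le_eq \<zeta>_def)
    qed
    then show ?thesis using d(1) by auto
  qed
  \<comment> \<open>Poisson's formula is available for q only on smaller circles. The values there
    are bounded by K and converge at all parameters except the countably many that represent
    \<zeta>.\<close>
  have qP: "q z = poisson (\<lambda>t. q (cis t)) z" if z: "cmod z < 1" for z
  proof (rule LIMSEQ_unique)
    let ?r = "\<lambda>n. 1 - 1 / real (n + 2)"
    note r = approach_radius
    have "(\<lambda>n. q (of_real (?r n) * z)) \<longlonglongrightarrow> q (of_real 1 * z)"
    proof (rule continuous_on_tendsto_compose[OF holomorphic_on_imp_continuous_on[OF qhol]])
      show "(\<lambda>n. of_real (?r n) * z) \<longlonglongrightarrow> of_real 1 * z" by (intro tendsto_intros r)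
      show "\<forall>\<^sub>F n in sequentially. of_real (?r n) * z \<in> ball 0 1"
      proof (intro always_eventually allI)
        fix n show "of_real (?r n) * z \<in> ball 0 1"
          using norm_scaled_less_1[OF r(1) less_imp_le[OF r(3)] z, of n] unfolding mem_ball_0 .
      qed
    qed (use z in auto)
    then show "(\<lambda>n. q (of_real (?r n) * z)) \<longlonglongrightarrow> q z" by simp
    have "(\<lambda>n. poisson (\<lambda>t. q (of_real (?r n) * cis t)) z) \<longlonglongrightarrow> poisson (\<lambda>t. q (cis t)) z"
    proof (rule poisson_dominated_convergence[where B = K])
      show "(\<lambda>t. q (of_real (?r n) * cis t)) \<in> borel_measurable circle_measure" for n
        using qmeas[of "?r n"] r(1)[of n] r(3)[of n] by (simp add: scaleR_conv_of_real)
      show "(\<lambda>t. q (cis t)) \<in> borel_measurable circle_measure" using qmeas[of 1] by simp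
      show "norm (q (of_real (?r n) * cis t)) \<le> K" for n t
        using r(1)[of n] r(3)[of n] by (intro qK) (auto simp: norm_mult simp del: of_real_diff)
      have lim: "(\<lambda>n. q (of_real (?r n) * cis t)) \<longlonglongrightarrow> q (cis t)" if "cis t \<noteq> \<zeta>" for t
      proof -
        have "(\<lambda>n. R (of_real (?r n) * cis t)) \<longlonglongrightarrow> R (of_real 1 * cis t)"
        proof (rule continuous_on_tendsto_compose[of "cball 0 1" R])
          show "continuous_on (cball 0 1) R" unfolding R_def by (intro continuous_intros Qc)
          show "(\<lambda>n. of_real (?r n) * cis t) \<longlonglongrightarrow> of_real 1 * cis t" by (intro tendsto_intros r)
          show "\<forall>\<^sub>F n in sequentially. of_real (?r n) * cis t \<in> cball 0 1"
            using r(1,3) by (intro always_eventually allI) (auto simp: norm_mult less_imp_le simp del: of_real_diff)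
        qed auto
        moreover have "(\<lambda>n. of_real (?r n) * cis t - \<zeta>) \<longlonglongrightarrow> of_real 1 * cis t - \<zeta>" by (intro tendsto_intros r)
        ultimately have "(\<lambda>n. R (of_real (?r n) * cis t) / (of_real (?r n) * cis t - \<zeta>)) \<longlonglongrightarrow> R (of_real 1 * cis t) / (of_real 1 * cis t - \<zeta>)"
          using that by (intro tendsto_divide) auto
        then show ?thesis unfolding q_def by simp
      qed
      show "AE t in circle_measure. (\<lambda>n. q (of_real (?r n) * cis t)) \<longlonglongrightarrow> q (cis t)"
      proof -
        have "{t. cis t = cis t0} \<in> null_sets lebesgue"
          by (intro null_sets_completionI countable_imp_null_set_lborel countable_cis_fibre)
        then have "AE t in lebesgue. cis t \<noteq> \<zeta>" unfolding \<zeta>_def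
          using AE_not_in by fastforce
        then have "AE t in lebesgue. t \<in> {0..2*pi} \<longrightarrow> (\<lambda>n. q (of_real (?r n) * cis t)) \<longlonglongrightarrow> q (cis t)"
          by eventually_elim (blast intro: lim)
        then show ?thesis
          by (subst AE_restrict_space_iff) simp_all
      qed
    qed (rule z)
    then show "(\<lambda>n. q (of_real (?r n) * z)) \<longlonglongrightarrow> poisson (\<lambda>t. q (cis t)) z"
      using poisson_formula[OF qhol r(1,3) z] by simp
  qed
  have "(poisson (\<lambda>t. q (cis t)) \<longlongrightarrow> 0) (at \<zeta> within ball 0 1)"
    using qmeas[of 1] qK qcont z1 by (intro poisson_tendsto_boundary[where B = K]) auto
  then have qlim: "(q \<longlongrightarrow> 0) (at \<zeta> within ball 0 1)"
    by (rule Lim_transform_eventually) (auto simp: eventually_at_filter qP)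
  show ?thesis unfolding has_nontangential_limit_def
  proof (intro allI impI)
    fix a :: real assume a: "1 < a"
    show "(A \<longlongrightarrow> D / (\<i> * cis t0)) (at (cis t0) within stolz_region (cis t0) a)"
      unfolding \<zeta>_def[symmetric] c_def[symmetric]
    proof (rule tendstoI)
      fix e :: real assume e: "0 < e"
      \<comment> \<open>With \<rho> = (1 - |z|) / 2, Cauchy's estimate gives |A z - c| \<le> 2 e' |z
        - \<zeta>| / \<rho>, and |z - \<zeta>| < 2 a \<rho> in the Stolz region, so the bound is 4 a
        e' = e / 2.\<close>
      define e' where "e' = e / (8 * a)"
      have e': "e' > 0" using e a by (simp add: e'_def)
      obtain d where d: "d > 0" "\<And>w. w \<in> ball 0 1 \<Longrightarrow> w \<noteq> \<zeta> \<Longrightarrow> dist w \<zeta> < d \<Longrightarrow> dist (q w) 0 < e'"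
        using tendstoD[OF qlim e'] unfolding eventually_at by blast
      have Rw: "cmod (R w) \<le> e' * cmod (w - \<zeta>)" if "w \<in> ball 0 1" "dist w \<zeta> < d" for w
      proof -
        have "w \<noteq> \<zeta>" using that z1 by auto
        then show ?thesis using d(2)[of w] that by (simp add: q_def norm_divide divide_less_eq)
      qed
      show "\<forall>\<^sub>F z in at \<zeta> within stolz_region \<zeta> a. dist (A z) c < e"
        unfolding eventually_at
      proof (intro exI[of _ "d/2"] conjI ballI impI)
        fix z assume z: "z \<in> stolz_region \<zeta> a" and "z \<noteq> \<zeta> \<and> dist z \<zeta> < d/2"
        then have zd: "cmod (z - \<zeta>) < d/2" by (simp add: dist_norm)
        have zb: "cmod z < 1" "cmod (z - \<zeta>) < a * (1 - cmod z)" using z by (auto simp: stolz_region_def)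
        define \<rho> where "\<rho> = (1 - cmod z) / 2"
        have \<rho>: "\<rho> > 0" using zb by (simp add: \<rho>_def)
        have "1 - cmod z \<le> cmod (z - \<zeta>)" using norm_triangle_ineq2[of \<zeta> z] z1 by (simp add: norm_minus_commute)
        then have \<rho>le: "\<rho> \<le> cmod (z - \<zeta>)" using zb by (simp add: \<rho>_def)
        have sub: "cball z \<rho> \<subseteq> ball 0 1"
        proof
          fix w assume "w \<in> cball z \<rho>"
          then show "w \<in> ball 0 1"
            using norm_triangle_ineq2[of w z] zb by (simp add: \<rho>_def dist_norm norm_minus_commute field_simps)
        qed
        have "norm ((deriv ^^ 1) R z) \<le> (fact 1) * (e' * (2 * cmod (z - \<zeta>))) / \<rho> ^ 1"
        proof (rule Cauchy_inequality)
          show "R holomorphic_on ball z \<rho>" using Rhol by (rule holomorphic_on_subset) (use sub ball_subset_cball in blast)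
          show "continuous_on (cball z \<rho>) R" using holomorphic_on_imp_continuous_on[OF Rhol] sub by (rule continuous_on_subset)
          fix w assume w: "norm (z - w) = \<rho>"
          have *: "cmod (w - \<zeta>) \<le> cmod (z - \<zeta>) + \<rho>"
            using norm_triangle_ineq[of "w - z" "z - \<zeta>"] w by (simp add: norm_minus_commute)
          have "cmod (R w) \<le> e' * cmod (w - \<zeta>)"
          proof (rule Rw)
            show "w \<in> ball 0 1" using sub w by (auto simp: dist_norm)
            show "dist w \<zeta> < d" using * \<rho>le zd by (simp add: dist_norm)
          qed
          also have "\<dots> \<le> e' * (2 * cmod (z - \<zeta>))" using * \<rho>le e' by (intro mult_left_mono) auto
          finally show "norm (R w) \<le> e' * (2 * cmod (z - \<zeta>))" .
        qed (use \<rho> in auto)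
        moreover have "deriv R z = A z - c" using R'[of z] zb by (intro DERIV_imp_deriv) auto
        ultimately have "cmod (A z - c) \<le> e' * (2 * cmod (z - \<zeta>)) / \<rho>" by simp
        also have "\<dots> \<le> e' * (2 * (2 * a * \<rho>)) / \<rho>"
          using zb \<rho> e' by (intro divide_right_mono mult_left_mono) (auto simp: \<rho>_def)
        also have "\<dots> = e / 2" using \<rho> a by (simp add: e'_def)
        also have "\<dots> < e" using e by simp
        finally show "dist (A z) c < e" by (simp add: dist_norm)
      qed (use d in auto)
    qed
  qed
qed

lemma bounded_holomorphic_nontangential_ae:
  assumes "A holomorphic_on ball 0 1" "\<And>z. z \<in> ball 0 1 \<Longrightarrow> cmod (A z) \<le> C" "bounded S"
  shows "negligible {t\<in>S. \<not> (\<exists>L. has_nontangential_limit A (cis t) L)}"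
proof -
  obtain Q where Q: "\<And>z. z \<in> ball 0 1 \<Longrightarrow> (Q has_field_derivative A z) (at z)" "C-lipschitz_on (cball 0 1) Q"
    using bounded_holomorphic_lipschitz_primitive[OF assms(1,2)] by blast
  have C: "C \<ge> 0" using Q(2) by (rule lipschitz_on_nonneg)
  have "(C * 1)-lipschitz_on UNIV (\<lambda>t. Q (cis t))"
  proof -
    have "cmod (cis s - cis t) \<le> \<bar>s - t\<bar>" for s t
    proof -
      have "norm (cis s - cis t) \<le> 1 * norm (s - t)"
      proof (rule differentiable_bound[of UNIV cis "\<lambda>t h. h *\<^sub>R (\<i> * cis t)"])
        fix t :: real
        have "(cis has_vector_derivative (\<i> * cis t)) (at t)"
          unfolding cis.ctr[abs_def] has_vector_derivative_complex_iff
          by (auto intro!: derivative_eq_intros)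
        then show "(cis has_derivative (\<lambda>h. h *\<^sub>R (\<i> * cis t))) (at t within UNIV)"
          by (simp add: has_vector_derivative_def)
        show "onorm (\<lambda>h. h *\<^sub>R (\<i> * cis t)) \<le> 1"
          by (rule onorm_bound) (auto simp: norm_mult)
      qed auto
      then show ?thesis by simp
    qed
    then have "1-lipschitz_on UNIV cis" by (intro lipschitz_onI) (auto simp: dist_norm)
    moreover have "C-lipschitz_on (range cis) Q" using Q(2) by (rule lipschitz_on_subset) auto
    ultimately show ?thesis by (rule lipschitz_on_compose2)
  qed
  then have "negligible {t\<in>S. \<not> (\<exists>D. ((\<lambda>t. Q (cis t)) has_vector_derivative D) (at t))}"
    using assms(3) by (rule lipschitz_vector_differentiable_ae)
  then show ?thesis
    by (rule negligible_subset) (use nontangential_limit_of_derivative[OF Q] in blast)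
qed

section \<open>Boundary uniqueness for bounded holomorphic functions\<close>

text \<open>Multiply \<open>A\<close> by the outer function of modulus roughly \<open>exp (N * indicator E)\<close> on the circle: as \<open>A\<close>
  vanishes on \<open>E\<close>, the mean of the product stays at most \<open>1\<close>, whereas its value at \<open>z\<close> grows exponentially
  in \<open>N\<close> unless \<open>A z = 0\<close>.\<close>

lemma bounded_holomorphic_zero_outer:
  fixes A :: "complex \<Rightarrow> complex" and U :: "complex \<Rightarrow> real" and W :: "complex set"
  defines "\<rho> \<equiv> \<lambda>n. 1 - 1 / real (n + 2)"
  assumes A: "A holomorphic_on ball 0 1" and A1: "\<And>z. z \<in> ball 0 1 \<Longrightarrow> cmod (A z) \<le> 1"
    and W: "closed W" "\<And>t. t \<in> {0..2*pi} \<Longrightarrow> cis t \<in> W \<Longrightarrow> (\<lambda>n. A (of_real (\<rho> n) * cis t)) \<longlonglongrightarrow> 0"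
    and U: "continuous_on UNIV U" "\<And>w. 0 \<le> U w" "\<And>w. U w \<le> N"
    and z: "cmod z < 1"
  shows "cmod (A z) * exp (poisson (\<lambda>t. U (cis t)) z) \<le>
           poisson (\<lambda>t. if cis t \<in> W then 0 else exp (U (cis t))) z"
proof -
  interpret finite_measure circle_measure by (rule finite_measure_circle)
  have \<rho>: "0 \<le> \<rho> n" "0 < \<rho> n" "\<rho> n < 1" "\<rho> \<longlonglongrightarrow> 1" for n
    unfolding \<rho>_def by (rule approach_radius)+
  let ?u = "\<lambda>t. U (cis t)"
  have Uc: "continuous_on S ?u" for S
    by (intro continuous_on_compose2[OF U(1)] continuous_intros) auto
  define H where "H = (\<lambda>z. A z * exp (herglotz ?u z))"
  have H: "H holomorphic_on ball 0 1"
    unfolding H_def by (intro holomorphic_intros A herglotz_holomorphic Uc)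
  have nH: "cmod (H w) = cmod (A w) * exp (poisson ?u w)" if "cmod w < 1" for w
    using Re_herglotz[OF Uc that] by (simp add: H_def norm_mult)
  have Wm: "{t \<in> space circle_measure. cis t \<in> W} \<in> sets circle_measure"
  proof -
    have "{t. cis t \<in> W} = cis -` W" by auto
    then have "{t. cis t \<in> W} \<in> sets borel"
      using W(1) by (auto intro!: borel_closed continuous_closed_vimage continuous_intros)
    then have "{t. cis t \<in> W} \<inter> {0..2*pi} \<in> sets lebesgue" by (intro sets.Int) auto
    then show ?thesis by (auto simp: sets_restrict_space Int_def conj_commute image_iff)
  qed
  have int_u: "integrable circle_measure ?u" by (intro continuous_imp_integrable_real Uc)
  have PN: "poisson ?u w \<le> N" "0 \<le> poisson ?u w" if "cmod w < 1" for w
    using poisson_mono[OF int_u integrable_const that, of N] poisson_mono[OF integrable_const int_u that, of 0]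
      U poisson_const[OF that] by auto
  have circ: "of_real (\<rho> n) * cis t \<in> ball 0 1" "cmod (of_real (\<rho> n) * cis t) < 1" for n t
    using \<rho>(1)[of n] \<rho>(3)[of n] by (auto simp: norm_mult)
  have Acirc: "continuous_on UNIV (\<lambda>t. A (of_real (\<rho> n) * cis t))" "continuous_on UNIV (\<lambda>t. H (of_real (\<rho> n) * cis t))" for n
    using circ(1) by (intro continuous_on_compose2[OF holomorphic_on_imp_continuous_on[OF A]]
          continuous_on_compose2[OF holomorphic_on_imp_continuous_on[OF H]] continuous_intros; force)+
  have Pcirc: "continuous_on UNIV (\<lambda>t. poisson ?u (of_real (\<rho> n) * cis t))" for n
  proof -
    have "continuous_on UNIV (\<lambda>t. Re (herglotz ?u (of_real (\<rho> n) * cis t)))"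
      using circ(1) by (intro continuous_on_Re continuous_on_compose2[OF holomorphic_on_imp_continuous_on[OF herglotz_holomorphic[OF Uc]]] continuous_intros) force
    then show ?thesis using Re_herglotz[OF Uc circ(2)] by simp
  qed
  have meas: "g \<in> borel_measurable circle_measure" if "continuous_on UNIV g" for g :: "real \<Rightarrow> real"
    by (intro continuous_imp_measurable_on_sets_lebesgue continuous_on_subset[OF that]) auto
  \<comment> \<open>A bounded majorant of |H| on the circle of radius \<open>\<rho> n\<close>. Over
    \<open>W\<close> the factor |A|, which tends to 0, is kept and the exponential is replaced by
    its bound; elsewhere |A| \<le> 1 is used, and continuity of \<open>U\<close> gives the limit of
    the exponential.\<close>
  define w where "w = (\<lambda>n t. if cis t \<in> W then cmod (A (of_real (\<rho> n) * cis t)) * exp N else exp (poisson ?u (of_real (\<rho> n) * cis t)))"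
  have wm: "w n \<in> borel_measurable circle_measure" for n
    unfolding w_def by (intro measurable_If meas continuous_intros Acirc Pcirc Wm)
  have wB: "norm (w n t) \<le> exp N" for n t
    using A1[OF circ(1)] PN[OF circ(2)] by (auto simp: w_def mult_left_le_one_le)
  have wint: "integrable circle_measure (w n)" for n
    using wm wB by (intro integrable_const_bound[of _ "exp N"] AE_I2) auto
  have lim: "(\<lambda>n. w n t) \<longlonglongrightarrow> (if cis t \<in> W then 0 else exp (?u t))" if t: "t \<in> {0..2*pi}" for t
  proof (cases "cis t \<in> W")
    case True
    have "(\<lambda>n. cmod (A (of_real (\<rho> n) * cis t)) * exp N) \<longlonglongrightarrow> cmod 0 * exp N"
      by (intro tendsto_intros W(2) True t)
    then show ?thesis using True by (simp add: w_def)
  next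
    case False
    have "(poisson ?u \<longlongrightarrow> ?u t) (at (cis t) within ball 0 1)"
    proof (rule poisson_tendsto_boundary[where B = N])
      show "?u \<in> borel_measurable circle_measure" by (rule meas[OF Uc])
      fix e :: real assume "0 < e"
      then obtain d where "d > 0" "\<And>x. dist x (cis t) < d \<Longrightarrow> dist (U x) (U (cis t)) < e"
        using U(1) unfolding continuous_on_iff by (metis UNIV_I)
      then show "\<exists>d>0. \<forall>s\<in>{0..2*pi}. cmod (cis s - cis t) < d \<longrightarrow> norm (?u s - ?u t) \<le> e"
        by (metis dist_norm less_imp_le)
    qed (use U in auto)
    moreover have "filterlim (\<lambda>n. of_real (\<rho> n) * cis t) (at (cis t) within ball 0 1) sequentially"
      unfolding filterlim_at
    proof
      show "\<forall>\<^sub>F n in sequentially. of_real (\<rho> n) * cis t \<in> ball 0 1 \<and> of_real (\<rho> n) * cis t \<noteq> cis t"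
      proof (intro always_eventually allI conjI)
        fix n show "of_real (\<rho> n) * cis t \<in> ball 0 1" by (rule circ(1))
        show "of_real (\<rho> n) * cis t \<noteq> cis t" using circ(2)[of n t] norm_cis[of t] by force
      qed
      have "(\<lambda>n. of_real (\<rho> n) * cis t) \<longlonglongrightarrow> of_real 1 * cis t" by (intro tendsto_intros \<rho>)
      then show "(\<lambda>n. of_real (\<rho> n) * cis t) \<longlonglongrightarrow> cis t" by simp
    qed
    ultimately have "(\<lambda>n. poisson ?u (of_real (\<rho> n) * cis t)) \<longlonglongrightarrow> ?u t"
      by (rule filterlim_compose)
    then show ?thesis using False by (simp add: w_def tendsto_exp)
  qed
  have lm: "(\<lambda>t. if cis t \<in> W then 0 else exp (?u t)) \<in> borel_measurable circle_measure"
    by (intro measurable_If meas Wm continuous_intros Uc)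
  have "(\<lambda>n. poisson (w n) z) \<longlonglongrightarrow> poisson (\<lambda>t. if cis t \<in> W then 0 else exp (?u t)) z"
    using wB lim by (intro poisson_dominated_convergence[where B = "exp N"] wm lm z AE_I2) auto
  moreover have "(\<lambda>n. cmod (H (of_real (\<rho> n) * z))) \<longlonglongrightarrow> cmod (H (of_real 1 * z))"
  proof (intro tendsto_norm continuous_on_tendsto_compose[OF holomorphic_on_imp_continuous_on[OF H]])
    show "(\<lambda>n. of_real (\<rho> n) * z) \<longlonglongrightarrow> of_real 1 * z" by (intro tendsto_intros \<rho>)
    show "\<forall>\<^sub>F n in sequentially. of_real (\<rho> n) * z \<in> ball 0 1"
      using norm_scaled_less_1[OF \<rho>(1) less_imp_le[OF \<rho>(3)] z] by (intro always_eventually allI) simp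
  qed (use z in auto)
  moreover have "cmod (H (of_real (\<rho> n) * z)) \<le> poisson (w n) z" for n
  proof -
    have "cmod (H (of_real (\<rho> n) * z)) = cmod (poisson (\<lambda>t. H (of_real (\<rho> n) * cis t)) z)"
      using poisson_formula[OF H \<rho>(1,3) z] by simp
    also have "\<dots> \<le> poisson (\<lambda>t. cmod (H (of_real (\<rho> n) * cis t))) z" by (rule norm_poisson_le[OF z])
    also have "\<dots> \<le> poisson (w n) z"
    proof (rule poisson_mono[OF _ wint z])
      show "integrable circle_measure (\<lambda>t. cmod (H (of_real (\<rho> n) * cis t)))"
        by (intro continuous_imp_integrable_real continuous_intros continuous_on_subset[OF Acirc(2)]) auto
      show "cmod (H (of_real (\<rho> n) * cis t)) \<le> w n t" for t
        unfolding nH[OF circ(2)] w_def using A1[OF circ(1), of n t] PN[OF circ(2), of n t]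
        by (auto intro!: mult_left_mono simp: mult_left_le_one_le)
    qed
    finally show ?thesis .
  qed
  ultimately have "cmod (H (of_real 1 * z)) \<le> poisson (\<lambda>t. if cis t \<in> W then 0 else exp (?u t)) z"
    by (intro LIMSEQ_le[of "\<lambda>n. cmod (H (of_real (\<rho> n) * z))" _ "\<lambda>n. poisson (w n) z"]) auto
  then show ?thesis using nH[OF z] by simp
qed

text \<open>\<open>bounded_holomorphic_zero_outer\<close> asks for a closed set and continuous data.
  So \<open>E\<close> is replaced by a closed subset \<open>F\<close> of positive measure, and N
  times the indicator of its image \<open>W\<close> on the circle is the limit in k of the functions
  \<open>U N k\<close>, built from the distance to \<open>W\<close>. Only then does N grow.\<close>

lemma bounded_holomorphic_boundary_uniqueness:
  fixes A :: "complex \<Rightarrow> complex"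
  assumes A: "A holomorphic_on ball 0 1" and A1: "\<And>z. z \<in> ball 0 1 \<Longrightarrow> cmod (A z) \<le> 1"
    and E: "E \<in> sets lebesgue" "E \<subseteq> {0..2*pi}" "0 < emeasure lebesgue E"
    and lim: "\<And>t. t \<in> E \<Longrightarrow> (\<lambda>n. A (of_real (1 - 1 / real (n + 2)) * cis t)) \<longlonglongrightarrow> 0"
    and z: "z \<in> ball 0 1"
  shows "A z = 0"
proof -
  interpret finite_measure circle_measure by (rule finite_measure_circle)
  have z1: "cmod z < 1" using z by simp
  have Efin: "emeasure lebesgue E < \<infinity>"
  proof -
    have "emeasure lebesgue E \<le> emeasure lebesgue {0..2*pi}" using E by (intro emeasure_mono) auto
    also have "\<dots> < \<infinity>" by simp
    finally show ?thesis .
  qed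
  obtain F where F: "closed F" "F \<subseteq> E" "E - F \<in> lmeasurable" "emeasure lebesgue (E - F) < emeasure lebesgue E"
  proof -
    obtain m where m: "emeasure lebesgue E = ennreal m" "m \<ge> 0" using Efin by (cases "emeasure lebesgue E") auto
    then have "m > 0" using E(3) by (cases "m = 0") auto
    from sets_lebesgue_inner_closed[OF E(1) this] show thesis using that m by metis
  qed
  have Fm: "F \<in> sets lebesgue" using F(1) by (simp add: borel_closed)
  have Fpos: "emeasure lebesgue F > 0"
  proof (rule ccontr)
    assume "\<not> ?thesis"
    then have "F \<in> null_sets lebesgue" using Fm by (auto simp: null_sets_def)
    then have "emeasure lebesgue ((E - F) \<union> F) = emeasure lebesgue (E - F)"
      using F by (intro emeasure_Un_null_set) auto
    moreover have "(E - F) \<union> F = E" using F by auto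
    ultimately show False using F(4) by simp
  qed
  have Fc: "compact F" using F(1,2) E(2) by (meson bounded_subset bounded_closed_interval compact_eq_bounded_closed subset_trans)
  define W where "W = cis ` F"
  have Wc: "compact W" unfolding W_def by (intro compact_continuous_image Fc continuous_intros)
  have Wne: "W \<noteq> {}" using Fpos by (auto simp: W_def)
  have Wlim: "(\<lambda>n. A (of_real (1 - 1 / real (n + 2)) * cis t)) \<longlonglongrightarrow> 0" if "cis t \<in> W" for t
  proof -
    obtain s where "s \<in> F" "cis t = cis s" using \<open>cis t \<in> W\<close> by (auto simp: W_def)
    then show ?thesis using lim[of s] F(2) by (simp add: subset_iff)
  qed
  define I where "I = (\<lambda>t. if cis t \<in> W then 1 else 0 :: real)"
  define U where "U = (\<lambda>N k w. real N * max 0 (1 - real k * infdist w W))"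
  have Uc: "continuous_on S (U N k)" for N k S
    unfolding U_def by (intro continuous_intros)
  have U0: "0 \<le> U N k w" "U N k w \<le> real N" for N k w
    by (auto simp: U_def infdist_nonneg max_def mult_left_le)
  have Ucis: "continuous_on S (\<lambda>t. U N k (cis t))" for S N k
    by (intro continuous_on_compose2[OF Uc[of UNIV]] continuous_intros) auto
  have Ulim: "(\<lambda>k. U N k (cis t)) \<longlonglongrightarrow> real N * I t" for N t
  proof (cases "cis t \<in> W")
    case True then show ?thesis by (simp add: U_def I_def)
  next
    case False
    then have d: "infdist (cis t) W > 0"
      using infdist_pos_not_in_closed[OF compact_imp_closed[OF Wc] Wne] by blast
    obtain k0 where k0: "1 / infdist (cis t) W < real k0" using reals_Archimedean2 by blast
    have "U N k (cis t) = 0" if "k \<ge> k0" for k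
    proof -
      have "1 / infdist (cis t) W < real k" using that k0 by linarith
      then have "1 < real k * infdist (cis t) W" using d by (simp add: field_simps)
      then show ?thesis by (simp add: U_def)
    qed
    then have "(\<lambda>k. U N k (cis t)) \<longlonglongrightarrow> 0"
      by (intro tendsto_eventually) (auto simp: eventually_sequentially)
    then show ?thesis using False by (simp add: I_def)
  qed
  have meas: "g \<in> borel_measurable circle_measure" if "continuous_on UNIV g" for g :: "real \<Rightarrow> real"
    by (intro continuous_imp_measurable_on_sets_lebesgue continuous_on_subset[OF that]) auto
  have Um: "(\<lambda>t. U N k (cis t)) \<in> borel_measurable circle_measure" for N k
    by (rule meas[OF Ucis])
  have Im: "I \<in> borel_measurable circle_measure"
    using borel_measurable_LIMSEQ_real[OF Ulim Um, of 1] by simp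
  have Iint: "integrable circle_measure I" "integrable circle_measure (\<lambda>t. 1 - I t)"
    using Im by (intro integrable_const_bound[of _ 1] AE_I2; auto simp: I_def)+
  have J: "(if cis t \<in> W then 0 else exp x) = (1 - I t) * exp x" for t x by (simp add: I_def)
  \<comment> \<open>On \<open>W\<close> the factor 1 - I vanishes and elsewhere the exponent does,
    so the right-hand side becomes the Poisson integral of 1 - I and stays at most 1 for every
    N.\<close>
  have main: "cmod (A z) * exp (real N * poisson I z) \<le> 1" for N
  proof -
    have "(\<lambda>k. cmod (A z) * exp (poisson (\<lambda>t. U N k (cis t)) z)) \<longlonglongrightarrow> cmod (A z) * exp (poisson (\<lambda>t. real N * I t) z)"
      using Ulim U0 Im Um z1 by (intro tendsto_intros poisson_dominated_convergence[where B = "real N"]) auto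
    moreover have "(\<lambda>k. poisson (\<lambda>t. (1 - I t) * exp (U N k (cis t))) z) \<longlonglongrightarrow> poisson (\<lambda>t. (1 - I t) * exp (real N * I t)) z"
    proof (intro poisson_dominated_convergence[where B = "exp (real N)"] AE_I2 tendsto_intros Ulim z1)
      show "norm ((1 - I t) * exp (U N k (cis t))) \<le> exp (real N)" for k t
        using U0 by (auto simp: I_def)
    qed (use Im Um in auto)
    moreover have "cmod (A z) * exp (poisson (\<lambda>t. U N k (cis t)) z) \<le> poisson (\<lambda>t. (1 - I t) * exp (U N k (cis t))) z" for k
      using bounded_holomorphic_zero_outer[OF A A1 compact_imp_closed[OF Wc] Wlim Uc[of UNIV N k] U0 z1]
      unfolding J by blast
    ultimately have "cmod (A z) * exp (poisson (\<lambda>t. real N * I t) z) \<le> poisson (\<lambda>t. (1 - I t) * exp (real N * I t)) z"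
      by (intro LIMSEQ_le[of "\<lambda>k. cmod (A z) * exp (poisson (\<lambda>t. U N k (cis t)) z)" _ "\<lambda>k. poisson (\<lambda>t. (1 - I t) * exp (U N k (cis t))) z"]) auto
    also have "(\<lambda>t. (1 - I t) * exp (real N * I t)) = (\<lambda>t. 1 - I t)" by (auto simp: I_def)
    also have "poisson (\<lambda>t. 1 - I t) z \<le> poisson (\<lambda>_. 1) z"
      by (intro poisson_mono Iint z1) (auto simp: I_def)
    also have "\<dots> = 1" by (rule poisson_const[OF z1])
    also have "poisson (\<lambda>t. real N * I t) z = real N * poisson I z"
      unfolding poisson_def by (simp add: mult.left_commute)
    finally show ?thesis .
  qed
  \<comment> \<open>A set of positive length has positive harmonic measure, because the kernel is
    bounded below on the circle.\<close>
  have pos: "poisson I z > 0"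
  proof -
    define c where "c = (1 - (cmod z)\<^sup>2) / 4"
    have c: "c > 0" using z1 by (simp add: c_def abs_square_less_1)
    have "0 < measure circle_measure F"
    proof -
      have "0 < measure lebesgue F"
        using Fpos emeasure_eq_measure2[OF lmeasurable_compact[OF Fc]] by (metis ennreal_less_zero_iff)
      then show ?thesis using F E Fm by (subst measure_restrict_space) auto
    qed
    moreover have "F \<inter> {0..2*pi} = F" using F E by auto
    ultimately have "0 < c * (\<integral>t. indicat_real F t \<partial>circle_measure)"
      using c by (subst Bochner_Integration.integral_indicator) auto
    also have "\<dots> = (\<integral>t. c * indicat_real F t \<partial>circle_measure)" by simp
    also have "\<dots> \<le> (\<integral>t. poisson_kernel z t *\<^sub>R I t \<partial>circle_measure)"
    proof (rule integral_mono)
      show "integrable circle_measure (\<lambda>t. c * indicat_real F t)"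
        using Fm F E by (intro integrable_mult_right integrable_const_bound[of _ 1] AE_I2 borel_measurable_indicator) (auto simp: sets_restrict_space_iff split: split_indicator)
      show "integrable circle_measure (\<lambda>t. poisson_kernel z t *\<^sub>R I t)" by (intro poisson_kernel_integrable Iint z1)
      show "c * indicat_real F t \<le> poisson_kernel z t *\<^sub>R I t" for t
        using poisson_kernel_ge[OF z1, of t] poisson_kernel_nonneg[OF z1, of t]
        by (auto simp: I_def W_def c_def split: split_indicator)
    qed
    finally show ?thesis by (simp add: poisson_def)
  qed
  show ?thesis
  proof (rule ccontr)
    assume "A z \<noteq> 0"
    define a where "a = cmod (A z)"
    have a: "a > 0" using \<open>A z \<noteq> 0\<close> by (simp add: a_def)
    obtain N where N: "1 / (a * poisson I z) < real N" using reals_Archimedean2 by blast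
    have "1 < a * (real N * poisson I z)" using N a pos by (simp add: field_simps)
    also have "\<dots> \<le> a * exp (real N * poisson I z)"
      using a exp_ge_add_one_self[of "real N * poisson I z"] by (intro mult_left_mono) linarith+
    finally show False using main[of N] by (simp add: a_def)
  qed
qed

section \<open>The Hardy space of exponent one\<close>

lemma bounded_if_compact_in_ball:
  assumes "compact K" "K \<subseteq> ball (0::complex) 1"
  obtains s where "s < 1" "\<And>z. z \<in> K \<Longrightarrow> cmod z \<le> s"
proof (cases "K = {}")
  case True then show thesis using that[of 0] by auto
next
  case False
  then obtain x where "x \<in> K" "\<And>y. y \<in> K \<Longrightarrow> cmod y \<le> cmod x"
    using continuous_attains_sup[OF assms(1) False continuous_on_norm_id] by auto
  then show thesis using that[of "cmod x"] assms(2) by auto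
qed

text \<open>A harmonic majorant of \<open>|f|\<close> is the real part of a holomorphic \<open>g\<close> obtained as a normal-family
  limit of Herglotz integrals; then \<open>f / (1 + g)\<close> and \<open>1 / (1 + g)\<close> are bounded by \<open>1\<close>.\<close>

lemma H1_bounded_quotient:
  fixes f :: "complex \<Rightarrow> complex"
  assumes f: "f holomorphic_on ball 0 1"
    and M: "\<And>r. 0 \<le> r \<Longrightarrow> r < 1 \<Longrightarrow> (\<integral>t. cmod (f (of_real r * cis t)) \<partial>circle_measure) \<le> M"
  obtains A B where "A holomorphic_on ball 0 1" "B holomorphic_on ball 0 1"
    "\<And>z. z \<in> ball 0 1 \<Longrightarrow> cmod (A z) \<le> 1" "\<And>z. z \<in> ball 0 1 \<Longrightarrow> cmod (B z) \<le> 1"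
    "\<And>z. z \<in> ball 0 1 \<Longrightarrow> B z \<noteq> 0" "\<And>z. z \<in> ball 0 1 \<Longrightarrow> f z = A z / B z"
proof -
  define \<rho> where "\<rho> = (\<lambda>n. 1 - 1 / real (n + 2))"
  have \<rho>: "0 \<le> \<rho> n" "0 < \<rho> n" "\<rho> n < 1" "\<rho> \<longlonglongrightarrow> 1" for n
    unfolding \<rho>_def by (rule approach_radius)+
  define u where "u = (\<lambda>n t. cmod (f (of_real (\<rho> n) * cis t)))"
  have fc: "continuous_on S (\<lambda>t. f (of_real (\<rho> n) * cis t))" for n S
    using \<rho>(1,3)[of n] by (intro continuous_on_compose2[OF holomorphic_on_imp_continuous_on[OF f]] continuous_intros)
      (auto simp: norm_mult)
  have uc: "continuous_on S (u n)" for n S unfolding u_def by (intro continuous_on_norm fc)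
  have u0: "0 \<le> u n t" for n t by (simp add: u_def)
  have M0: "0 \<le> M" using order_trans[OF _ M[of 0]] by simp
  define G where "G = (\<lambda>n. herglotz (u n))"
  have Gb: "cmod (G n z) \<le> M / (pi * (1 - cmod z))" if z: "cmod z < 1" for n z
  proof -
    have "cmod (G n z) \<le> (\<integral>t. u n t \<partial>circle_measure) / (pi * (1 - cmod z))"
      unfolding G_def by (intro norm_herglotz_le uc z u0)
    also have "\<dots> \<le> M / (pi * (1 - cmod z))"
      using M[OF \<rho>(1,3)] z by (intro divide_right_mono) (auto simp: u_def)
    finally show ?thesis .
  qed
  have Gb': "\<exists>B. \<forall>h\<in>range G. \<forall>z\<in>K. cmod (h z) \<le> B" if K: "compact K" "K \<subseteq> ball 0 1" for K
  proof -
    obtain s where s: "s < 1" "\<And>z. z \<in> K \<Longrightarrow> cmod z \<le> s" using bounded_if_compact_in_ball[OF K] by blast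
    have "cmod (G n z) \<le> M / (pi * (1 - s))" if "z \<in> K" for n z
    proof -
      have "cmod (G n z) \<le> M / (pi * (1 - cmod z))" using that K(2) by (intro Gb) auto
      also have "\<dots> \<le> M / (pi * (1 - s))"
        using s that M0 by (intro divide_left_mono mult_left_mono mult_pos_pos) (auto, force)
      finally show ?thesis .
    qed
    then show ?thesis by blast
  qed
  have Gh: "h holomorphic_on ball 0 1" if "h \<in> range G" for h
    using that by (auto simp: G_def intro!: herglotz_holomorphic uc)
  obtain g k where g: "g holomorphic_on ball 0 1" and k: "strict_mono (k :: nat \<Rightarrow> nat)"
      "\<And>x. x \<in> ball 0 1 \<Longrightarrow> (\<lambda>n. G (k n) x) \<longlonglongrightarrow> g x"
    using Montel[OF open_ball[of "0::complex" 1], of "range G" G] Gh Gb' by (metis order_refl)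
  \<comment> \<open>For each n the Poisson integral of |f| over the circle of radius
    \<open>\<rho> n\<close> dominates |f| at the scaled point and is the real part of
    \<open>G n z\<close>; both sides converge along the subsequence.\<close>
  have maj: "cmod (f z) \<le> Re (g z)" if z: "z \<in> ball 0 1" for z
  proof (rule LIMSEQ_le)
    have z1: "cmod z < 1" using z by simp
    have "(\<lambda>n. cmod (f (of_real (\<rho> n) * z))) \<longlonglongrightarrow> cmod (f (of_real 1 * z))"
    proof (intro tendsto_norm continuous_on_tendsto_compose[OF holomorphic_on_imp_continuous_on[OF f]])
      show "(\<lambda>n. of_real (\<rho> n) * z) \<longlonglongrightarrow> of_real 1 * z" by (intro tendsto_intros \<rho>)
      show "\<forall>\<^sub>F n in sequentially. of_real (\<rho> n) * z \<in> ball 0 1"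
        using norm_scaled_less_1[OF \<rho>(1) less_imp_le[OF \<rho>(3)] z1] by (intro always_eventually allI) simp
    qed (use z in auto)
    then have "(\<lambda>n. cmod (f (of_real (\<rho> n) * z))) \<longlonglongrightarrow> cmod (f z)" by simp
    from LIMSEQ_subseq_LIMSEQ[OF this k(1)]
    show "(\<lambda>n. cmod (f (of_real (\<rho> (k n)) * z))) \<longlonglongrightarrow> cmod (f z)" by (simp add: o_def)
    show "(\<lambda>n. Re (G (k n) z)) \<longlonglongrightarrow> Re (g z)" by (intro tendsto_Re k z)
    show "\<exists>N. \<forall>n\<ge>N. cmod (f (of_real (\<rho> (k n)) * z)) \<le> Re (G (k n) z)"
    proof (intro exI allI impI)
      fix n
      show "cmod (f (of_real (\<rho> (k n)) * z)) \<le> Re (G (k n) z)"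
        using norm_poisson_le[OF z1, of "\<lambda>t. f (of_real (\<rho> (k n)) * cis t)"] poisson_formula[OF f \<rho>(1,3) z1]
        unfolding G_def Re_herglotz[OF uc z1] by (simp add: u_def)
    qed
  qed
  \<comment> \<open>The 1 added to g keeps the denominator away from 0 and makes it dominate both 1
    and |f|.\<close>
  have big: "1 + cmod (f z) \<le> cmod (1 + g z)" if "z \<in> ball 0 1" for z
    using maj[OF that] complex_Re_le_cmod[of "1 + g z"] by simp
  have nz: "1 + g z \<noteq> 0" if "z \<in> ball 0 1" for z
    using big[OF that] norm_ge_zero[of "f z"] by fastforce
  show thesis
  proof
    show "(\<lambda>z. f z / (1 + g z)) holomorphic_on ball 0 1" "(\<lambda>z. 1 / (1 + g z)) holomorphic_on ball 0 1"
      using nz by (intro holomorphic_intros f g; simp)+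
    fix z :: complex assume z: "z \<in> ball 0 1"
    have pos: "0 < cmod (1 + g z)" using nz[OF z] by simp
    show "cmod (f z / (1 + g z)) \<le> 1" "cmod (1 / (1 + g z)) \<le> 1"
      unfolding norm_divide divide_le_eq_1_pos[OF pos] norm_one using big[OF z] norm_ge_zero[of "f z"] by linarith+
    show "1 / (1 + g z) \<noteq> 0" "f z = f z / (1 + g z) / (1 / (1 + g z))" using nz[OF z] by auto
  qed
qed

text \<open>The radius lies in the Stolz region of aperture 2, since the distance from its points to
  the boundary point is exactly 1 - |z|.\<close>

lemma has_nontangential_limit_radial:
  assumes "has_nontangential_limit f (cis t) L"
  shows "(\<lambda>n. f (of_real (1 - 1 / real (n + 2)) * cis t)) \<longlonglongrightarrow> L"
proof -
  define \<rho> where "\<rho> = (\<lambda>n. 1 - 1 / real (n + 2))"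
  have \<rho>: "0 \<le> \<rho> n" "0 < \<rho> n" "\<rho> n < 1" "\<rho> \<longlonglongrightarrow> 1" for n
    unfolding \<rho>_def by (rule approach_radius)+
  have "(f \<longlongrightarrow> L) (at (cis t) within stolz_region (cis t) 2)"
    using assms by (simp add: has_nontangential_limit_def)
  moreover have "filterlim (\<lambda>n. of_real (\<rho> n) * cis t) (at (cis t) within stolz_region (cis t) 2) sequentially"
    unfolding filterlim_at
  proof
    show "\<forall>\<^sub>F n in sequentially. of_real (\<rho> n) * cis t \<in> stolz_region (cis t) 2 \<and> of_real (\<rho> n) * cis t \<noteq> cis t"
    proof (intro always_eventually allI conjI)
      fix n
      have n1: "cmod (of_real (\<rho> n) * cis t) = \<rho> n" using \<rho>(1)[of n] by (simp add: norm_mult)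
      have "of_real (\<rho> n) * cis t - cis t = of_real (\<rho> n - 1) * cis t" by (simp add: algebra_simps)
      then have n2: "cmod (of_real (\<rho> n) * cis t - cis t) = 1 - \<rho> n"
        using \<rho>(3)[of n] by (simp only: norm_mult norm_of_real norm_cis) simp
      show "of_real (\<rho> n) * cis t \<in> stolz_region (cis t) 2"
        unfolding stolz_region_def mem_Collect_eq mem_ball_0 n1 n2 using \<rho>(3)[of n] by simp
      show "of_real (\<rho> n) * cis t \<noteq> cis t" using n2 \<rho>(3)[of n] by force
    qed
    have "(\<lambda>n. of_real (\<rho> n) * cis t) \<longlonglongrightarrow> of_real 1 * cis t" by (intro tendsto_intros \<rho>)
    then show "(\<lambda>n. of_real (\<rho> n) * cis t) \<longlonglongrightarrow> cis t" by simp
  qed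
  ultimately have "(\<lambda>n. f (of_real (\<rho> n) * cis t)) \<longlonglongrightarrow> L" by (rule filterlim_compose)
  then show ?thesis by (simp add: \<rho>_def)
qed

text \<open>Measurability matters because this set is shown to be null by applying uniqueness to it
  as a set of positive measure. Testing the tolerances 1 / (j + 1) makes the limit statement
  countable.\<close>

lemma sets_radial_limit_zero:
  assumes B: "B holomorphic_on ball 0 1"
  shows "{t \<in> {0..2*pi}. (\<lambda>n. B (of_real (1 - 1 / real (n + 2)) * cis t)) \<longlonglongrightarrow> 0} \<in> sets lebesgue"
proof -
  define X where "X = (\<lambda>n t. cmod (B (of_real (1 - 1 / real (n + 2)) * cis t)))"
  have "continuous_on {0..2*pi} (X n)" for n
    unfolding X_def using approach_radius(1,3)[of n]
    by (intro continuous_on_norm continuous_on_compose2[OF holomorphic_on_imp_continuous_on[OF B]] continuous_intros)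
      (auto simp: norm_mult simp del: of_real_diff)
  then have [measurable]: "X n \<in> borel_measurable circle_measure" for n
    by (intro continuous_imp_measurable_on_sets_lebesgue) auto
  have "((\<lambda>n. B (of_real (1 - 1 / real (n + 2)) * cis t)) \<longlonglongrightarrow> 0) \<longleftrightarrow> (\<forall>j. \<exists>m. \<forall>n\<ge>m. X n t < 1 / real (Suc j))" for t
    unfolding LIMSEQ_def X_def dist_norm diff_0_right
  proof safe
    fix j assume *: "\<forall>r>0. \<exists>no. \<forall>n\<ge>no. cmod (B (of_real (1 - 1 / real (n + 2)) * cis t)) < r"
    show "\<exists>m. \<forall>n\<ge>m. cmod (B (of_real (1 - 1 / real (n + 2)) * cis t)) < 1 / real (Suc j)"
      by (rule *[rule_format]) simp
  next
    fix r :: real assume "0 < r" and *: "\<forall>j. \<exists>m. \<forall>n\<ge>m. cmod (B (of_real (1 - 1 / real (n + 2)) * cis t)) < 1 / real (Suc j)"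
    obtain j where j: "inverse (real (Suc j)) < r" using reals_Archimedean[OF \<open>0 < r\<close>] by blast
    obtain m where "\<forall>n\<ge>m. cmod (B (of_real (1 - 1 / real (n + 2)) * cis t)) < 1 / real (Suc j)" using * by blast
    then show "\<exists>no. \<forall>n\<ge>no. cmod (B (of_real (1 - 1 / real (n + 2)) * cis t)) < r"
      using j by (intro exI[of _ m]) (auto simp: inverse_eq_divide intro: less_trans)
  qed
  then have "{t \<in> {0..2*pi}. (\<lambda>n. B (of_real (1 - 1 / real (n + 2)) * cis t)) \<longlonglongrightarrow> 0} =
     {t \<in> space circle_measure. \<forall>j. \<exists>m. \<forall>n\<ge>m. X n t < 1 / real (Suc j)}" by simp
  also have "\<dots> \<in> sets circle_measure" by measurable
  finally show ?thesis by (subst (asm) sets_restrict_space_iff) auto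
qed

text \<open>In f = A / B with |B| \<le> 1 the numerator satisfies |A| \<le> |f|, so the bounded
  function A inherits the vanishing radial limits.\<close>

lemma H1_boundary_uniqueness:
  fixes f :: "complex \<Rightarrow> complex"
  assumes f: "f holomorphic_on ball 0 1"
    and M: "\<And>r. 0 \<le> r \<Longrightarrow> r < 1 \<Longrightarrow> (\<integral>t. cmod (f (of_real r * cis t)) \<partial>circle_measure) \<le> M"
    and E: "E \<in> sets lebesgue" "E \<subseteq> {0..2*pi}" "0 < emeasure lebesgue E"
    and lim: "\<And>t. t \<in> E \<Longrightarrow> (\<lambda>n. f (of_real (1 - 1 / real (n + 2)) * cis t)) \<longlonglongrightarrow> 0"
    and z: "z \<in> ball 0 1"
  shows "f z = 0"
proof -
  obtain A B where AB: "A holomorphic_on ball 0 1" "B holomorphic_on ball 0 1"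
    "\<And>z. z \<in> ball 0 1 \<Longrightarrow> cmod (A z) \<le> 1" "\<And>z. z \<in> ball 0 1 \<Longrightarrow> cmod (B z) \<le> 1"
    "\<And>z. z \<in> ball 0 1 \<Longrightarrow> B z \<noteq> 0" "\<And>z. z \<in> ball 0 1 \<Longrightarrow> f z = A z / B z"
    using H1_bounded_quotient[OF f M] by blast
  have Af: "cmod (A z) \<le> cmod (f z)" if z: "z \<in> ball 0 1" for z
    using AB(4-6)[OF z] by (simp add: norm_divide pos_le_divide_eq mult_left_le)
  have "A z = 0"
  proof (rule bounded_holomorphic_boundary_uniqueness[OF AB(1,3) E _ z])
    fix t assume "t \<in> E"
    show "(\<lambda>n. A (of_real (1 - 1 / real (n + 2)) * cis t)) \<longlonglongrightarrow> 0"
    proof (rule Lim_null_comparison[OF _ tendsto_norm_zero[OF lim[OF \<open>t \<in> E\<close>]]], intro always_eventually allI Af)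
      show "of_real (1 - 1 / real (n + 2)) * cis t \<in> ball 0 1" for n
        using norm_scaled_less_1[of "1 - 1 / real (n+2)" "cis t"] approach_radius(1,3)[of n]
        by (simp add: norm_mult del: of_real_diff)
    qed
  qed
  then show ?thesis using AB(6)[OF z] by simp
qed

text \<open>Both bounded functions in f = A / B have limits almost everywhere. The limit of B
  vanishes only on a null set, since otherwise uniqueness would give B = 0; off that set the limits
  may be divided.\<close>

lemma H1_nontangential_limit_ae:
  fixes f :: "complex \<Rightarrow> complex"
  assumes f: "f holomorphic_on ball 0 1"
    and M: "\<And>r. 0 \<le> r \<Longrightarrow> r < 1 \<Longrightarrow> (\<integral>t. cmod (f (of_real r * cis t)) \<partial>circle_measure) \<le> M"
  shows "negligible {t\<in>{0..2*pi}. \<not> (\<exists>L. has_nontangential_limit f (cis t) L)}"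
proof -
  obtain A B where AB: "A holomorphic_on ball 0 1" "B holomorphic_on ball 0 1"
    "\<And>z. z \<in> ball 0 1 \<Longrightarrow> cmod (A z) \<le> 1" "\<And>z. z \<in> ball 0 1 \<Longrightarrow> cmod (B z) \<le> 1"
    "\<And>z. z \<in> ball 0 1 \<Longrightarrow> B z \<noteq> 0" "\<And>z. z \<in> ball 0 1 \<Longrightarrow> f z = A z / B z"
    using H1_bounded_quotient[OF f M] by blast
  define Z where "Z = {t \<in> {0..2*pi}. (\<lambda>n. B (of_real (1 - 1 / real (n + 2)) * cis t)) \<longlonglongrightarrow> 0}"
  have Zm: "Z \<in> sets lebesgue" unfolding Z_def by (rule sets_radial_limit_zero[OF AB(2)])
  have Zn: "negligible Z"
  proof (rule ccontr)
    assume "\<not> negligible Z"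
    then have "emeasure lebesgue Z > 0" using negligible_iff_emeasure0[OF Zm] by (simp add: zero_less_iff_neq_zero)
    then have "B 0 = 0"
      by (intro bounded_holomorphic_boundary_uniqueness[OF AB(2,4) Zm]) (auto simp: Z_def)
    then show False using AB(5)[of 0] by simp
  qed
  let ?N = "\<lambda>f. {t\<in>{0..2*pi}. \<not> (\<exists>L. has_nontangential_limit f (cis t) L)}"
  have "negligible (?N A)" "negligible (?N B)"
    by (rule bounded_holomorphic_nontangential_ae[OF AB(1,3)] bounded_holomorphic_nontangential_ae[OF AB(2,4)]; simp)+
  then have "negligible (?N A \<union> ?N B \<union> Z)" using Zn by (intro negligible_Un)
  moreover have "?N f \<subseteq> ?N A \<union> ?N B \<union> Z"
  proof (rule subsetI, rule ccontr)
    fix t assume t: "t \<in> ?N f" "t \<notin> ?N A \<union> ?N B \<union> Z"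
    then obtain a b where ab: "has_nontangential_limit A (cis t) a" "has_nontangential_limit B (cis t) b" by auto
    have "b \<noteq> 0" using has_nontangential_limit_radial[OF ab(2)] t by (auto simp: Z_def)
    have "has_nontangential_limit f (cis t) (a / b)"
      unfolding has_nontangential_limit_def
    proof (intro allI impI)
      fix s :: real assume "1 < s"
      then have "((\<lambda>z. A z / B z) \<longlongrightarrow> a / b) (at (cis t) within stolz_region (cis t) s)"
        using ab \<open>b \<noteq> 0\<close> unfolding has_nontangential_limit_def by (intro tendsto_divide) auto
      then show "(f \<longlongrightarrow> a / b) (at (cis t) within stolz_region (cis t) s)"
        by (rule Lim_transform_eventually) (auto simp: eventually_at_filter stolz_region_def AB(6))
    qed
    then show False using t(1) by blast
  qed
  ultimately show ?thesis by (rule negligible_subset)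
qed

section \<open>The Choquet integral of a concave distortion\<close>

text \<open>Fubini for the region under the graph; negative values of \<open>u\<close> drop out on
  both sides. It serves twice, for Lebesgue measure on the circle and for the Stieltjes measure of
  \<phi>.\<close>

lemma nn_integral_layer_cake:
  fixes u :: "'a \<Rightarrow> real"
  assumes "sigma_finite_measure M" and [measurable]: "u \<in> borel_measurable M"
  shows "(\<integral>\<^sup>+s. ennreal (u s) \<partial>M) = (\<integral>\<^sup>+\<tau>\<in>{0..}. emeasure M {s \<in> space M. \<tau> < u s} \<partial>lborel)"
proof -
  interpret pair_sigma_finite M lborel
    using assms(1) by (simp add: pair_sigma_finite_def lborel.sigma_finite_measure_axioms)
  let ?g = "\<lambda>p. indicator {p \<in> space (M \<Otimes>\<^sub>M lborel). 0 \<le> snd p \<and> snd p < u (fst p)} p :: ennreal"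
  have m: "?g \<in> borel_measurable (M \<Otimes>\<^sub>M lborel)" by measurable
  have "(\<integral>\<^sup>+s. ennreal (u s) \<partial>M) = (\<integral>\<^sup>+s. (\<integral>\<^sup>+\<tau>. ?g (s, \<tau>) \<partial>lborel) \<partial>M)"
  proof (rule nn_integral_cong)
    fix s assume s: "s \<in> space M"
    have "(\<integral>\<^sup>+\<tau>. ?g (s, \<tau>) \<partial>lborel) = (\<integral>\<^sup>+\<tau>. indicator {0..<u s} \<tau> \<partial>lborel)"
      using s by (intro nn_integral_cong) (auto simp: space_pair_measure split: split_indicator)
    also have "\<dots> = ennreal (u s)" by (cases "0 \<le> u s") (auto simp: ennreal_neg)
    finally show "ennreal (u s) = (\<integral>\<^sup>+\<tau>. ?g (s, \<tau>) \<partial>lborel)" ..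
  qed
  also have "\<dots> = (\<integral>\<^sup>+\<tau>. (\<integral>\<^sup>+s. ?g (s, \<tau>) \<partial>M) \<partial>lborel)" by (rule Fubini[OF m, symmetric])
  also have "\<dots> = (\<integral>\<^sup>+\<tau>\<in>{0..}. emeasure M {s \<in> space M. \<tau> < u s} \<partial>lborel)"
  proof (rule nn_integral_cong)
    fix \<tau> :: real
    have "(\<integral>\<^sup>+s. ?g (s, \<tau>) \<partial>M) = (\<integral>\<^sup>+s. indicator {s \<in> space M. \<tau> < u s} s * indicator {0..} \<tau> \<partial>M)"
      by (intro nn_integral_cong) (auto simp: space_pair_measure split: split_indicator)
    also have "\<dots> = emeasure M {s \<in> space M. \<tau> < u s} * indicator {0..} \<tau>"
      by (subst nn_integral_multc) auto
    finally show "(\<integral>\<^sup>+s. ?g (s, \<tau>) \<partial>M) = emeasure M {s \<in> space M. \<tau> < u s} * indicator {0..} \<tau>" .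
  qed
  finally show ?thesis .
qed

section \<open>Step functions of mesh \<open>e\<close>\<close>

lemma nn_integral_step:
  assumes c: "\<And>k. 0 \<le> c k" and e: "0 < e"
  shows "(\<integral>\<^sup>+\<tau>. ennreal (\<Sum>k<n. c k * indicator {real k * e..<real (Suc k) * e} \<tau>) \<partial>lborel) = ennreal (e * (\<Sum>k<n. c k))"
proof -
  have "(\<integral>\<^sup>+\<tau>. ennreal (\<Sum>k<n. c k * indicator {real k * e..<real (Suc k) * e} \<tau>) \<partial>lborel) =
     (\<integral>\<^sup>+\<tau>. (\<Sum>k<n. ennreal (c k) * indicator {real k * e..<real (Suc k) * e} \<tau>) \<partial>lborel)"
  proof (rule nn_integral_cong)
    fix \<tau> :: real
    have "ennreal (\<Sum>k<n. c k * indicator {real k * e..<real (Suc k) * e} \<tau>) =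
        (\<Sum>k<n. ennreal (c k * indicator {real k * e..<real (Suc k) * e} \<tau>))"
      using c by (intro sum_ennreal[symmetric] mult_nonneg_nonneg indicator_pos_le)
    also have "\<dots> = (\<Sum>k<n. ennreal (c k) * indicator {real k * e..<real (Suc k) * e} \<tau>)"
      by (intro sum.cong refl) (simp split: split_indicator)
    finally show "ennreal (\<Sum>k<n. c k * indicator {real k * e..<real (Suc k) * e} \<tau>) =
        (\<Sum>k<n. ennreal (c k) * indicator {real k * e..<real (Suc k) * e} \<tau>)" .
  qed
  also have "\<dots> = (\<Sum>k<n. ennreal (c k) * ennreal e)"
  proof (subst nn_integral_sum)
    have "emeasure lborel {real k * e..<real (Suc k) * e} = ennreal e" for k
      using e by (subst emeasure_lborel_Ico) (auto simp: algebra_simps)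
    then show "(\<Sum>k<n. \<integral>\<^sup>+\<tau>. ennreal (c k) * indicator {real k * e..<real (Suc k) * e} \<tau> \<partial>lborel) = (\<Sum>k<n. ennreal (c k) * ennreal e)"
      by (intro sum.cong) (auto simp: nn_integral_cmult_indicator)
  qed auto
  also have "\<dots> = ennreal (e * (\<Sum>k<n. c k))"
  proof -
    have "(\<Sum>k<n. ennreal (c k) * ennreal e) = (\<Sum>k<n. ennreal (e * c k))"
      using c e by (intro sum.cong refl) (simp add: ennreal_mult[symmetric] mult.commute)
    also have "\<dots> = ennreal (\<Sum>k<n. e * c k)" using c e by (intro sum_ennreal) simp
    finally show ?thesis by (simp only: sum_distrib_left)
  qed
  finally show ?thesis .
qed

lemma step_value:
  assumes e: "0 < e" and \<tau>: "0 \<le> \<tau>"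
  shows "(\<Sum>k<n. c k * indicator {real k * e..<real (Suc k) * e} \<tau>) =
    (if nat \<lfloor>\<tau> / e\<rfloor> < n then c (nat \<lfloor>\<tau> / e\<rfloor>) else (0::real))"
proof -
  have ind: "indicator {real k * e..<real (Suc k) * e} \<tau> = (if k = nat \<lfloor>\<tau> / e\<rfloor> then 1 else (0::real))" for k
  proof -
    have "\<tau> \<in> {real k * e..<real (Suc k) * e} \<longleftrightarrow> real k \<le> \<tau> / e \<and> \<tau> / e < real (Suc k)"
      using e by (simp add: field_simps)
    also have "\<dots> \<longleftrightarrow> \<lfloor>\<tau> / e\<rfloor> = int k" by (simp add: floor_eq_iff add.commute)
    also have "\<dots> \<longleftrightarrow> k = nat \<lfloor>\<tau> / e\<rfloor>" using e \<tau> by auto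
    finally show ?thesis by (simp add: indicator_def)
  qed
  have "(\<Sum>k<n. c k * indicator {real k * e..<real (Suc k) * e} \<tau>) = (\<Sum>k<n. if k = nat \<lfloor>\<tau> / e\<rfloor> then c k else 0)"
    unfolding ind by (intro sum.cong) auto
  then show ?thesis by (simp add: sum.delta)
qed

text \<open>By the layer-cake formula the Lorentz norm is the Choquet integral with respect to the
  submodular set function \<open>\<phi> \<circ> measure M\<close>.\<close>

definition choquet :: "'a measure \<Rightarrow> (real \<Rightarrow> real) \<Rightarrow> ('a \<Rightarrow> real) \<Rightarrow> ennreal" where
  "choquet M \<phi> u = (\<integral>\<^sup>+\<tau>\<in>{0..}. ennreal (\<phi> (measure M {s \<in> space M. \<tau> < u s})) \<partial>lborel)"

text \<open>Concavity is stated as decrease of increments of equal length, the form in which a piece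
  is added to a smaller and to a larger set. Strictness enters through the numerical gains \<delta>
  assumed in individual lemmas.\<close>

locale concave_distortion = finite_measure M for M :: "'a measure" +
  fixes \<phi> :: "real \<Rightarrow> real"
  assumes distortion_mono: "0 \<le> s \<Longrightarrow> s \<le> t \<Longrightarrow> t \<le> measure M (space M) \<Longrightarrow> \<phi> s \<le> \<phi> t"
    and distortion_concave: "0 \<le> b \<Longrightarrow> b \<le> a \<Longrightarrow> 0 \<le> d \<Longrightarrow> a + d \<le> measure M (space M) \<Longrightarrow>
      \<phi> (a + d) - \<phi> a \<le> \<phi> (b + d) - \<phi> b"
    and distortion_0 [simp]: "\<phi> 0 = 0"
begin

abbreviation capacity :: "'a set \<Rightarrow> real" where
  "capacity A \<equiv> \<phi> (measure M A)"

lemma capacity_mono: "A \<subseteq> B \<Longrightarrow> B \<in> sets M \<Longrightarrow> capacity A \<le> capacity B"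
  by (intro distortion_mono finite_measure_mono bounded_measure) auto

lemma capacity_nonneg: "0 \<le> capacity A"
  using distortion_mono[of 0 "measure M A"] bounded_measure[of A] by simp

lemma capacity_le_space: "capacity A \<le> capacity (space M)"
  by (intro distortion_mono bounded_measure) auto

text \<open>Two uses of concavity trim \<open>A - B\<close> and \<open>B - A\<close> to measure
  \<eta> each; what then remains is the second difference of \<phi> with step \<eta>, which is worth
  at least \<delta>. With \<eta> = \<delta> = 0 this is ordinary submodularity.\<close>

lemma capacity_submodular:
  assumes [measurable]: "A \<in> sets M" "B \<in> sets M"
    and \<eta>: "0 \<le> \<eta>" "\<eta> \<le> measure M (A - B)" "\<eta> \<le> measure M (B - A)"
    and \<delta>: "\<And>c. 0 \<le> c \<Longrightarrow> c + 2 * \<eta> \<le> measure M (space M) \<Longrightarrow> \<phi> (c + 2 * \<eta>) + \<phi> c + \<delta> \<le> 2 * \<phi> (c + \<eta>)"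
  shows "capacity (A \<union> B) + capacity (A \<inter> B) + \<delta> \<le> capacity A + capacity B"
proof -
  define a b c where "a = measure M (A - B)" "b = measure M (B - A)" "c = measure M (A \<inter> B)"
  have "measure M ((A \<inter> B) \<union> (A - B)) = c + a" "measure M ((A \<inter> B) \<union> (B - A)) = c + b"
    unfolding a_b_c_def by (rule finite_measure_Union; auto)+
  moreover have "(A \<inter> B) \<union> (A - B) = A" "(A \<inter> B) \<union> (B - A) = B" by auto
  ultimately have A: "measure M A = c + a" and B: "measure M B = c + b" by auto
  have AB: "measure M (A \<union> B) = c + a + b"
    using finite_measure_Union[of A "B - A"] A by (simp add: a_b_c_def Diff_disjoint)
  have le: "c + a + b \<le> measure M (space M)" using AB bounded_measure[of "A \<union> B"] by simp
  have c0: "0 \<le> c" "\<eta> \<le> a" "\<eta> \<le> b" using \<eta> by (auto simp: a_b_c_def)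
  have "\<phi> (c + 2 * \<eta>) + \<phi> c + \<delta> \<le> 2 * \<phi> (c + \<eta>)" using c0 le \<eta>(1) by (intro \<delta>) auto
  moreover have "\<phi> ((c + b + \<eta>) + (a - \<eta>)) - \<phi> (c + b + \<eta>) \<le> \<phi> ((c + \<eta>) + (a - \<eta>)) - \<phi> (c + \<eta>)"
    using c0 le \<eta>(1) by (intro distortion_concave) auto
  moreover have "\<phi> ((c + \<eta> + \<eta>) + (b - \<eta>)) - \<phi> (c + \<eta> + \<eta>) \<le> \<phi> ((c + \<eta>) + (b - \<eta>)) - \<phi> (c + \<eta>)"
    using c0 le \<eta>(1) by (intro distortion_concave) auto
  ultimately show ?thesis unfolding A B AB a_b_c_def(3)[symmetric] by (simp add: algebra_simps)
qed

section \<open>Level sets and elementary rules for the Choquet integral\<close>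

definition level :: "('a \<Rightarrow> real) \<Rightarrow> real \<Rightarrow> 'a set" where
  "level u \<tau> = {s \<in> space M. \<tau> < u s}"

lemma choquet_level: "choquet M \<phi> u = (\<integral>\<^sup>+\<tau>\<in>{0..}. ennreal (capacity (level u \<tau>)) \<partial>lborel)"
  by (simp add: choquet_def level_def)

lemma sets_level [measurable (raw)]: "u \<in> borel_measurable M \<Longrightarrow> level u \<tau> \<in> sets M"
  unfolding level_def by measurable

lemma measurable_capacity_level [measurable (raw)]:
  assumes u: "u \<in> borel_measurable M"
  shows "(\<lambda>\<tau>. capacity (level u \<tau>)) \<in> borel_measurable borel"
proof -
  have "mono (\<lambda>\<tau>. - capacity (level u \<tau>))"
  proof (rule monoI)
    fix \<tau> \<tau>' :: real assume "\<tau> \<le> \<tau>'"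
    then have "level u \<tau>' \<subseteq> level u \<tau>" by (auto simp: level_def)
    then show "- capacity (level u \<tau>) \<le> - capacity (level u \<tau>')"
      using capacity_mono[OF _ sets_level[OF u]] by simp
  qed
  then have "(\<lambda>\<tau>. - (- capacity (level u \<tau>))) \<in> borel_measurable borel"
    by (intro borel_measurable_uminus borel_measurable_mono)
  then show ?thesis by simp
qed

lemma choquet_mono:
  assumes "v \<in> borel_measurable M" "\<And>s. s \<in> space M \<Longrightarrow> u s \<le> v s"
  shows "choquet M \<phi> u \<le> choquet M \<phi> v"
  unfolding choquet_level
  by (intro nn_integral_mono mult_right_mono ennreal_leI capacity_mono sets_level assms)
    (use assms(2) in \<open>auto simp: level_def intro: less_le_trans\<close>)

lemma choquet_cong: "(\<And>s. s \<in> space M \<Longrightarrow> u s = v s) \<Longrightarrow> choquet M \<phi> u = choquet M \<phi> v"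
proof -
  assume "\<And>s. s \<in> space M \<Longrightarrow> u s = v s"
  then have "{s \<in> space M. \<tau> < u s} = {s \<in> space M. \<tau> < v s}" for \<tau> by auto
  then show ?thesis by (simp only: choquet_def)
qed

lemma choquet_cmult:
  assumes [measurable]: "u \<in> borel_measurable M" and c: "0 < c"
  shows "choquet M \<phi> (\<lambda>s. c * u s) = ennreal c * choquet M \<phi> u"
proof -
  have "choquet M \<phi> (\<lambda>s. c * u s) = ennreal \<bar>c\<bar> * (\<integral>\<^sup>+\<tau>. ennreal (capacity (level (\<lambda>s. c * u s) (0 + c * \<tau>))) * indicator {0..} (0 + c * \<tau>) \<partial>lborel)"
    unfolding choquet_level using c by (intro nn_integral_real_affine) auto
  also have "(\<lambda>\<tau>. ennreal (capacity (level (\<lambda>s. c * u s) (0 + c * \<tau>))) * indicator {0..} (0 + c * \<tau>)) =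
     (\<lambda>\<tau>. ennreal (capacity (level u \<tau>)) * indicator {0..} \<tau>)"
    using c by (auto simp: level_def indicator_def zero_le_mult_iff fun_eq_iff)
  finally show ?thesis using c unfolding choquet_level by simp
qed

lemma choquet_const:
  assumes "0 \<le> c"
  shows "choquet M \<phi> (\<lambda>_. c) = ennreal (c * capacity (space M))"
proof -
  have "choquet M \<phi> (\<lambda>_. c) = (\<integral>\<^sup>+\<tau>. ennreal (capacity (space M)) * indicator {0..<c} \<tau> \<partial>lborel)"
    unfolding choquet_def by (intro nn_integral_cong) (auto split: split_indicator)
  also have "\<dots> = ennreal (capacity (space M)) * ennreal c"
    using assms by (subst nn_integral_cmult_indicator) auto
  finally show ?thesis using assms capacity_nonneg by (simp add: ennreal_mult[symmetric] mult.commute)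
qed

text \<open>The Choquet integral of a function with integer values up to \<open>K\<close>, whose
  level sets change only at integers. In this form subadditivity can be proved by induction on the
  values.\<close>

definition nat_choquet :: "nat \<Rightarrow> ('a \<Rightarrow> nat) \<Rightarrow> real" where
  "nat_choquet K X = (\<Sum>k<K. capacity {s \<in> space M. k < X s})"

text \<open>Increasing \<open>X\<close> by \<open>1\<close> on \<open>B\<close> enlarges the level set \<open>{k < X}\<close> by \<open>B \<inter> {X = k}\<close>.  By concavity this adds
  at most what it adds to \<open>B \<inter> {k < X}\<close>, and those increments telescope to the capacity of \<open>B\<close>.\<close>

lemma nat_choquet_add_indicator:
  assumes X [measurable]: "X \<in> measurable M (count_space UNIV)" and B [measurable]: "B \<in> sets M"
    and K: "\<And>s. s \<in> space M \<Longrightarrow> X s \<le> K"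
  shows "nat_choquet (Suc K) (\<lambda>s. X s + (if s \<in> B then 1 else 0)) \<le> nat_choquet K X + capacity B"
proof -
  define A where "A = (\<lambda>j. {s \<in> space M. j \<le> X s})"
  have [measurable]: "A j \<in> sets M" for j unfolding A_def by measurable
  have Bsub: "B \<subseteq> space M" using B by (rule sets.sets_into_space)
  define a where "a = (\<lambda>j. measure M (A j))"
  define b where "b = (\<lambda>j. measure M (B \<inter> A j))"
  have ab: "capacity {s \<in> space M. k < X s + (if s \<in> B then 1 else 0)} \<le> \<phi> (a (Suc k)) + (\<phi> (b k) - \<phi> (b (Suc k)))" for k
  proof -
    let ?C = "B \<inter> A k - B \<inter> A (Suc k)"
    have "{s \<in> space M. k < X s + (if s \<in> B then 1 else 0)} = A (Suc k) \<union> ?C"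
      using Bsub by (auto simp: A_def split: if_splits)
    moreover have "measure M (A (Suc k) \<union> ?C) = a (Suc k) + measure M ?C"
      unfolding a_def by (intro finite_measure_Union) auto
    moreover have "measure M ?C = b k - b (Suc k)"
      unfolding b_def by (intro finite_measure_Diff) (auto simp: A_def)
    ultimately have eq: "measure M {s \<in> space M. k < X s + (if s \<in> B then 1 else 0)} = a (Suc k) + (b k - b (Suc k))"
      by simp
    have "\<phi> (a (Suc k) + (b k - b (Suc k))) - \<phi> (a (Suc k)) \<le> \<phi> (b (Suc k) + (b k - b (Suc k))) - \<phi> (b (Suc k))"
    proof (rule distortion_concave)
      show "b (Suc k) \<le> a (Suc k)" unfolding a_def b_def by (intro finite_measure_mono) auto
      show "0 \<le> b k - b (Suc k)" unfolding b_def by (simp, intro finite_measure_mono) (auto simp: A_def)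
      show "a (Suc k) + (b k - b (Suc k)) \<le> measure M (space M)" unfolding eq[symmetric] by (rule bounded_measure)
    qed (simp add: b_def)
    then show ?thesis unfolding eq by simp
  qed
  have "A (Suc K) = {}" using K by (force simp: A_def)
  then have K0: "a (Suc K) = 0" "b (Suc K) = 0" by (simp_all add: a_def b_def)
  have "b 0 = measure M B" using Bsub by (auto simp: b_def A_def Int_absorb2)
  have "nat_choquet (Suc K) (\<lambda>s. X s + (if s \<in> B then 1 else 0)) \<le> (\<Sum>k<Suc K. \<phi> (a (Suc k)) + (\<phi> (b k) - \<phi> (b (Suc k))))"
    unfolding nat_choquet_def by (intro sum_mono ab)
  also have "\<dots> = (\<Sum>k<Suc K. \<phi> (a (Suc k))) + (\<phi> (b 0) - \<phi> (b (Suc K)))"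
    by (simp only: sum.distrib sum_lessThan_telescope'[of "\<lambda>k. \<phi> (b k)" "Suc K"])
  also have "\<dots> = (\<Sum>k<K. \<phi> (a (Suc k))) + capacity B"
    using K0 \<open>b 0 = measure M B\<close> by simp
  also have "(\<Sum>k<K. \<phi> (a (Suc k))) = nat_choquet K X"
    by (simp add: nat_choquet_def a_def A_def Suc_le_eq)
  finally show ?thesis .
qed

text \<open>Induction on the bound of \<open>Y\<close>: its top level, where \<open>L < Y\<close>,
  is split off as an indicator, and the rest \<open>min (Y s) L\<close> has the smaller
  bound.\<close>

lemma nat_choquet_add:
  assumes X [measurable]: "X \<in> measurable M (count_space UNIV)" and K: "\<And>s. s \<in> space M \<Longrightarrow> X s \<le> K"
  shows "Y \<in> measurable M (count_space UNIV) \<Longrightarrow> (\<And>s. s \<in> space M \<Longrightarrow> Y s \<le> L) \<Longrightarrow>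
    nat_choquet (K + L) (\<lambda>s. X s + Y s) \<le> nat_choquet K X + nat_choquet L Y"
proof (induction L arbitrary: Y)
  case 0
  then have "{s \<in> space M. k < X s + Y s} = {s \<in> space M. k < X s}" for k by force
  then show ?case by (simp add: nat_choquet_def)
next
  case (Suc L)
  note [measurable] = Suc.prems(1)
  define Y' where "Y' = (\<lambda>s. min (Y s) L)"
  define B where "B = {s \<in> space M. L < Y s}"
  have [measurable]: "Y' \<in> measurable M (count_space UNIV)" "B \<in> sets M" unfolding Y'_def B_def by measurable
  have "nat_choquet (K + Suc L) (\<lambda>s. X s + Y s) = nat_choquet (Suc (K + L)) (\<lambda>s. (X s + Y' s) + (if s \<in> B then 1 else 0))"
  proof -
    have "X s + Y s = (X s + Y' s) + (if s \<in> B then 1 else 0)" if "s \<in> space M" for s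
      using Suc.prems(2)[OF that] that by (auto simp: Y'_def B_def)
    then have "{s \<in> space M. k < X s + Y s} = {s \<in> space M. k < (X s + Y' s) + (if s \<in> B then 1 else 0)}" for k
      by force
    then show ?thesis by (simp add: nat_choquet_def)
  qed
  also have "\<dots> \<le> nat_choquet (K + L) (\<lambda>s. X s + Y' s) + capacity B"
    using K by (intro nat_choquet_add_indicator) (auto simp: Y'_def intro!: add_mono)
  also have "nat_choquet (K + L) (\<lambda>s. X s + Y' s) \<le> nat_choquet K X + nat_choquet L Y'"
    by (intro Suc.IH) (auto simp: Y'_def)
  also have "nat_choquet L Y' = nat_choquet L Y"
  proof -
    have "{s \<in> space M. k < Y' s} = {s \<in> space M. k < Y s}" if "k < L" for k using that by (auto simp: Y'_def)
    then show ?thesis by (simp add: nat_choquet_def)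
  qed
  also have "nat_choquet K X + nat_choquet L Y + capacity B = nat_choquet K X + nat_choquet (Suc L) Y"
    by (simp add: nat_choquet_def B_def)
  finally show ?case by simp
qed

text \<open>For heights \<tau> in the block [k e, (k+1) e) the level set of \<open>x\<close>
  contains \<open>{k < X}\<close> and, for k > 0, lies in \<open>{k - 1 < X}\<close>. The upper sum
  is thus the lower one shifted by one block, with the capacity of the whole space filling the first
  block; the bounds differ by e times that capacity.\<close>

lemma choquet_discretize:
  assumes x [measurable]: "x \<in> borel_measurable M" and e: "0 < e"
    and x0: "\<And>s. s \<in> space M \<Longrightarrow> 0 \<le> x s" and K: "\<And>s. s \<in> space M \<Longrightarrow> x s \<le> real K * e"
  defines "X \<equiv> \<lambda>s. nat \<lfloor>x s / e\<rfloor>"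
  shows "ennreal (e * nat_choquet K X) \<le> choquet M \<phi> x"
    and "choquet M \<phi> x \<le> ennreal (e * (capacity (space M) + nat_choquet K X))"
proof -
  have Xiff: "k < X s \<longleftrightarrow> real (Suc k) * e \<le> x s" if "s \<in> space M" for k s
  proof -
    have "k < X s \<longleftrightarrow> int (Suc k) \<le> \<lfloor>x s / e\<rfloor>" using x0[OF that] e unfolding X_def by linarith
    also have "\<dots> \<longleftrightarrow> real (Suc k) \<le> x s / e" by (simp add: le_floor_iff)
    finally show ?thesis using e by (simp add: field_simps)
  qed
  have [measurable]: "X \<in> measurable M (count_space UNIV)" unfolding X_def by measurable
  let ?c = "\<lambda>k. capacity {s \<in> space M. k < X s}"
  have j: "real (nat \<lfloor>\<tau> / e\<rfloor>) * e \<le> \<tau>" "\<tau> < real (Suc (nat \<lfloor>\<tau> / e\<rfloor>)) * e" if "0 \<le> \<tau>" for \<tau>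
  proof -
    have "real (nat \<lfloor>\<tau> / e\<rfloor>) \<le> \<tau> / e" "\<tau> / e < real (Suc (nat \<lfloor>\<tau> / e\<rfloor>))" using that e by (auto simp: of_nat_nat) linarith
    then show "real (nat \<lfloor>\<tau> / e\<rfloor>) * e \<le> \<tau>" "\<tau> < real (Suc (nat \<lfloor>\<tau> / e\<rfloor>)) * e" using e by (simp_all add: field_simps)
  qed
  have "ennreal (e * nat_choquet K X) = (\<integral>\<^sup>+\<tau>. ennreal (\<Sum>k<K. ?c k * indicator {real k * e..<real (Suc k) * e} \<tau>) \<partial>lborel)"
    unfolding nat_choquet_def by (subst nn_integral_step) (auto simp: capacity_nonneg e)
  also have "\<dots> \<le> choquet M \<phi> x"
    unfolding choquet_level
  proof (rule nn_integral_mono)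
    fix \<tau> :: real
    show "ennreal (\<Sum>k<K. ?c k * indicator {real k * e..<real (Suc k) * e} \<tau>) \<le> ennreal (capacity (level x \<tau>)) * indicator {0..} \<tau>"
    proof (cases "0 \<le> \<tau>")
      case False
      have "indicat_real {real k * e..<real (Suc k) * e} \<tau> = 0" for k
      proof -
        have "0 \<le> real k * e" using e by simp
        then show ?thesis using False by (simp add: indicator_def)
      qed
      then have "(\<Sum>k<K. ?c k * indicator {real k * e..<real (Suc k) * e} \<tau>) = 0"
        by (simp only: mult_zero_right sum.neutral_const)
      then show ?thesis by simp
    next
      case True
      have "{s \<in> space M. nat \<lfloor>\<tau> / e\<rfloor> < X s} \<subseteq> level x \<tau>"
      proof
        fix s assume "s \<in> {s \<in> space M. nat \<lfloor>\<tau> / e\<rfloor> < X s}"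
        then have s: "s \<in> space M" "real (Suc (nat \<lfloor>\<tau> / e\<rfloor>)) * e \<le> x s" using Xiff by blast+
        then show "s \<in> level x \<tau>" using j(2)[OF True] unfolding level_def by (intro CollectI conjI) linarith+
      qed
      then have "capacity {s \<in> space M. nat \<lfloor>\<tau> / e\<rfloor> < X s} \<le> capacity (level x \<tau>)"
        by (intro capacity_mono sets_level x)
      then have "(if nat \<lfloor>\<tau> / e\<rfloor> < K then ?c (nat \<lfloor>\<tau> / e\<rfloor>) else 0) \<le> capacity (level x \<tau>)"
        using capacity_nonneg[of "level x \<tau>"] by (simp split: if_split)
      then show ?thesis
        unfolding step_value[OF e True] using True by (simp only: atLeast_iff indicator_simps mult_1_right ennreal_leI)
    qed
  qed
  finally show "ennreal (e * nat_choquet K X) \<le> choquet M \<phi> x" .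
  let ?d = "\<lambda>k. case k of 0 \<Rightarrow> capacity (space M) | Suc k \<Rightarrow> ?c k"
  have "choquet M \<phi> x \<le> (\<integral>\<^sup>+\<tau>. ennreal (\<Sum>k<Suc K. ?d k * indicator {real k * e..<real (Suc k) * e} \<tau>) \<partial>lborel)"
    unfolding choquet_level
  proof (rule nn_integral_mono)
    fix \<tau> :: real
    show "ennreal (capacity (level x \<tau>)) * indicator {0..} \<tau> \<le> ennreal (\<Sum>k<Suc K. ?d k * indicator {real k * e..<real (Suc k) * e} \<tau>)"
    proof (cases "0 \<le> \<tau>")
      case True
      have "capacity (level x \<tau>) \<le> (if nat \<lfloor>\<tau> / e\<rfloor> < Suc K then ?d (nat \<lfloor>\<tau> / e\<rfloor>) else 0)"
      proof (cases "nat \<lfloor>\<tau> / e\<rfloor> < Suc K")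
        case True
        show ?thesis
        proof (cases "nat \<lfloor>\<tau> / e\<rfloor>")
          case 0
          have "capacity (level x \<tau>) \<le> capacity (space M)" by (rule capacity_le_space)
          then show ?thesis using True unfolding 0 by (simp only: if_True nat.case)
        next
          case (Suc k)
          have "level x \<tau> \<subseteq> {s \<in> space M. k < X s}"
          proof
            fix s assume "s \<in> level x \<tau>"
            then have s: "s \<in> space M" "\<tau> < x s" by (auto simp: level_def)
            then have "real (Suc k) * e \<le> x s" using j(1)[OF \<open>0 \<le> \<tau>\<close>] unfolding Suc by linarith
            then show "s \<in> {s \<in> space M. k < X s}" using s(1) Xiff by blast
          qed
          then have "capacity (level x \<tau>) \<le> ?c k" by (intro capacity_mono) auto
          then show ?thesis using True Suc by simp
        qed
      next
        case False
        then have "real K * e \<le> real (nat \<lfloor>\<tau> / e\<rfloor>) * e" using e by (intro mult_right_mono) auto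
        then have "real K * e \<le> \<tau>" using j(1)[OF \<open>0 \<le> \<tau>\<close>] by linarith
        then have "level x \<tau> = {}" using K by (force simp: level_def)
        then show ?thesis using False by simp
      qed
      then show ?thesis unfolding step_value[OF e True]
        using True by (simp only: atLeast_iff indicator_simps mult_1_right ennreal_leI)
    qed simp
  qed
  also have "\<dots> = ennreal (e * (\<Sum>k<Suc K. ?d k))"
    by (intro nn_integral_step e) (auto simp: capacity_nonneg split: nat.split)
  also have "(\<Sum>k<Suc K. ?d k) = capacity (space M) + nat_choquet K X"
    unfolding sum.lessThan_Suc_shift nat_choquet_def by simp
  finally show "choquet M \<phi> x \<le> ennreal (e * (capacity (space M) + nat_choquet K X))" .
qed

text \<open>Rounding to multiples of e reduces this to \<open>nat_choquet_add\<close>. The integer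
  part of a sum exceeds the sum of the integer parts by at most 1, and one more indicator of the
  whole space pays for that. The common bound \<open>C\<close> keeps the number of levels
  finite.\<close>

lemma choquet_add:
  assumes [measurable]: "x \<in> borel_measurable M" "y \<in> borel_measurable M"
    and x: "\<And>s. s \<in> space M \<Longrightarrow> 0 \<le> x s" "\<And>s. s \<in> space M \<Longrightarrow> x s \<le> C"
    and y: "\<And>s. s \<in> space M \<Longrightarrow> 0 \<le> y s" "\<And>s. s \<in> space M \<Longrightarrow> y s \<le> C"
  shows "choquet M \<phi> (\<lambda>s. x s + y s) \<le> choquet M \<phi> x + choquet M \<phi> y"
proof (rule ennreal_le_epsilon)
  fix r :: real assume r: "0 < r"
  \<comment> \<open>An error of e times the total capacity occurs twice, from the upper
    discretization bound and from the integer parts; the 1 in the denominator covers total capacity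
    0.\<close>
  define e where "e = r / (2 * capacity (space M) + 1)"
  have e: "0 < e" "e * (2 * capacity (space M)) \<le> r"
  proof -
    define c where "c = capacity (space M)"
    have c: "0 \<le> c" by (simp add: c_def capacity_nonneg)
    show "0 < e" unfolding e_def c_def[symmetric] using r c by simp
    have "r * (2 * c / (2 * c + 1)) \<le> r * 1" using r c by (intro mult_left_mono) simp_all
    then show "e * (2 * capacity (space M)) \<le> r" unfolding e_def c_def[symmetric] by simp
  qed
  obtain K :: nat where "C / e \<le> real K" using real_arch_simple by blast
  then have K: "C \<le> real K * e" using e by (simp add: field_simps)
  define X Y Z where "X = (\<lambda>s. nat \<lfloor>x s / e\<rfloor>)" "Y = (\<lambda>s. nat \<lfloor>y s / e\<rfloor>)" "Z = (\<lambda>s. nat \<lfloor>(x s + y s) / e\<rfloor>)"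
  have [measurable]: "X \<in> measurable M (count_space UNIV)" "Y \<in> measurable M (count_space UNIV)" "Z \<in> measurable M (count_space UNIV)"
    unfolding X_Y_Z_def by measurable
  have XK: "X s \<le> K" if "s \<in> space M" for s
  proof -
    have "x s / e \<le> real K" using x(2)[OF that] K e by (simp add: field_simps)
    then show ?thesis unfolding X_Y_Z_def by linarith
  qed
  have YK: "Y s \<le> K" if "s \<in> space M" for s
  proof -
    have "y s / e \<le> real K" using y(2)[OF that] K e by (simp add: field_simps)
    then show ?thesis unfolding X_Y_Z_def by linarith
  qed
  have ZXY: "Z s \<le> X s + Y s + 1" if "s \<in> space M" for s
  proof -
    have "0 \<le> x s / e" "0 \<le> y s / e" using x(1)[OF that] y(1)[OF that] e by auto
    then show ?thesis unfolding X_Y_Z_def add_divide_distrib by linarith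
  qed
  have "choquet M \<phi> (\<lambda>s. x s + y s) \<le> ennreal (e * (capacity (space M) + nat_choquet (K + K) Z))"
    unfolding X_Y_Z_def(3)
  proof (rule choquet_discretize(2))
    fix s assume s: "s \<in> space M"
    have "real (K + K) * e = real K * e + real K * e" by (simp add: distrib_right)
    then show "x s + y s \<le> real (K + K) * e" using x(2)[OF s] y(2)[OF s] K by linarith
  qed (use x y e in auto)
  also have "\<dots> \<le> ennreal (e * nat_choquet K X + e * nat_choquet K Y + r)"
  proof (rule ennreal_leI)
    have "nat_choquet (K + K) Z \<le> nat_choquet (Suc (K + K)) (\<lambda>s. (X s + Y s) + (if s \<in> space M then 1 else 0))"
      unfolding nat_choquet_def sum.lessThan_Suc
    proof (intro add_increasing2 capacity_nonneg sum_mono capacity_mono)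
      show "{s \<in> space M. k < Z s} \<subseteq> {s \<in> space M. k < X s + Y s + (if s \<in> space M then 1 else 0)}" for k
        using ZXY by (auto intro: less_le_trans)
      have "(\<lambda>s. X s + Y s + (if s \<in> space M then 1 else 0)) \<in> measurable M (count_space UNIV)" by measurable
      from measurable_sets[OF this, of "{k<..}" for k]
      show "{s \<in> space M. k < X s + Y s + (if s \<in> space M then 1 else 0)} \<in> sets M" for k
        by (simp add: vimage_def Int_def conj_commute)
    qed
    also have "\<dots> \<le> nat_choquet (K + K) (\<lambda>s. X s + Y s) + capacity (space M)"
      using XK YK by (intro nat_choquet_add_indicator) (auto intro: add_mono)
    also have "nat_choquet (K + K) (\<lambda>s. X s + Y s) \<le> nat_choquet K X + nat_choquet K Y"
      using XK YK by (intro nat_choquet_add) auto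
    finally have "e * nat_choquet (K + K) Z \<le> e * (nat_choquet K X + nat_choquet K Y + capacity (space M))"
      using e by (intro mult_left_mono) auto
    then show "e * (capacity (space M) + nat_choquet (K + K) Z) \<le> e * nat_choquet K X + e * nat_choquet K Y + r"
      using e(2) by (simp add: algebra_simps)
  qed
  also have "\<dots> = ennreal (e * nat_choquet K X) + ennreal (e * nat_choquet K Y) + ennreal r"
    using e r by (simp add: nat_choquet_def sum_nonneg capacity_nonneg)
  also have "\<dots> \<le> choquet M \<phi> x + choquet M \<phi> y + ennreal r"
    unfolding X_Y_Z_def
    by (intro add_mono order_refl choquet_discretize(1) x(1) y(1) e(1) order_trans[OF x(2) K] order_trans[OF y(2) K]) auto
  finally show "choquet M \<phi> (\<lambda>s. x s + y s) \<le> choquet M \<phi> x + choquet M \<phi> y + ennreal r" .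
qed

text \<open>Quantitative strict monotonicity: at every height in [\<tau>0, \<tau>0 + e) the level
  set of \<open>a\<close> exceeds that of \<open>b\<close> by at least the set in \<open>m\<close>,
  so the integrand gains \<delta> over an interval of length e.\<close>

lemma choquet_gap_mono:
  assumes [measurable]: "a \<in> borel_measurable M" "b \<in> borel_measurable M"
    and ab: "\<And>s. s \<in> space M \<Longrightarrow> b s \<le> a s" and \<tau>0: "0 \<le> \<tau>0" and e: "0 \<le> e" and \<eta>: "0 \<le> \<eta>"
    and m: "\<eta> \<le> measure M {s \<in> space M. \<tau>0 + e < a s \<and> b s \<le> \<tau>0}"
    and \<delta>: "0 \<le> \<delta>" "\<And>c. 0 \<le> c \<Longrightarrow> c + \<eta> \<le> measure M (space M) \<Longrightarrow> \<phi> c + \<delta> \<le> \<phi> (c + \<eta>)"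
  shows "choquet M \<phi> b + ennreal (e * \<delta>) \<le> choquet M \<phi> a"
proof -
  have "ennreal (e * \<delta>) = (\<integral>\<^sup>+\<tau>. ennreal \<delta> * indicator {\<tau>0..<\<tau>0 + e} \<tau> \<partial>lborel)"
    using e \<delta>(1) by (subst nn_integral_cmult_indicator) (auto simp: ennreal_mult[symmetric] mult.commute)
  then have "choquet M \<phi> b + ennreal (e * \<delta>) =
      (\<integral>\<^sup>+\<tau>. ennreal (capacity (level b \<tau>)) * indicator {0..} \<tau> + ennreal \<delta> * indicator {\<tau>0..<\<tau>0 + e} \<tau> \<partial>lborel)"
    unfolding choquet_level by (subst nn_integral_add) auto
  also have "\<dots> \<le> choquet M \<phi> a"
    unfolding choquet_level
  proof (rule nn_integral_mono)
    fix \<tau> :: real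
    have le: "capacity (level b \<tau>) \<le> capacity (level a \<tau>)"
      using ab by (intro capacity_mono) (auto simp: level_def intro: less_le_trans)
    have "capacity (level b \<tau>) + \<delta> \<le> capacity (level a \<tau>)" if \<tau>: "\<tau> \<in> {\<tau>0..<\<tau>0 + e}"
    proof -
      let ?D = "{s \<in> space M. \<tau>0 + e < a s \<and> b s \<le> \<tau>0}"
      have "measure M (level b \<tau>) + \<eta> \<le> measure M (level b \<tau>) + measure M ?D" using m by simp
      also have "\<dots> = measure M (level b \<tau> \<union> ?D)"
        using \<tau> by (intro finite_measure_Union[symmetric]) (auto simp: level_def)
      also have "\<dots> \<le> measure M (level a \<tau>)"
        using \<tau> ab by (intro finite_measure_mono) (auto simp: level_def intro: less_le_trans)
      finally have *: "measure M (level b \<tau>) + \<eta> \<le> measure M (level a \<tau>)" .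
      have "capacity (level b \<tau>) + \<delta> \<le> \<phi> (measure M (level b \<tau>) + \<eta>)"
        using * bounded_measure[of "level a \<tau>"] by (intro \<delta>) auto
      also have "\<dots> \<le> capacity (level a \<tau>)" using * \<eta> by (intro distortion_mono bounded_measure) auto
      finally show ?thesis .
    qed
    then show "ennreal (capacity (level b \<tau>)) * indicator {0..} \<tau> + ennreal \<delta> * indicator {\<tau>0..<\<tau>0 + e} \<tau>
        \<le> ennreal (capacity (level a \<tau>)) * indicator {0..} \<tau>"
      using le \<tau>0 capacity_nonneg[of "level b \<tau>"] \<delta>(1)
      by (auto simp: ennreal_plus[symmetric] ennreal_leI simp del: ennreal_plus split: split_indicator)
  qed
  finally show ?thesis .
qed

text \<open>Level sets of maximum and minimum are unions and intersections of level sets, so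
  \<open>capacity_submodular\<close> is integrated over the heights; its strict form contributes
  \<delta> at each height below e.\<close>

lemma choquet_max_min:
  assumes [measurable]: "x \<in> borel_measurable M" "y \<in> borel_measurable M"
    and e: "0 \<le> e" and \<eta>: "0 \<le> \<eta>"
    and m: "\<And>\<tau>. 0 \<le> \<tau> \<Longrightarrow> \<tau> < e \<Longrightarrow> \<eta> \<le> measure M (level x \<tau> - level y \<tau>)"
      "\<And>\<tau>. 0 \<le> \<tau> \<Longrightarrow> \<tau> < e \<Longrightarrow> \<eta> \<le> measure M (level y \<tau> - level x \<tau>)"
    and \<delta>: "0 \<le> \<delta>" "\<And>c. 0 \<le> c \<Longrightarrow> c + 2 * \<eta> \<le> measure M (space M) \<Longrightarrow> \<phi> (c + 2 * \<eta>) + \<phi> c + \<delta> \<le> 2 * \<phi> (c + \<eta>)"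
  shows "choquet M \<phi> (\<lambda>s. max (x s) (y s)) + choquet M \<phi> (\<lambda>s. min (x s) (y s)) + ennreal (e * \<delta>)
    \<le> choquet M \<phi> x + choquet M \<phi> y"
proof -
  have lev: "level (\<lambda>s. max (x s) (y s)) \<tau> = level x \<tau> \<union> level y \<tau>" "level (\<lambda>s. min (x s) (y s)) \<tau> = level x \<tau> \<inter> level y \<tau>" for \<tau>
    by (auto simp: level_def)
  have [measurable]: "(\<lambda>\<tau>. capacity (level x \<tau> \<union> level y \<tau>)) \<in> borel_measurable borel"
    "(\<lambda>\<tau>. capacity (level x \<tau> \<inter> level y \<tau>)) \<in> borel_measurable borel"
    unfolding lev[symmetric] by measurable
  have "ennreal (e * \<delta>) = (\<integral>\<^sup>+\<tau>. ennreal \<delta> * indicator {0..<e} \<tau> \<partial>lborel)"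
    using e \<delta>(1) by (subst nn_integral_cmult_indicator) (auto simp: ennreal_mult[symmetric] mult.commute)
  then have "choquet M \<phi> (\<lambda>s. max (x s) (y s)) + choquet M \<phi> (\<lambda>s. min (x s) (y s)) + ennreal (e * \<delta>) =
      (\<integral>\<^sup>+\<tau>. ennreal (capacity (level x \<tau> \<union> level y \<tau>)) * indicator {0..} \<tau> + ennreal (capacity (level x \<tau> \<inter> level y \<tau>)) * indicator {0..} \<tau>
         + ennreal \<delta> * indicator {0..<e} \<tau> \<partial>lborel)"
    unfolding choquet_level lev by (subst nn_integral_add; (subst nn_integral_add)?) auto
  also have "\<dots> \<le> (\<integral>\<^sup>+\<tau>. ennreal (capacity (level x \<tau>)) * indicator {0..} \<tau> + ennreal (capacity (level y \<tau>)) * indicator {0..} \<tau> \<partial>lborel)"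
  proof (rule nn_integral_mono)
    fix \<tau> :: real
    have 1: "capacity (level x \<tau> \<union> level y \<tau>) + capacity (level x \<tau> \<inter> level y \<tau>) \<le> capacity (level x \<tau>) + capacity (level y \<tau>)"
      using capacity_submodular[of "level x \<tau>" "level y \<tau>" 0 0] by simp
    have 2: "capacity (level x \<tau> \<union> level y \<tau>) + capacity (level x \<tau> \<inter> level y \<tau>) + \<delta> \<le> capacity (level x \<tau>) + capacity (level y \<tau>)"
      if "0 \<le> \<tau>" "\<tau> < e"
      using m that \<eta> \<delta>(2) by (intro capacity_submodular[of _ _ \<eta>]) auto
    show "ennreal (capacity (level x \<tau> \<union> level y \<tau>)) * indicator {0..} \<tau> + ennreal (capacity (level x \<tau> \<inter> level y \<tau>)) * indicator {0..} \<tau>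
         + ennreal \<delta> * indicator {0..<e} \<tau> \<le> ennreal (capacity (level x \<tau>)) * indicator {0..} \<tau> + ennreal (capacity (level y \<tau>)) * indicator {0..} \<tau>"
      using 1 2 \<delta>(1) capacity_nonneg
      by (auto simp: ennreal_plus[symmetric] ennreal_leI simp del: ennreal_plus split: split_indicator)
  qed
  also have "\<dots> = choquet M \<phi> x + choquet M \<phi> y"
    unfolding choquet_level by (subst nn_integral_add) auto
  finally show ?thesis .
qed

text \<open>\<open>x2\<close> is the part of \<open>x\<close> between the heights \<alpha> and
  \<alpha> + e. Its level sets and those of the rest are level sets of \<open>x\<close> at shifted
  heights, so the integral over \<tau> is only cut and reassembled. This is an instance of
  additivity on comonotone functions.\<close>

lemma choquet_slice:
  assumes [measurable]: "x \<in> borel_measurable M" and \<alpha>: "0 \<le> \<alpha>" and e: "0 \<le> e"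
  defines "x2 \<equiv> \<lambda>s. min (max (x s - \<alpha>) 0) e"
  shows "choquet M \<phi> x = choquet M \<phi> (\<lambda>s. x s - x2 s) + choquet M \<phi> x2"
proof -
  let ?F = "\<lambda>\<tau>. ennreal (capacity (level x \<tau>))"
  have l2: "level x2 \<tau> = (if \<tau> < e then level x (\<alpha> + \<tau>) else {})" if "0 \<le> \<tau>" for \<tau>
    using that by (auto simp: level_def x2_def)
  have l1: "level (\<lambda>s. x s - x2 s) \<tau> = (if \<tau> < \<alpha> then level x \<tau> else level x (e + \<tau>))" if "0 \<le> \<tau>" for \<tau>
    using that e by (auto simp: level_def x2_def min_def max_def)
  have F [measurable]: "?F \<in> borel_measurable borel" by measurable
  have shift: "(\<integral>\<^sup>+\<tau>. ?F (t + \<tau>) * indicator A (t + \<tau>) \<partial>lborel) = (\<integral>\<^sup>+\<tau>. ?F \<tau> * indicator A \<tau> \<partial>lborel)"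
    if [measurable]: "A \<in> sets borel" for t :: real and A
  proof -
    have "(\<lambda>\<tau>. ?F \<tau> * indicator A \<tau>) \<in> borel_measurable borel" by measurable
    from nn_integral_real_affine[OF this, of 1 t] show ?thesis by simp
  qed
  have F' [measurable]: "(\<lambda>\<tau>. ?F (t + \<tau>)) \<in> borel_measurable borel" for t
    by (rule measurable_compose[of "\<lambda>\<tau>. t + \<tau>" borel borel ?F, OF _ F]) measurable
  have "choquet M \<phi> x2 = (\<integral>\<^sup>+\<tau>. ?F (\<alpha> + \<tau>) * indicator {\<alpha>..<\<alpha> + e} (\<alpha> + \<tau>) \<partial>lborel)"
    unfolding choquet_level by (intro nn_integral_cong) (auto simp: l2 split: split_indicator)
  also have "\<dots> = (\<integral>\<^sup>+\<tau>. ?F \<tau> * indicator {\<alpha>..<\<alpha> + e} \<tau> \<partial>lborel)"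
    by (rule shift) auto
  finally have 2: "choquet M \<phi> x2 = (\<integral>\<^sup>+\<tau>. ?F \<tau> * indicator {\<alpha>..<\<alpha> + e} \<tau> \<partial>lborel)" .
  have "choquet M \<phi> (\<lambda>s. x s - x2 s) = (\<integral>\<^sup>+\<tau>. ?F \<tau> * indicator {0..<\<alpha>} \<tau> + ?F (e + \<tau>) * indicator {e + \<alpha>..} (e + \<tau>) \<partial>lborel)"
    unfolding choquet_level using \<alpha> by (intro nn_integral_cong) (auto simp: l1 split: split_indicator)
  also have "\<dots> = (\<integral>\<^sup>+\<tau>. ?F \<tau> * indicator {0..<\<alpha>} \<tau> \<partial>lborel) + (\<integral>\<^sup>+\<tau>. ?F (e + \<tau>) * indicator {e + \<alpha>..} (e + \<tau>) \<partial>lborel)"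
  proof (rule nn_integral_add)
    have "(\<lambda>\<tau>. indicator {\<alpha>..} \<tau> :: ennreal) = (\<lambda>\<tau>. indicator {e + \<alpha>..} (e + \<tau>))" by (auto simp: indicator_def)
    moreover have "(\<lambda>\<tau>. indicator {\<alpha>..} \<tau> :: ennreal) \<in> borel_measurable lborel" by measurable
    ultimately show "(\<lambda>\<tau>. ?F (e + \<tau>) * indicator {e + \<alpha>..} (e + \<tau>)) \<in> borel_measurable lborel" by measurable
  qed measurable
  also have "(\<integral>\<^sup>+\<tau>. ?F (e + \<tau>) * indicator {e + \<alpha>..} (e + \<tau>) \<partial>lborel) = (\<integral>\<^sup>+\<tau>. ?F \<tau> * indicator {e + \<alpha>..} \<tau> \<partial>lborel)"
    by (rule shift) auto
  finally have 1: "choquet M \<phi> (\<lambda>s. x s - x2 s) = (\<integral>\<^sup>+\<tau>. ?F \<tau> * indicator {0..<\<alpha>} \<tau> \<partial>lborel) + (\<integral>\<^sup>+\<tau>. ?F \<tau> * indicator {e + \<alpha>..} \<tau> \<partial>lborel)" .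
  have "choquet M \<phi> x = (\<integral>\<^sup>+\<tau>. (?F \<tau> * indicator {0..<\<alpha>} \<tau> + ?F \<tau> * indicator {e + \<alpha>..} \<tau>) + ?F \<tau> * indicator {\<alpha>..<\<alpha> + e} \<tau> \<partial>lborel)"
    unfolding choquet_level using \<alpha> e by (intro nn_integral_cong) (auto split: split_indicator)
  also have "\<dots> = (\<integral>\<^sup>+\<tau>. ?F \<tau> * indicator {0..<\<alpha>} \<tau> + ?F \<tau> * indicator {e + \<alpha>..} \<tau> \<partial>lborel) + (\<integral>\<^sup>+\<tau>. ?F \<tau> * indicator {\<alpha>..<\<alpha> + e} \<tau> \<partial>lborel)"
    by (rule nn_integral_add) measurable
  also have "(\<integral>\<^sup>+\<tau>. ?F \<tau> * indicator {0..<\<alpha>} \<tau> + ?F \<tau> * indicator {e + \<alpha>..} \<tau> \<partial>lborel) =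
     (\<integral>\<^sup>+\<tau>. ?F \<tau> * indicator {0..<\<alpha>} \<tau> \<partial>lborel) + (\<integral>\<^sup>+\<tau>. ?F \<tau> * indicator {e + \<alpha>..} \<tau> \<partial>lborel)"
    by (rule nn_integral_add) measurable
  finally show ?thesis unfolding 1 2 .
qed

text \<open>Where \<open>x\<close> and \<open>y\<close> are ordered oppositely around the heights \<open>\<alpha>\<close> and \<open>\<sigma>\<close>, cut out slices of thickness \<open>e\<close>
  there and rearrange their sum as maximum plus minimum: strict submodularity gains a definite amount.\<close>

lemma choquet_gap_add:
  assumes [measurable]: "x \<in> borel_measurable M" "y \<in> borel_measurable M"
    and x: "\<And>s. s \<in> space M \<Longrightarrow> 0 \<le> x s" "\<And>s. s \<in> space M \<Longrightarrow> x s \<le> C"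
    and y: "\<And>s. s \<in> space M \<Longrightarrow> 0 \<le> y s" "\<And>s. s \<in> space M \<Longrightarrow> y s \<le> C"
    and \<alpha>: "0 \<le> \<alpha>" "0 \<le> \<sigma>" and e: "0 \<le> e" and \<eta>: "0 \<le> \<eta>"
    and m: "\<eta> \<le> measure M {s \<in> space M. \<alpha> + e < x s \<and> y s \<le> \<sigma>}"
      "\<eta> \<le> measure M {s \<in> space M. x s \<le> \<alpha> \<and> \<sigma> + e < y s}"
    and \<delta>: "0 \<le> \<delta>" "\<And>c. 0 \<le> c \<Longrightarrow> c + 2 * \<eta> \<le> measure M (space M) \<Longrightarrow> \<phi> (c + 2 * \<eta>) + \<phi> c + \<delta> \<le> 2 * \<phi> (c + \<eta>)"
  shows "choquet M \<phi> (\<lambda>s. x s + y s) + ennreal (e * \<delta>) \<le> choquet M \<phi> x + choquet M \<phi> y"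
proof -
  define x2 y2 where "x2 = (\<lambda>s. min (max (x s - \<alpha>) 0) e)" "y2 = (\<lambda>s. min (max (y s - \<sigma>) 0) e)"
  have [measurable]: "x2 \<in> borel_measurable M" "y2 \<in> borel_measurable M" unfolding x2_y2_def by measurable
  define x1 y1 where "x1 = (\<lambda>s. x s - x2 s)" "y1 = (\<lambda>s. y s - y2 s)"
  have [measurable]: "x1 \<in> borel_measurable M" "y1 \<in> borel_measurable M" unfolding x1_y1_def by measurable
  let ?N = "choquet M \<phi>"
  have slice: "?N x = ?N x1 + ?N x2" "?N y = ?N y1 + ?N y2"
    unfolding x1_y1_def x2_y2_def by (rule choquet_slice; use \<alpha> e in simp)+
  have b2: "0 \<le> x2 s" "x2 s \<le> e" "0 \<le> y2 s" "y2 s \<le> e" for s using e by (auto simp: x2_y2_def)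
  have b1: "0 \<le> x1 s" "x1 s \<le> C" "0 \<le> y1 s" "y1 s \<le> C" if "s \<in> space M" for s
    using x[OF that] y[OF that] \<alpha> e by (auto simp: x1_y1_def x2_y2_def min_def max_def)
  have "?N (\<lambda>s. x s + y s) = ?N (\<lambda>s. (x1 s + y1 s) + (x2 s + y2 s))"
    by (rule choquet_cong) (simp add: x1_y1_def)
  also have "\<dots> \<le> ?N (\<lambda>s. x1 s + y1 s) + ?N (\<lambda>s. x2 s + y2 s)"
  proof (rule choquet_add[where C = "2 * C + 2 * e"])
    fix s assume s: "s \<in> space M"
    have "0 \<le> C" using x[OF s] by linarith
    then show "x1 s + y1 s \<le> 2 * C + 2 * e" "x2 s + y2 s \<le> 2 * C + 2 * e" "0 \<le> x1 s + y1 s" "0 \<le> x2 s + y2 s"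
      using b1[OF s] b2[of s] e by linarith+
  qed auto
  also have "?N (\<lambda>s. x1 s + y1 s) \<le> ?N x1 + ?N y1" using b1 by (intro choquet_add[where C = C]) auto
  also have "?N (\<lambda>s. x2 s + y2 s) = ?N (\<lambda>s. max (x2 s) (y2 s) + min (x2 s) (y2 s))"
    by (rule choquet_cong) simp
  also have "\<dots> \<le> ?N (\<lambda>s. max (x2 s) (y2 s)) + ?N (\<lambda>s. min (x2 s) (y2 s))"
    using b2 by (intro choquet_add[where C = e]) (auto simp: le_max_iff_disj min_le_iff_disj)
  finally have "?N (\<lambda>s. x s + y s) + ennreal (e * \<delta>) \<le>
     (?N x1 + ?N y1) + (?N (\<lambda>s. max (x2 s) (y2 s)) + ?N (\<lambda>s. min (x2 s) (y2 s)) + ennreal (e * \<delta>))"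
    by (simp add: add.assoc add_right_mono add_left_mono)
  also have "\<dots> \<le> (?N x1 + ?N y1) + (?N x2 + ?N y2)"
  proof (intro add_left_mono choquet_max_min e \<eta> \<delta>)
    fix \<tau> assume \<tau>: "0 \<le> \<tau>" "\<tau> < e"
    \<comment> \<open>On this set \<open>x2\<close> equals e and \<open>y2\<close> equals 0, so it
      separates the two slices at every height below e; the other set does so with the roles
      exchanged.\<close>
    have "{s \<in> space M. \<alpha> + e < x s \<and> y s \<le> \<sigma>} \<subseteq> level x2 \<tau> - level y2 \<tau>"
      using \<tau> by (auto simp: level_def x2_y2_def)
    from finite_measure_mono[OF this] show "\<eta> \<le> measure M (level x2 \<tau> - level y2 \<tau>)"
      using m(1) by fastforce
    have "{s \<in> space M. x s \<le> \<alpha> \<and> \<sigma> + e < y s} \<subseteq> level y2 \<tau> - level x2 \<tau>"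
      using \<tau> by (auto simp: level_def x2_y2_def)
    from finite_measure_mono[OF this] show "\<eta> \<le> measure M (level y2 \<tau> - level x2 \<tau>)"
      using m(2) by fastforce
  qed (auto intro: \<eta> \<delta>(2))
  also have "\<dots> = ?N x + ?N y" unfolding slice by (simp add: ac_simps)
  finally show ?thesis .
qed

end

section \<open>The Lorentz norm as a Choquet integral\<close>

locale lorentz_weight =
  fixes \<phi> :: "real \<Rightarrow> real"
  assumes weight_continuous: "continuous_on {0..2*pi} \<phi>"
    and weight_strict_mono: "strict_mono_on {0..2*pi} \<phi>"
    and weight_strictly_concave: "strictly_concave_on {0..2*pi} \<phi>"
    and weight_0 [simp]: "\<phi> 0 = 0" and weight_2pi [simp]: "\<phi> (2*pi) = 1"
begin

lemma weight_mono: "0 \<le> s \<Longrightarrow> s \<le> t \<Longrightarrow> t \<le> 2*pi \<Longrightarrow> \<phi> s \<le> \<phi> t"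
  using strict_mono_onD[OF weight_strict_mono, of s t] by (cases "s = t") auto

lemma weight_concaveD:
  assumes "0 < k" "k < 1" "p \<in> {0..2*pi}" "q \<in> {0..2*pi}" "p \<noteq> q"
  shows "(1 - k) * \<phi> p + k * \<phi> q < \<phi> ((1 - k) * p + k * q)"
proof -
  have "k \<in> {0<..<1}" using assms by simp
  then show ?thesis using weight_strictly_concave assms(3-5) unfolding strictly_concave_on_def by blast
qed

text \<open>The inner points a and b + d are convex combinations of the outer points b and a + d
  with exchanged weights; the two concavity inequalities are added.\<close>

lemma weight_increment_less:
  assumes "0 \<le> b" "b < a" "0 < d" "a + d \<le> 2*pi"
  shows "\<phi> (a + d) - \<phi> a < \<phi> (b + d) - \<phi> b"
proof -
  define l where "l = (a - b) / (a + d - b)"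
  have l: "0 < l" "l < 1" using assms by (auto simp: l_def divide_less_eq)
  have la: "l * (a + d - b) = a - b" using assms by (simp add: l_def)
  have eq: "(1 - l) * b + l * (a + d) = a" "(1 - (1 - l)) * b + (1 - l) * (a + d) = b + d"
    using la by (auto simp: algebra_simps)
  have "(1 - l) * \<phi> b + l * \<phi> (a + d) < \<phi> a" "(1 - (1 - l)) * \<phi> b + (1 - l) * \<phi> (a + d) < \<phi> (b + d)"
    using weight_concaveD[of l b "a + d"] weight_concaveD[of "1 - l" b "a + d"] l assms unfolding eq by auto
  then show ?thesis by (simp add: algebra_simps)
qed

text \<open>The graph lies above its chord over [0, 2 pi]. This lets the Lorentz norm dominate the
  L^1 norm and so brings in the results on H^1.\<close>

lemma weight_ge_linear:
  assumes "0 \<le> d" "d \<le> 2*pi"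
  shows "d \<le> 2*pi * \<phi> d"
proof (cases "d = 0 \<or> d = 2*pi")
  case False
  then have "0 < d / (2*pi)" "d / (2*pi) < 1" using assms by auto
  from weight_concaveD[OF this, of 0 "2*pi"] have "d / (2*pi) < \<phi> d" by simp
  then show ?thesis by (simp add: field_simps)
qed auto

sublocale concave_distortion circle_measure \<phi>
proof -
  interpret finite_measure circle_measure by (rule finite_measure_circle)
  show "concave_distortion circle_measure \<phi>"
  proof
    fix a b d :: real
    assume *: "0 \<le> b" "b \<le> a" "0 \<le> d" "a + d \<le> measure circle_measure (space circle_measure)"
    show "\<phi> (a + d) - \<phi> a \<le> \<phi> (b + d) - \<phi> b"
    proof (cases "b = a \<or> d = 0")
      case False
      then show ?thesis using weight_increment_less[of b a d] * by simp
    qed auto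
  qed (use weight_mono in auto)
qed

text \<open>Compactness makes the increase uniform in c. For \<eta> > 2 pi there is no admissible c,
  and \<delta> = 1 is taken.\<close>

lemma weight_increment_bound:
  assumes "0 < \<eta>"
  obtains \<delta> where "0 < \<delta>" "\<And>c. 0 \<le> c \<Longrightarrow> c + \<eta> \<le> 2*pi \<Longrightarrow> \<phi> c + \<delta> \<le> \<phi> (c + \<eta>)"
proof (cases "{0..2*pi - \<eta>} = {}")
  case True then show thesis using that[of 1] by auto
next
  case False
  have "continuous_on {0..2*pi - \<eta>} (\<lambda>c. \<phi> (c + \<eta>) - \<phi> c)"
    using assms by (intro continuous_intros continuous_on_compose2[OF weight_continuous]) auto
  from continuous_attains_inf[OF compact_Icc False this]
  obtain c0 where c0: "c0 \<in> {0..2*pi - \<eta>}" "\<And>c. c \<in> {0..2*pi - \<eta>} \<Longrightarrow> \<phi> (c0 + \<eta>) - \<phi> c0 \<le> \<phi> (c + \<eta>) - \<phi> c" by blast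
  show thesis
  proof (rule that)
    show "0 < \<phi> (c0 + \<eta>) - \<phi> c0"
      using strict_mono_onD[OF weight_strict_mono, of c0 "c0 + \<eta>"] c0(1) assms by auto
    show "\<phi> c + (\<phi> (c0 + \<eta>) - \<phi> c0) \<le> \<phi> (c + \<eta>)" if "0 \<le> c" "c + \<eta> \<le> 2*pi" for c
      using c0(2)[of c] that by auto
  qed
qed

text \<open>The same compactness argument for strict concavity: the second difference is continuous
  and negative, hence bounded away from 0.\<close>

lemma weight_second_difference_bound:
  assumes "0 < \<eta>"
  obtains \<delta> where "0 < \<delta>" "\<And>c. 0 \<le> c \<Longrightarrow> c + 2 * \<eta> \<le> 2*pi \<Longrightarrow> \<phi> (c + 2 * \<eta>) + \<phi> c + \<delta> \<le> 2 * \<phi> (c + \<eta>)"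
proof (cases "{0..2*pi - 2 * \<eta>} = {}")
  case True then show thesis using that[of 1] by auto
next
  case False
  have "continuous_on {0..2*pi - 2 * \<eta>} (\<lambda>c. 2 * \<phi> (c + \<eta>) - \<phi> (c + 2 * \<eta>) - \<phi> c)"
    using assms by (intro continuous_intros continuous_on_compose2[OF weight_continuous]) auto
  from continuous_attains_inf[OF compact_Icc False this]
  obtain c0 where c0: "c0 \<in> {0..2*pi - 2 * \<eta>}" "\<And>c. c \<in> {0..2*pi - 2 * \<eta>} \<Longrightarrow>
     2 * \<phi> (c0 + \<eta>) - \<phi> (c0 + 2 * \<eta>) - \<phi> c0 \<le> 2 * \<phi> (c + \<eta>) - \<phi> (c + 2 * \<eta>) - \<phi> c" by blast
  show thesis
  proof (rule that)
    have "\<phi> ((c0 + \<eta>) + \<eta>) - \<phi> (c0 + \<eta>) < \<phi> (c0 + \<eta>) - \<phi> c0"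
      using weight_increment_less[of c0 "c0 + \<eta>" \<eta>] c0(1) assms by auto
    then show "0 < 2 * \<phi> (c0 + \<eta>) - \<phi> (c0 + 2 * \<eta>) - \<phi> c0" by (simp add: algebra_simps)
    show "\<phi> (c + 2 * \<eta>) + \<phi> c + (2 * \<phi> (c0 + \<eta>) - \<phi> (c0 + 2 * \<eta>) - \<phi> c0) \<le> 2 * \<phi> (c + \<eta>)"
      if "0 \<le> c" "c + 2 * \<eta> \<le> 2*pi" for c
      using c0(2)[of c] that by auto
  qed
qed

text \<open>Rearrangement and distribution function are generalized inverses. From right to left the
  point is right-continuity of the distribution function: if it exceeds t at \<tau>, it still does
  at some larger height, and no admissible value lies below that height. Continuity bounds |x|, so
  the set under the infimum is not empty.\<close>

lemma less_decr_rearr_iff: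
  assumes v: "continuous_on {0..2*pi} (\<lambda>s. cmod (x s))" and t: "0 < t" and \<tau>: "0 \<le> \<tau>"
  shows "\<tau> < decr_rearr x t \<longleftrightarrow> t < measure circle_measure (level (\<lambda>s. cmod (x s)) \<tau>)"
proof -
  let ?v = "\<lambda>s. cmod (x s)"
  define lev where "lev = (\<lambda>\<tau>. measure circle_measure (level ?v \<tau>))"
  have vm [measurable]: "?v \<in> borel_measurable circle_measure"
    using v by (intro continuous_imp_measurable_on_sets_lebesgue) auto
  have em: "emeasure lebesgue {s\<in>{0..2*pi}. \<tau> < cmod (x s)} = ennreal (lev \<tau>)" for \<tau>
  proof -
    have eq: "level ?v \<tau> = {s\<in>{0..2*pi}. \<tau> < cmod (x s)}" by (auto simp: level_def)
    have "emeasure lebesgue (level ?v \<tau>) = emeasure circle_measure (level ?v \<tau>)"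
      by (rule emeasure_restrict_space[symmetric]) (auto simp: level_def)
    also have "\<dots> = ennreal (lev \<tau>)" unfolding lev_def by (rule emeasure_eq_measure)
    finally show ?thesis unfolding eq .
  qed
  define S where "S = {\<tau>. 0 \<le> \<tau> \<and> lev \<tau> \<le> t}"
  have dr: "decr_rearr x t = Inf S"
    unfolding decr_rearr_def S_def em using t by (simp add: ennreal_le_iff)
  have bdd: "bdd_below S" by (auto simp: S_def bdd_below_def)
  have anti: "lev \<sigma> \<le> lev \<tau>" if "\<tau> \<le> \<sigma>" for \<tau> \<sigma>
    unfolding lev_def using that by (intro finite_measure_mono sets_level[OF vm]) (auto simp: level_def)
  obtain C where C: "\<And>s. s \<in> {0..2*pi} \<Longrightarrow> ?v s \<le> C"
    using continuous_attains_sup[OF compact_Icc _ v] by fastforce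
  have "0 \<le> C" using order_trans[OF norm_ge_zero C[of 0]] by simp
  moreover have "level ?v C = {}" using C by (force simp: level_def)
  ultimately have "C \<in> S" using t by (simp add: S_def lev_def)
  then have ne: "S \<noteq> {}" by blast
  show ?thesis
  proof
    assume "\<tau> < decr_rearr x t"
    then have "\<tau> \<notin> S" using cInf_lower[OF _ bdd] unfolding dr by force
    then show "t < measure circle_measure (level ?v \<tau>)" using \<tau> by (simp add: S_def lev_def)
  next
    assume less: "t < measure circle_measure (level ?v \<tau>)"
    have "(\<lambda>n. measure circle_measure (level ?v (\<tau> + 1 / real (Suc n)))) \<longlonglongrightarrow> measure circle_measure (\<Union>n. level ?v (\<tau> + 1 / real (Suc n)))"
    proof (rule finite_Lim_measure_incseq)
      show "incseq (\<lambda>n. level ?v (\<tau> + 1 / real (Suc n)))"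
      proof (rule incseq_SucI)
        fix n :: nat
        have "1 / real (Suc (Suc n)) \<le> 1 / real (Suc n)" by (intro frac_le) auto
        then show "level ?v (\<tau> + 1 / real (Suc n)) \<subseteq> level ?v (\<tau> + 1 / real (Suc (Suc n)))" by (auto simp: level_def simp del: of_nat_Suc)
      qed
    qed (use sets_level[OF vm] in auto)
    also have "(\<Union>n. level ?v (\<tau> + 1 / real (Suc n))) = level ?v \<tau>"
    proof (intro equalityI subsetI)
      fix s assume "s \<in> level ?v \<tau>"
      then have s: "s \<in> space circle_measure" "0 < ?v s - \<tau>" by (auto simp: level_def)
      obtain n where "inverse (real (Suc n)) < ?v s - \<tau>" using reals_Archimedean[OF s(2)] by blast
      then show "s \<in> (\<Union>n. level ?v (\<tau> + 1 / real (Suc n)))"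
        using s(1) by (intro UN_I[of n]) (auto simp: level_def inverse_eq_divide simp del: of_nat_Suc)
    next
      fix s assume "s \<in> (\<Union>n. level ?v (\<tau> + 1 / real (Suc n)))"
      then obtain n where n: "s \<in> space circle_measure" "\<tau> + 1 / real (Suc n) < ?v s" unfolding level_def by blast
      have "0 < 1 / real (Suc n)" by simp
      then have "\<tau> < ?v s" using n(2) by linarith
      then show "s \<in> level ?v \<tau>" using n(1) unfolding level_def by blast
    qed
    finally have "\<forall>\<^sub>F n in sequentially. t < measure circle_measure (level ?v (\<tau> + 1 / real (Suc n)))"
      using less by (rule order_tendstoD(1))
    then obtain n where n: "t < lev (\<tau> + 1 / real (Suc n))"
      unfolding lev_def using eventually_happens'[OF sequentially_bot] by blast
    have "\<tau> + 1 / real (Suc n) \<le> \<sigma>" if "\<sigma> \<in> S" for \<sigma>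
      using that n anti[of \<sigma> "\<tau> + 1 / real (Suc n)"] by (force simp: S_def simp del: of_nat_Suc)
    then have "\<tau> + 1 / real (Suc n) \<le> Inf S" by (rule cInf_greatest[OF ne])
    moreover have "0 < 1 / real (Suc n)" by simp
    ultimately show "\<tau> < decr_rearr x t" unfolding dr by linarith
  qed
qed

text \<open>The layer-cake formula for the Stieltjes measure of \<phi>: the rearrangement exceeds
  \<tau> on the open interval from 0 to the measure of the level set, and the Stieltjes measure of
  that interval is the capacity of the level set.\<close>

lemma lorentz_norm_eq_choquet:
  assumes v: "continuous_on {0..2*pi} (\<lambda>s. cmod (x s))"
  shows "lorentz_norm \<phi> x = choquet circle_measure \<phi> (\<lambda>s. cmod (x s))"
proof -
  let ?v = "\<lambda>s. cmod (x s)"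
  have [measurable]: "?v \<in> borel_measurable circle_measure"
    using v by (intro continuous_imp_measurable_on_sets_lebesgue) auto
  define F where "F = (\<lambda>t. \<phi> (max 0 (min (2*pi) t)))"
  let ?I = "interval_measure F"
  have mono: "F s \<le> F t" if "s \<le> t" for s t unfolding F_def using that by (intro weight_mono) auto
  have cont: "continuous_on UNIV F"
    unfolding F_def by (intro continuous_on_compose2[OF weight_continuous] continuous_intros) auto
  have rcont: "continuous (at_right a) F" for a
    using cont continuous_on_eq_continuous_within continuous_at_imp_continuous_at_within by blast
  \<comment> \<open>The distribution F is continuous, so there are no atoms and the right endpoint
    carries no mass.\<close>
  have Ioo: "emeasure ?I {0<..<d} = ennreal (\<phi> d)" if d: "0 \<le> d" "d \<le> 2*pi" for d
  proof (cases "d = 0")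
    case False
    have "emeasure ?I {d..d} = 0" using emeasure_interval_measure_Icc[OF order_refl mono cont, of d] by simp
    then have "{d} \<in> null_sets ?I" by (auto simp: null_sets_def)
    moreover have "{0<..<d} = {0<..d} - {d}" by auto
    ultimately have "emeasure ?I {0<..<d} = emeasure ?I {0<..d}" by (simp add: emeasure_Diff_null_set)
    also have "\<dots> = ennreal (F d - F 0)" by (intro emeasure_interval_measure_Ioc d mono rcont)
    finally show ?thesis using d by (simp add: F_def)
  qed simp
  \<comment> \<open>\<open>decr_rearr\<close> is meaningful only for t > 0 and the integral runs
    over (0, 2 pi], so the integrand is continued by 0.\<close>
  define u where "u = (\<lambda>t. if t \<in> {0<..2*pi} then decr_rearr x t else 0)"
  have lev: "{t \<in> space ?I. \<tau> < u t} = {0<..<measure circle_measure (level ?v \<tau>)}" if "0 \<le> \<tau>" for \<tau>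
    using less_decr_rearr_iff[OF v _ that] bounded_measure[of "level ?v \<tau>"] that
    by (auto simp: u_def)
  have dr0: "0 \<le> decr_rearr x t" if "0 < t" for t
  proof (rule ccontr)
    assume neg: "\<not> 0 \<le> decr_rearr x t"
    define S where "S = {\<tau>. 0 \<le> \<tau> \<and> emeasure lebesgue {s\<in>{0..2*pi}. cmod (x s) > \<tau>} \<le> ennreal t}"
    obtain C where C: "\<And>s. s \<in> {0..2*pi} \<Longrightarrow> ?v s \<le> C"
      using continuous_attains_sup[OF compact_Icc _ v] by fastforce
    have "0 \<le> C" using order_trans[OF norm_ge_zero C[of 0]] by simp
    moreover have emp: "{s\<in>{0..2*pi}. C < cmod (x s)} = {}" using C by force
    have "emeasure lebesgue {s\<in>{0..2*pi}. C < cmod (x s)} \<le> ennreal t"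
      unfolding emp emeasure_empty by (rule zero_le)
    ultimately have "C \<in> S" unfolding S_def by blast
    then have "0 \<le> Inf S" by (intro cInf_greatest) (auto simp: S_def)
    then show False using neg unfolding decr_rearr_def S_def by blast
  qed
  have um: "u \<in> borel_measurable ?I"
    unfolding borel_measurable_iff_greater
  proof
    fix a :: real
    show "{t \<in> space ?I. a < u t} \<in> sets ?I"
    proof (cases "0 \<le> a")
      case True then show ?thesis unfolding lev[OF True] by simp
    next
      case False
      moreover have "0 \<le> u t" for t using dr0 by (simp add: u_def)
      ultimately have "a < u t" for t by (meson not_le order_less_le_trans)
      then have "{t \<in> space ?I. a < u t} = UNIV" by simp
      then show ?thesis by simp
    qed
  qed
  have "lorentz_norm \<phi> x = (\<integral>\<^sup>+t. ennreal (u t) \<partial>?I)"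
    unfolding lorentz_norm_def F_def[symmetric] by (intro nn_integral_cong) (auto simp: u_def split: split_indicator)
  also have "\<dots> = (\<integral>\<^sup>+\<tau>\<in>{0..}. emeasure ?I {t \<in> space ?I. \<tau> < u t} \<partial>lborel)"
    by (intro nn_integral_layer_cake um sigma_finite_interval_measure mono rcont)
  also have "\<dots> = choquet circle_measure \<phi> ?v"
    unfolding choquet_level
  proof (intro nn_integral_cong)
    fix \<tau> :: real
    show "emeasure ?I {t \<in> space ?I. \<tau> < u t} * indicator {0..} \<tau> = ennreal (capacity (level ?v \<tau>)) * indicator {0..} \<tau>"
    proof (cases "0 \<le> \<tau>")
      case True
      have "emeasure ?I {t \<in> space ?I. \<tau> < u t} = ennreal (capacity (level ?v \<tau>))"
        unfolding lev[OF True] using bounded_measure[of "level ?v \<tau>"] by (intro Ioo) auto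
      then show ?thesis by simp
    qed simp
  qed
  finally show ?thesis .
qed

lemma integral_le_choquet:
  assumes v: "continuous_on {0..2*pi} v" "\<And>s. s \<in> {0..2*pi} \<Longrightarrow> 0 \<le> v s"
    and c: "choquet circle_measure \<phi> v \<le> ennreal c" "0 \<le> c"
  shows "(\<integral>s. v s \<partial>circle_measure) \<le> 2*pi * c"
proof -
  have [measurable]: "v \<in> borel_measurable circle_measure"
    using v by (intro continuous_imp_measurable_on_sets_lebesgue) auto
  have "ennreal (\<integral>s. v s \<partial>circle_measure) = (\<integral>\<^sup>+s. ennreal (v s) \<partial>circle_measure)"
    using v by (intro nn_integral_eq_integral[symmetric] continuous_imp_integrable_real AE_I2) auto
  also have "\<dots> = (\<integral>\<^sup>+\<tau>\<in>{0..}. emeasure circle_measure (level v \<tau>) \<partial>lborel)"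
    unfolding level_def by (rule nn_integral_layer_cake) (unfold_locales, measurable)
  also have "\<dots> \<le> (\<integral>\<^sup>+\<tau>. ennreal (2*pi) * (ennreal (capacity (level v \<tau>)) * indicator {0..} \<tau>) \<partial>lborel)"
  proof (rule nn_integral_mono)
    fix \<tau> :: real
    have "measure circle_measure (level v \<tau>) \<le> 2*pi * capacity (level v \<tau>)"
      using bounded_measure[of "level v \<tau>"] by (intro weight_ge_linear) auto
    then have "emeasure circle_measure (level v \<tau>) \<le> ennreal (2*pi) * ennreal (capacity (level v \<tau>))"
      unfolding emeasure_eq_measure by (subst ennreal_mult[symmetric]) (auto simp: capacity_nonneg intro: ennreal_leI)
    then show "emeasure circle_measure (level v \<tau>) * indicator {0..} \<tau> \<le> ennreal (2*pi) * (ennreal (capacity (level v \<tau>)) * indicator {0..} \<tau>)"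
      by (auto split: split_indicator)
  qed
  also have "\<dots> = ennreal (2*pi) * choquet circle_measure \<phi> v"
    unfolding choquet_level by (intro nn_integral_cmult) measurable
  also have "\<dots> \<le> ennreal (2*pi) * ennreal c" by (intro mult_left_mono c) simp
  also have "\<dots> = ennreal (2*pi * c)" using c by (simp add: ennreal_mult)
  finally show ?thesis using c by (simp add: ennreal_le_iff)
qed

end

section \<open>Monotonicity of the circle norms\<close>

lemma measure_circle_eq:
  assumes "A \<in> sets lebesgue" "A \<subseteq> {0..2*pi}"
  shows "measure circle_measure A = measure lebesgue A"
  using assms by (intro measure_restrict_space) auto

text \<open>Translation by \<theta> moves the window [0, 2 pi] to [\<theta>, 2 pi + \<theta>], and
  the part beyond 2 pi moves back by one period to [0, \<theta>). Half-open windows make the pieces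
  disjoint, at the cost of a null set.\<close>

lemma measure_periodic_rotate:
  fixes A :: "real set"
  assumes A: "A \<in> sets lebesgue" and per: "\<And>t. t + 2*pi \<in> A \<longleftrightarrow> t \<in> A" and \<theta>: "0 \<le> \<theta>" "\<theta> \<le> 2*pi"
  shows "measure lebesgue {s \<in> {0..2*pi}. s + \<theta> \<in> A} = measure lebesgue {s \<in> {0..2*pi}. s \<in> A}"
proof -
  have lm: "A \<inter> {a..<b} \<in> lmeasurable" for a b
    by (rule bounded_set_imp_lmeasurable) (use A in \<open>auto intro: bounded_subset[of "{a..b}"]\<close>)
  have tr: "measure lebesgue (A \<inter> {2*pi..<2*pi + \<theta>}) = measure lebesgue (A \<inter> {0..<\<theta>})"
  proof -
    have "(+) (2*pi) ` (A \<inter> {0..<\<theta>}) = A \<inter> {2*pi..<2*pi + \<theta>}"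
    proof safe
      fix t assume "t \<in> A" "t \<in> {2*pi..<2*pi + \<theta>}"
      then show "t \<in> (+) (2*pi) ` (A \<inter> {0..<\<theta>})"
        using per[of "t - 2*pi"] by (intro image_eqI[of _ _ "t - 2*pi"]) auto
    qed (use per in \<open>auto simp: add.commute\<close>)
    then show ?thesis using measure_translation[of "2*pi" "A \<inter> {0..<\<theta>}"] by simp
  qed
  have split: "measure lebesgue (A \<inter> {a..<c}) = measure lebesgue (A \<inter> {a..<b}) + measure lebesgue (A \<inter> {b..<c})"
    if "a \<le> b" "b \<le> c" for a b c
  proof -
    have "A \<inter> {a..<c} = (A \<inter> {a..<b}) \<union> (A \<inter> {b..<c})" using that by auto
    moreover have "measure lebesgue ((A \<inter> {a..<b}) \<union> (A \<inter> {b..<c})) = measure lebesgue (A \<inter> {a..<b}) + measure lebesgue (A \<inter> {b..<c})"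
    proof -
      have "(A \<inter> {b..<c}) - (A \<inter> {a..<b}) = A \<inter> {b..<c}" by auto
      then show ?thesis using measure_Un2[OF lm lm, of a b b c] by simp
    qed
    ultimately show ?thesis by simp
  qed
  have ends: "measure lebesgue (A \<inter> {a..b}) = measure lebesgue (A \<inter> {a..<b})" for a b
  proof (rule measure_negligible_symdiff[OF lm])
    have "(A \<inter> {a..<b} - A \<inter> {a..b}) \<union> (A \<inter> {a..b} - A \<inter> {a..<b}) \<subseteq> {b}" by auto
    then show "negligible ((A \<inter> {a..<b} - A \<inter> {a..b}) \<union> (A \<inter> {a..b} - A \<inter> {a..<b}))"
      by (rule negligible_subset[rotated]) simp
  qed
  have "(+) \<theta> ` {s \<in> {0..2*pi}. s + \<theta> \<in> A} = A \<inter> {\<theta>..2*pi + \<theta>}"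
  proof safe
    fix t assume "t \<in> A" "t \<in> {\<theta>..2*pi + \<theta>}"
    then show "t \<in> (+) \<theta> ` {s \<in> {0..2*pi}. s + \<theta> \<in> A}" by (intro image_eqI[of _ _ "t - \<theta>"]) auto
  qed (auto simp: add.commute)
  then have "measure lebesgue {s \<in> {0..2*pi}. s + \<theta> \<in> A} = measure lebesgue (A \<inter> {\<theta>..2*pi + \<theta>})"
    using measure_translation[of \<theta> "{s \<in> {0..2*pi}. s + \<theta> \<in> A}"] by simp
  also have "\<dots> = measure lebesgue (A \<inter> {\<theta>..<2*pi}) + measure lebesgue (A \<inter> {2*pi..<2*pi + \<theta>})"
    unfolding ends using \<theta> by (intro split) auto
  also have "\<dots> = measure lebesgue (A \<inter> {0..<2*pi})"
    unfolding tr using split[of 0 \<theta> "2*pi"] \<theta> by simp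
  also have "\<dots> = measure lebesgue {s \<in> {0..2*pi}. s \<in> A}"
    unfolding ends[symmetric] by (intro arg_cong[where f = "measure lebesgue"]) auto
  finally show ?thesis .
qed

context lorentz_weight
begin

lemma choquet_rotate:
  assumes v: "continuous_on UNIV v" "\<And>t. v (t + 2*pi) = v t" and \<theta>: "0 \<le> \<theta>" "\<theta> \<le> 2*pi"
  shows "choquet circle_measure \<phi> (\<lambda>s. v (s + \<theta>)) = choquet circle_measure \<phi> v"
proof -
  have vb: "{t. \<tau> < v t} \<in> sets borel" for \<tau>
    using v(1) by (intro borel_open open_Collect_less continuous_intros)
  have "measure circle_measure (level (\<lambda>s. v (s + \<theta>)) \<tau>) = measure circle_measure (level v \<tau>)" for \<tau>
  proof -
    have c: "continuous_on UNIV (\<lambda>s. v (s + \<theta>))"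
      by (intro continuous_on_compose2[OF v(1)] continuous_intros) auto
    have "{s. \<tau> < v (s + \<theta>)} \<in> sets borel" using c by (intro borel_open open_Collect_less continuous_intros)
    then have m1: "{0..2*pi} \<inter> {s. \<tau> < v (s + \<theta>)} \<in> sets lebesgue" by (intro sets.Int) auto
    have m2: "{0..2*pi} \<inter> {s. \<tau> < v s} \<in> sets lebesgue" using vb by (intro sets.Int) auto
    have eq: "level (\<lambda>s. v (s + \<theta>)) \<tau> = {0..2*pi} \<inter> {s. \<tau> < v (s + \<theta>)}" "level v \<tau> = {0..2*pi} \<inter> {s. \<tau> < v s}"
      by (auto simp: level_def)
    have "measure lebesgue {s \<in> {0..2*pi}. s + \<theta> \<in> {t. \<tau> < v t}} = measure lebesgue {s \<in> {0..2*pi}. s \<in> {t. \<tau> < v t}}"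
      using vb v(2) by (intro measure_periodic_rotate \<theta>) auto
    then show ?thesis
      unfolding eq measure_circle_eq[OF m1 Int_lower1] measure_circle_eq[OF m2 Int_lower1]
      by (simp add: Int_def Collect_conj_eq[symmetric])
  qed
  then show ?thesis unfolding choquet_level by simp
qed

text \<open>Subadditivity, homogeneity and rotation invariance combined: when the weights sum to 1,
  an average of rotations has norm at most that of \<open>v\<close>.\<close>

lemma choquet_weighted_sum_rotations:
  fixes v :: "real \<Rightarrow> real" and w \<theta> :: "nat \<Rightarrow> real"
  assumes v: "continuous_on UNIV v" "\<And>t. v (t + 2*pi) = v t" "\<And>t. 0 \<le> v t" "\<And>t. v t \<le> C"
    and w: "\<And>j. 0 \<le> w j" and \<theta>: "\<And>j. j < k \<Longrightarrow> 0 \<le> \<theta> j \<and> \<theta> j \<le> 2*pi"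
  shows "choquet circle_measure \<phi> (\<lambda>s. \<Sum>j<k. w j * v (s + \<theta> j)) \<le> ennreal (\<Sum>j<k. w j) * choquet circle_measure \<phi> v"
  using \<theta>
proof (induction k)
  case 0
  then show ?case using choquet_const[of 0] by simp
next
  case (Suc k)
  let ?N = "choquet circle_measure \<phi>"
  have vc: "continuous_on A (\<lambda>s. v (s + t))" for A t
    by (intro continuous_on_compose2[OF v(1)] continuous_intros) auto
  have C0: "0 \<le> C" using order_trans[OF v(3,4)[of 0]] by simp
  have wk: "0 \<le> (\<Sum>j<k. w j)" using w by (intro sum_nonneg) auto
  have "?N (\<lambda>s. \<Sum>j<Suc k. w j * v (s + \<theta> j)) = ?N (\<lambda>s. (\<Sum>j<k. w j * v (s + \<theta> j)) + w k * v (s + \<theta> k))" by simp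
  also have "\<dots> \<le> ?N (\<lambda>s. \<Sum>j<k. w j * v (s + \<theta> j)) + ?N (\<lambda>s. w k * v (s + \<theta> k))"
  proof (rule choquet_add[where C = "((\<Sum>j<k. w j) + w k) * C"])
    show "(\<lambda>s. \<Sum>j<k. w j * v (s + \<theta> j)) \<in> borel_measurable circle_measure" "(\<lambda>s. w k * v (s + \<theta> k)) \<in> borel_measurable circle_measure"
      by (intro continuous_imp_measurable_on_sets_lebesgue continuous_on_sum continuous_on_mult continuous_on_const vc; simp)+
    fix s
    show "0 \<le> (\<Sum>j<k. w j * v (s + \<theta> j))" "0 \<le> w k * v (s + \<theta> k)" using w v(3) by (auto intro!: sum_nonneg)
    have "(\<Sum>j<k. w j * v (s + \<theta> j)) \<le> (\<Sum>j<k. w j * C)" using w v(4) by (intro sum_mono mult_left_mono) auto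
    also have "\<dots> = (\<Sum>j<k. w j) * C" by (simp add: sum_distrib_right)
    also have "\<dots> \<le> ((\<Sum>j<k. w j) + w k) * C" using w C0 by (intro mult_right_mono) auto
    finally show "(\<Sum>j<k. w j * v (s + \<theta> j)) \<le> ((\<Sum>j<k. w j) + w k) * C" .
    have "w k * v (s + \<theta> k) \<le> w k * C" using w v(4) by (intro mult_left_mono) auto
    also have "\<dots> \<le> ((\<Sum>j<k. w j) + w k) * C" using wk C0 by (intro mult_right_mono) auto
    finally show "w k * v (s + \<theta> k) \<le> ((\<Sum>j<k. w j) + w k) * C" .
  qed
  also have "?N (\<lambda>s. w k * v (s + \<theta> k)) = ennreal (w k) * ?N v"
  proof (cases "w k = 0")
    case True then show ?thesis using choquet_const[of 0] by simp
  next
    case False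
    then have "0 < w k" using w[of k] by simp
    moreover have "(\<lambda>s. v (s + \<theta> k)) \<in> borel_measurable circle_measure"
      by (intro continuous_imp_measurable_on_sets_lebesgue vc) auto
    ultimately have "?N (\<lambda>s. w k * v (s + \<theta> k)) = ennreal (w k) * ?N (\<lambda>s. v (s + \<theta> k))" by (intro choquet_cmult)
    then show ?thesis using choquet_rotate[OF v(1,2)] Suc.prems[of k] by simp
  qed
  also have "?N (\<lambda>s. \<Sum>j<k. w j * v (s + \<theta> j)) \<le> ennreal (\<Sum>j<k. w j) * ?N v" by (rule Suc.IH) (use Suc.prems in auto)
  also have "ennreal (\<Sum>j<k. w j) * ?N v + ennreal (w k) * ?N v = ennreal (\<Sum>j<Suc k. w j) * ?N v"
    using wk w by (simp add: distrib_right[symmetric])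
  finally show ?case by (simp add: add_right_mono)
qed

text \<open>The values of \<open>f\<close> on the smaller circle are Poisson averages of its rotated values on the larger one;
  cutting the average into short arcs reduces this to finitely many rotations.\<close>

lemma choquet_circle_mono:
  assumes f: "f holomorphic_on ball 0 1" and r: "0 \<le> r" "r < R" "R < 1"
  shows "choquet circle_measure \<phi> (\<lambda>s. cmod (f (of_real r * cis s))) \<le>
    choquet circle_measure \<phi> (\<lambda>s. cmod (f (of_real R * cis s)))"
proof (rule ennreal_le_epsilon)
  fix e :: real assume e: "0 < e"
  let ?N = "choquet circle_measure \<phi>"
  define v where "v = (\<lambda>s. cmod (f (of_real R * cis s)))"
  have fc: "continuous_on UNIV (\<lambda>s. f (of_real R' * cis s))" if "0 \<le> R'" "R' < 1" for R'
    using that by (intro continuous_on_compose2[OF holomorphic_on_imp_continuous_on[OF f]] continuous_intros)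
      (auto simp: norm_mult)
  have v: "continuous_on UNIV v" "\<And>t. 0 \<le> v t" "\<And>t. v (t + 2*pi) = v t"
    unfolding v_def using fc[of R] r by (auto intro!: continuous_intros simp: cis_mult[symmetric])
  obtain C where C: "\<And>t. v t \<le> C"
  proof -
    have "compact (f ` sphere 0 R)"
      using r by (intro compact_continuous_image continuous_on_subset[OF holomorphic_on_imp_continuous_on[OF f]]) auto
    then obtain C where "\<And>y. y \<in> f ` sphere 0 R \<Longrightarrow> cmod y \<le> C" using compact_imp_bounded bounded_iff by metis
    moreover have "of_real R * cis t \<in> sphere 0 R" for t using r by (simp add: norm_mult)
    ultimately show thesis using that[of C] unfolding v_def by blast
  qed
  define z where "z = complex_of_real (r / R)"
  have z: "cmod z < 1" unfolding z_def norm_of_real using r by simp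
  define P where "P = poisson_kernel z"
  have P: "continuous_on A P" "0 \<le> P t" for A t
    unfolding P_def using continuous_on_poisson_kernel[OF z] poisson_kernel_nonneg[OF z] by auto
  \<comment> \<open>The arguments s + t with both terms in [0, 2 pi] range over [0, 4 pi].\<close>
  have "uniformly_continuous_on {0..4*pi} v"
    by (intro compact_uniformly_continuous continuous_on_subset[OF v(1)]) auto
  then obtain d where d: "0 < d" "\<And>s t. s \<in> {0..4*pi} \<Longrightarrow> t \<in> {0..4*pi} \<Longrightarrow> dist t s < d \<Longrightarrow> dist (v t) (v s) < e"
    using e unfolding uniformly_continuous_on_def by metis
  obtain m :: nat where m: "2*pi / d < real m" using reals_Archimedean2 by blast
  then have m0: "0 < real m" using d(1) by (smt (verit) divide_pos_pos pi_gt_zero)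
  define \<theta> where "\<theta> = (\<lambda>j::nat. real j * (2*pi / real m))"
  have \<theta>m: "\<theta> m = 2*pi" "\<theta> 0 = 0" using m0 by (auto simp: \<theta>_def)
  have \<theta>S: "\<theta> (Suc j) = \<theta> j + 2*pi / real m" for j unfolding \<theta>_def of_nat_Suc distrib_right mult_1 by (rule add.commute)
  have small: "2*pi / real m < d"
  proof -
    have "2*pi < real m * d" using m d(1) by (simp only: pos_divide_less_eq)
    then show ?thesis using m0 by (simp only: pos_divide_less_eq mult.commute)
  qed
  have \<theta>mono: "\<theta> j \<le> \<theta> k" if "j \<le> k" for j k unfolding \<theta>_def using that m0 by (intro mult_right_mono) auto
  have \<theta>rng: "0 \<le> \<theta> j" "\<theta> j \<le> 2*pi" if "j \<le> m" for j
    using \<theta>mono[of 0 j] \<theta>mono[OF that] \<theta>m by auto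
  \<comment> \<open>The harmonic measures, seen from z, of the arcs between consecutive division
    points; they add up to 1.\<close>
  define w where "w = (\<lambda>j. integral {\<theta> j..\<theta> (Suc j)} P / (2*pi))"
  have Pint: "P integrable_on {a..b}" for a b by (intro integrable_continuous_real P)
  have w0: "0 \<le> w j" for j
    unfolding w_def using P by (intro divide_nonneg_nonneg Henstock_Kurzweil_Integration.integral_nonneg Pint) auto
  have wsum: "(\<Sum>j<k. w j) = integral {0..\<theta> k} P / (2*pi)" for k
  proof (induction k)
    case 0 then show ?case by (simp add: \<theta>m)
  next
    case (Suc k)
    have "integral {0..\<theta> k} P + integral {\<theta> k..\<theta> (Suc k)} P = integral {0..\<theta> (Suc k)} P"
      using \<theta>mono[of 0 k] \<theta>mono[of k "Suc k"] \<theta>m by (intro Henstock_Kurzweil_Integration.integral_combine Pint) auto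
    then show ?case using Suc by (simp add: w_def add_divide_distrib[symmetric])
  qed
  have w1: "(\<Sum>j<m. w j) = 1"
  proof -
    have "poisson (\<lambda>_. 1::real) z = (1/(2*pi)) * integral {0..2*pi} P"
      unfolding poisson_def using lebesgue_integral_eq_integral[OF continuous_imp_integrable_real[OF P(1)]] by (simp add: P_def)
    then show ?thesis unfolding wsum \<theta>m using poisson_const[OF z, of 1] by simp
  qed
  have est: "cmod (f (of_real r * cis s)) \<le> (\<Sum>j<m. w j * v (s + \<theta> j)) + e" if s: "s \<in> {0..2*pi}" for s
  proof -
    have vs: "continuous_on A (\<lambda>t. v (s + t))" for A
      by (intro continuous_on_compose2[OF v(1)] continuous_intros) auto
    have Pv: "(\<lambda>t. P t * v (s + t)) integrable_on {a..b}" for a b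
      by (intro integrable_continuous_real continuous_intros P vs)
    have step: "integral {0..\<theta> k} (\<lambda>t. P t * v (s + t)) \<le> (\<Sum>j<k. 2*pi * w j * (v (s + \<theta> j) + e))" if "k \<le> m" for k
      using that
    proof (induction k)
      case 0 then show ?case by (simp add: \<theta>m)
    next
      case (Suc k)
      have "integral {0..\<theta> (Suc k)} (\<lambda>t. P t * v (s + t)) = integral {0..\<theta> k} (\<lambda>t. P t * v (s + t)) + integral {\<theta> k..\<theta> (Suc k)} (\<lambda>t. P t * v (s + t))"
        using \<theta>mono[of 0 k] \<theta>mono[of k "Suc k"] \<theta>m by (intro Henstock_Kurzweil_Integration.integral_combine[symmetric] Pv) auto
      also have "integral {\<theta> k..\<theta> (Suc k)} (\<lambda>t. P t * v (s + t)) \<le> integral {\<theta> k..\<theta> (Suc k)} (\<lambda>t. P t * (v (s + \<theta> k) + e))"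
      proof (rule Henstock_Kurzweil_Integration.integral_le)
        show "(\<lambda>t. P t * (v (s + \<theta> k) + e)) integrable_on {\<theta> k..\<theta> (Suc k)}"
          by (intro integrable_continuous_real continuous_intros P)
        fix t assume t: "t \<in> {\<theta> k..\<theta> (Suc k)}"
        have "dist (v (s + t)) (v (s + \<theta> k)) < e"
          using t \<theta>rng[of k] \<theta>rng[of "Suc k"] Suc.prems s small \<theta>S[of k] by (intro d(2)) (auto simp: dist_real_def)
        then show "P t * v (s + t) \<le> P t * (v (s + \<theta> k) + e)"
          using P(2) by (intro mult_left_mono) (auto simp: dist_real_def)
      qed (rule Pv)
      also have "\<dots> = 2*pi * w k * (v (s + \<theta> k) + e)" by (simp add: w_def)
      finally show ?case using Suc by simp
    qed
    \<comment> \<open>Rotating f by s allows the same point z = r / R, and hence the same weights,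
      to be used for every s.\<close>
    define F where "F = (\<lambda>x. f (cis s * x))"
    have F: "F holomorphic_on ball 0 1"
      unfolding F_def by (rule holomorphic_on_compose_gen[OF _ f, unfolded o_def]) (auto intro!: holomorphic_intros simp: norm_mult)
    have "poisson (\<lambda>t. F (of_real R * cis t)) z = F (of_real R * z)" using r by (intro poisson_formula[OF F _ _ z]) auto
    moreover have "of_real R * z = of_real r"
    proof -
      have "R * (r / R) = r" using r by simp
      then show ?thesis unfolding z_def of_real_mult[symmetric] by simp
    qed
    moreover have "F (of_real R * cis t) = f (of_real R * cis (s + t))" for t
      by (simp add: F_def cis_mult[symmetric] mult.left_commute)
    ultimately have "f (of_real r * cis s) = poisson (\<lambda>t. f (of_real R * cis (s + t))) z" by (simp add: F_def mult.commute)
    then have "cmod (f (of_real r * cis s)) \<le> poisson (\<lambda>t. v (s + t)) z"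
      using norm_poisson_le[OF z] unfolding v_def by metis
    also have "\<dots> = (1/(2*pi)) * integral {0..2*pi} (\<lambda>t. P t * v (s + t))"
      unfolding poisson_def P_def[symmetric]
      using lebesgue_integral_eq_integral[OF continuous_imp_integrable_real[OF continuous_on_mult[OF P(1) vs]]] by simp
    also have "\<dots> \<le> (1/(2*pi)) * (\<Sum>j<m. 2*pi * w j * (v (s + \<theta> j) + e))"
      using step[of m] unfolding \<theta>m by (intro mult_left_mono) auto
    also have "\<dots> = (\<Sum>j<m. w j * (v (s + \<theta> j) + e))"
      unfolding sum_distrib_left by (intro sum.cong refl) simp
    also have "\<dots> = (\<Sum>j<m. w j * v (s + \<theta> j)) + (\<Sum>j<m. w j) * e"
      by (simp add: distrib_left sum.distrib sum_distrib_right)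
    finally show ?thesis unfolding w1 by simp
  qed
  let ?S = "\<lambda>s. \<Sum>j<m. w j * v (s + \<theta> j)"
  have Sc: "continuous_on A ?S" for A
    by (intro continuous_intros continuous_on_compose2[OF v(1)]) auto
  have Sm: "?S \<in> borel_measurable circle_measure" by (intro continuous_imp_measurable_on_sets_lebesgue Sc) auto
  have SC: "?S s \<le> C" for s
  proof -
    have "?S s \<le> (\<Sum>j<m. w j * C)" using w0 C by (intro sum_mono mult_left_mono) auto
    then show ?thesis using w1 by (simp add: sum_distrib_right[symmetric])
  qed
  have S0: "0 \<le> ?S s" for s using w0 v(2) by (intro sum_nonneg mult_nonneg_nonneg)
  have "?N (\<lambda>s. cmod (f (of_real r * cis s))) \<le> ?N (\<lambda>s. ?S s + e)"
    using est Sm by (intro choquet_mono) auto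
  also have "\<dots> \<le> ?N ?S + ?N (\<lambda>_. e)"
    using S0 SC e Sm by (intro choquet_add[where C = "max C e"]) (auto simp: le_max_iff_disj)
  also have "?N (\<lambda>_. e) = ennreal e" using choquet_const[of e] e by simp
  also have "?N ?S \<le> ennreal (\<Sum>j<m. w j) * ?N v"
    using \<theta>rng by (intro choquet_weighted_sum_rotations[where C = C] v C w0) auto
  also have "\<dots> = ?N v" by (simp add: w1)
  finally show "?N (\<lambda>s. cmod (f (of_real r * cis s))) \<le> ?N (\<lambda>s. cmod (f (of_real R * cis s))) + ennreal e"
    by (simp add: v_def add_right_mono)
qed

end

section \<open>Equality in the triangle inequality\<close>

text \<open>The points of \<open>A\<close> at which Q holds from index k on increase to
  \<open>A\<close>, so for some k they have measure above \<eta>. This carries strict inequalities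
  between boundary limits over to circles of radius near 1, with only a loss of measure.\<close>

lemma (in finite_measure) eventually_measure_ge:
  assumes A: "A \<in> sets M" "\<eta> < measure M A"
    and Q: "\<And>n. {s \<in> space M. Q n s} \<in> sets M"
    and ev: "\<And>s. s \<in> A \<Longrightarrow> \<forall>\<^sub>F n in sequentially. Q n s"
  shows "\<forall>\<^sub>F n in sequentially. \<eta> \<le> measure M {s \<in> space M. Q n s}"
proof -
  define B where "B = (\<lambda>k. A \<inter> (\<Inter>n\<in>{k..}. {s \<in> space M. Q n s}))"
  have Bm: "B k \<in> sets M" for k
    unfolding B_def using A(1) Q by (intro sets.Int sets.countable_INT') auto
  have As: "A \<subseteq> space M" using A(1) by (rule sets.sets_into_space)
  have "(\<Union>k. B k) = A"
  proof
    show "A \<subseteq> (\<Union>k. B k)"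
    proof
      fix s assume s: "s \<in> A"
      then obtain k where "\<And>n. k \<le> n \<Longrightarrow> Q n s" using ev[OF s] unfolding eventually_sequentially by blast
      then show "s \<in> (\<Union>k. B k)" using s As by (auto simp: B_def)
    qed
  qed (auto simp: B_def)
  moreover have "(\<lambda>k. measure M (B k)) \<longlonglongrightarrow> measure M (\<Union>k. B k)"
  proof (rule finite_Lim_measure_incseq)
    show "incseq B" by (rule incseq_SucI) (auto simp: B_def)
  qed (use Bm in auto)
  ultimately have "\<forall>\<^sub>F k in sequentially. \<eta> < measure M (B k)"
    using A(2) by (simp add: order_tendstoD(1))
  then obtain k where k: "\<eta> < measure M (B k)" using eventually_happens'[OF sequentially_bot] by blast
  have "\<eta> \<le> measure M {s \<in> space M. Q n s}" if "k \<le> n" for n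
  proof -
    have "B k \<subseteq> {s \<in> space M. Q n s}" using that by (auto simp: B_def)
    from finite_measure_mono[OF this Q] show ?thesis using k by simp
  qed
  then show ?thesis unfolding eventually_sequentially by blast
qed

lemma (in finite_measure) measure_pos_countable_UN:
  assumes "0 < measure M (\<Union>i::nat. A i)" "\<And>i. A i \<in> sets M"
  shows "\<exists>i. 0 < measure M (A i)"
proof (rule ccontr)
  assume "\<not> ?thesis"
  then have "measure M (A i) = 0" for i using measure_nonneg[of M "A i"] by (simp add: not_less antisym)
  then have "A i \<in> null_sets M" for i using assms(2) by (simp add: null_sets_def emeasure_eq_measure)
  then have "(\<Union>i. A i) \<in> null_sets M" by (intro null_sets_UN) auto
  then show False using assms(1) by (simp add: null_sets_def measure_def)
qed

text \<open>The candidate \<kappa> is the essential supremum of \<open>x\<close> on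
  \<open>E\<close>, finite by the bounds. Above each height below \<kappa> there is a set of
  positive measure; if no \<alpha> splits \<open>E\<close>, only a null set lies below that height,
  and \<open>x\<close> equals \<kappa> almost everywhere.\<close>

lemma (in finite_measure) ae_constant_or_split:
  fixes x :: "'a \<Rightarrow> real"
  assumes x [measurable]: "x \<in> borel_measurable M" and E [measurable]: "E \<in> sets M" and pos: "0 < measure M E"
    and bounds: "\<And>s. s \<in> E \<Longrightarrow> 0 \<le> x s" "\<And>s. s \<in> E \<Longrightarrow> x s \<le> C"
  shows "(\<exists>\<kappa>. measure M {s \<in> E. x s \<noteq> \<kappa>} = 0) \<or>
    (\<exists>\<alpha>. 0 < measure M {s \<in> E. \<alpha> < x s} \<and> 0 < measure M {s \<in> E. x s < \<alpha>})"
proof (rule disjCI)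
  assume no: "\<not> (\<exists>\<alpha>. 0 < measure M {s \<in> E. \<alpha> < x s} \<and> 0 < measure M {s \<in> E. x s < \<alpha>})"
  have Es: "E \<subseteq> space M" using E by (rule sets.sets_into_space)
  have [measurable]: "{s \<in> E. x s < a} \<in> sets M" "{s \<in> E. a < x s} \<in> sets M" for a
  proof -
    have "{s \<in> E. x s < a} = E \<inter> {s \<in> space M. x s < a}" "{s \<in> E. a < x s} = E \<inter> {s \<in> space M. a < x s}"
      using Es by auto
    then show "{s \<in> E. x s < a} \<in> sets M" "{s \<in> E. a < x s} \<in> sets M" by simp_all
  qed
  define S where "S = {\<alpha>. measure M {s \<in> E. \<alpha> < x s} = 0}"
  define \<kappa> where "\<kappa> = Inf S"
  have emp: "{s \<in> E. C < x s} = {}" using bounds(2) by force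
  have "C \<in> S" unfolding S_def mem_Collect_eq emp by simp
  have S0: "0 \<le> \<alpha>" if "\<alpha> \<in> S" for \<alpha>
  proof (rule ccontr)
    assume "\<not> 0 \<le> \<alpha>"
    then have all: "{s \<in> E. \<alpha> < x s} = E" using bounds(1) by force
    show False using that pos unfolding S_def mem_Collect_eq all by simp
  qed
  then have bdd: "bdd_below S" by (auto simp: bdd_below_def)
  have up: "measure M {s \<in> E. \<kappa> + 1 / real (Suc n) < x s} = 0" for n
  proof -
    have "\<kappa> < \<kappa> + 1 / real (Suc n)" by simp
    then obtain \<beta> where \<beta>: "\<beta> \<in> S" "\<beta> < \<kappa> + 1 / real (Suc n)"
      unfolding \<kappa>_def using cInf_lessD[of S] \<open>C \<in> S\<close> by blast
    then have "measure M {s \<in> E. \<kappa> + 1 / real (Suc n) < x s} \<le> measure M {s \<in> E. \<beta> < x s}"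
      by (intro finite_measure_mono) auto
    then show ?thesis using \<beta>(1) by (simp add: S_def order_antisym)
  qed
  have down: "measure M {s \<in> E. x s < \<kappa> - 1 / real (Suc n)} = 0" for n
  proof -
    have "0 < 1 / real (Suc n)" by simp
    then have "\<kappa> - 1 / real (Suc n) \<notin> S" using cInf_lower[OF _ bdd] unfolding \<kappa>_def by fastforce
    then have "0 < measure M {s \<in> E. \<kappa> - 1 / real (Suc n) < x s}" by (simp add: S_def zero_less_measure_iff)
    then have "\<not> 0 < measure M {s \<in> E. x s < \<kappa> - 1 / real (Suc n)}" using no by blast
    then show ?thesis using measure_nonneg[of M "{s \<in> E. x s < \<kappa> - 1 / real (Suc n)}"] by linarith
  qed
  have ex: "\<exists>n. 1 / real (Suc n) < d" if "0 < d" for d :: real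
    using reals_Archimedean[OF that] by (simp add: inverse_eq_divide)
  have sub: "{s \<in> E. x s \<noteq> \<kappa>} \<subseteq> (\<Union>n. {s \<in> E. \<kappa> + 1 / real (Suc n) < x s}) \<union> (\<Union>n. {s \<in> E. x s < \<kappa> - 1 / real (Suc n)})"
  proof
    fix s assume s: "s \<in> {s \<in> E. x s \<noteq> \<kappa>}"
    then consider "0 < x s - \<kappa>" | "0 < \<kappa> - x s" by force
    then show "s \<in> (\<Union>n. {s \<in> E. \<kappa> + 1 / real (Suc n) < x s}) \<union> (\<Union>n. {s \<in> E. x s < \<kappa> - 1 / real (Suc n)})"
    proof cases
      case 1
      obtain n where "1 / real (Suc n) < x s - \<kappa>" using ex[OF 1] by blast
      then have "\<kappa> + 1 / real (Suc n) < x s" by linarith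
      then show ?thesis using s by blast
    next
      case 2
      obtain n where "1 / real (Suc n) < \<kappa> - x s" using ex[OF 2] by blast
      then have "x s < \<kappa> - 1 / real (Suc n)" by linarith
      then show ?thesis using s by blast
    qed
  qed
  have "(\<Union>n. {s \<in> E. \<kappa> + 1 / real (Suc n) < x s}) \<union> (\<Union>n. {s \<in> E. x s < \<kappa> - 1 / real (Suc n)}) \<in> null_sets M"
    using up down by (intro null_sets.Un null_sets_UN) (auto simp: null_sets_def emeasure_eq_measure simp del: of_nat_Suc)
  moreover have "{s \<in> E. x s \<noteq> \<kappa>} \<in> sets M"
  proof -
    have "{s \<in> E. x s \<noteq> \<kappa>} = {s \<in> E. x s < \<kappa>} \<union> {s \<in> E. \<kappa> < x s}" by auto
    then show ?thesis by simp
  qed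
  ultimately have "{s \<in> E. x s \<noteq> \<kappa>} \<in> null_sets M" using sub by (rule null_sets_subset)
  then show "\<exists>\<kappa>. measure M {s \<in> E. x s \<noteq> \<kappa>} = 0" by (intro exI[of _ \<kappa>]) (simp add: null_sets_def measure_def)
qed

context lorentz_weight
begin

section \<open>Circle norms and the deficit\<close>

definition circle_norm :: "(complex \<Rightarrow> complex) \<Rightarrow> real \<Rightarrow> ennreal" where
  "circle_norm f r = choquet circle_measure \<phi> (\<lambda>s. cmod (f (of_real r * cis s)))"

lemma continuous_on_circle:
  assumes "f holomorphic_on ball 0 1" "0 \<le> r" "r < 1"
  shows "continuous_on A (\<lambda>s. f (of_real r * cis s))"
  using assms(2,3) by (intro continuous_on_compose2[OF holomorphic_on_imp_continuous_on[OF assms(1)]] continuous_intros)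
    (auto simp: norm_mult)

lemma hardy_lorentz_norm_eq_SUP:
  assumes "f holomorphic_on ball 0 1"
  shows "hardy_lorentz_norm \<phi> f = (SUP r\<in>{0..<1}. circle_norm f r)"
  unfolding hardy_lorentz_norm_def circle_norm_def
  using assms by (intro SUP_cong refl lorentz_norm_eq_choquet continuous_intros continuous_on_circle) auto

lemma circle_norm_le_1:
  assumes "f \<in> hardy_lorentz_unit_ball \<phi>" "0 \<le> r" "r < 1"
  shows "circle_norm f r \<le> 1"
proof -
  have f: "f holomorphic_on ball 0 1" "hardy_lorentz_norm \<phi> f \<le> 1"
    using assms(1) by (auto simp: hardy_lorentz_unit_ball_def hardy_lorentz_def analytic_imp_holomorphic)
  have "circle_norm f r \<le> (SUP r\<in>{0..<1}. circle_norm f r)" using assms by (intro SUP_upper) auto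
  then show ?thesis using f(2) unfolding hardy_lorentz_norm_eq_SUP[OF f(1)] by simp
qed

lemma circle_norm_cmult:
  assumes "f holomorphic_on ball 0 1" "0 \<le> r" "r < 1" "\<And>w. w \<in> ball 0 1 \<Longrightarrow> cmod (g w) = k * cmod (f w)" "0 < k"
  shows "circle_norm g r = ennreal k * circle_norm f r"
proof -
  have "cmod (g (of_real r * cis s)) = k * cmod (f (of_real r * cis s))" for s
    using assms(2,3) by (intro assms(4)) (auto simp: norm_mult)
  then have "circle_norm g r = choquet circle_measure \<phi> (\<lambda>s. k * cmod (f (of_real r * cis s)))" by (simp add: circle_norm_def)
  also have "\<dots> = ennreal k * circle_norm f r" unfolding circle_norm_def
    using assms by (intro choquet_cmult continuous_imp_measurable_on_sets_lebesgue continuous_on_norm continuous_on_circle) auto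
  finally show ?thesis .
qed

lemma integral_circle_le:
  assumes "f holomorphic_on ball 0 1" "0 \<le> r" "r < 1" "circle_norm f r \<le> 1"
  shows "(\<integral>t. cmod (f (of_real r * cis t)) \<partial>circle_measure) \<le> 2*pi"
proof -
  have "continuous_on {0..2*pi} (\<lambda>t. cmod (f (of_real r * cis t)))"
    by (intro continuous_on_norm continuous_on_circle assms)
  from integral_le_choquet[OF this, of 1] assms(4) show ?thesis by (simp add: circle_norm_def)
qed

lemma midpoint_eq_endpoints:
  fixes f g h :: "complex \<Rightarrow> complex"
  assumes hol: "f holomorphic_on ball 0 1" "g holomorphic_on ball 0 1" "h holomorphic_on ball 0 1"
    and sup: "(SUP r\<in>{0..<1}. circle_norm f r) = 1"
    and le1: "\<And>r. 0 \<le> r \<Longrightarrow> r < 1 \<Longrightarrow> circle_norm g r \<le> 1" "\<And>r. 0 \<le> r \<Longrightarrow> r < 1 \<Longrightarrow> circle_norm h r \<le> 1"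
    and mid: "\<And>w. w \<in> ball 0 1 \<Longrightarrow> f w = (g w + h w) / 2"
    and E: "E \<in> sets lebesgue" "E \<subseteq> {0..2*pi}" "0 < emeasure lebesgue E"
    and const: "\<And>t. t \<in> E \<Longrightarrow> cmod (boundary_value f t) = c"
    and w: "w \<in> ball 0 1"
  shows "g w = h w"
proof -
  let ?N = "choquet circle_measure \<phi>"
  define \<rho> where "\<rho> = (\<lambda>n. 1 - 1 / real (n + 2))"
  have \<rho>: "0 \<le> \<rho> n" "0 < \<rho> n" "\<rho> n < 1" "\<rho> \<longlonglongrightarrow> 1" for n
    unfolding \<rho>_def by (rule approach_radius)+
  have inball: "of_real (\<rho> n) * cis s \<in> ball 0 1" for n s
    using \<rho>(1)[of n] \<rho>(3)[of n] by (simp add: norm_mult)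
  have mid2: "2 * f w = g w + h w" if "w \<in> ball 0 1" for w
    using mid[OF that] by (simp add: field_simps)
  have f_le1: "circle_norm f r \<le> 1" if "0 \<le> r" "r < 1" for r
    unfolding sup[symmetric] using that by (intro SUP_upper) auto
  define bad where "bad = (\<lambda>f. {t\<in>{0..2*pi}. \<not> (\<exists>L. has_nontangential_limit f (cis t) L)})"
  define Bad where "Bad = bad f \<union> bad g \<union> bad h"
  have "negligible (bad f)" "negligible (bad g)" "negligible (bad h)"
    unfolding bad_def using integral_circle_le hol f_le1 le1 by (blast intro: H1_nontangential_limit_ae)+
  then have Badn: "negligible Bad" unfolding Bad_def by (intro negligible_Un)
  have lim: "(\<lambda>n. u (of_real (\<rho> n) * cis t)) \<longlonglongrightarrow> boundary_value u t" if "t \<in> {0..2*pi}" "t \<notin> bad u" for u t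
  proof -
    have "\<exists>L. has_nontangential_limit u (cis t) L" using that unfolding bad_def by simp
    then obtain L where L: "has_nontangential_limit u (cis t) L" by blast
    then have "boundary_value u t = L"
      unfolding boundary_value_def by (rule the_equality) (rule has_nontangential_limit_unique[OF _ _ L], simp)
    then show ?thesis using has_nontangential_limit_radial[OF L] by (simp add: \<rho>_def)
  qed
  define F where "F = boundary_value f"
  define G where "G = boundary_value g"
  define H where "H = boundary_value h"
  have limF: "(\<lambda>n. f (of_real (\<rho> n) * cis t)) \<longlonglongrightarrow> F t" and limG: "(\<lambda>n. g (of_real (\<rho> n) * cis t)) \<longlonglongrightarrow> G t"
    and limH: "(\<lambda>n. h (of_real (\<rho> n) * cis t)) \<longlonglongrightarrow> H t" if "t \<in> {0..2*pi} - Bad" for t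
    using that lim unfolding F_def G_def H_def Bad_def by auto
  have FGH: "2 * F t = G t + H t" if "t \<in> {0..2*pi} - Bad" for t
  proof (rule LIMSEQ_unique)
    show "(\<lambda>n. 2 * f (of_real (\<rho> n) * cis t)) \<longlonglongrightarrow> 2 * F t" by (intro tendsto_intros limF that)
    have "(\<lambda>n. g (of_real (\<rho> n) * cis t) + h (of_real (\<rho> n) * cis t)) \<longlonglongrightarrow> G t + H t"
      by (intro tendsto_intros limG limH that)
    moreover have "2 * f (of_real (\<rho> n) * cis t) = g (of_real (\<rho> n) * cis t) + h (of_real (\<rho> n) * cis t)" for n
      by (rule mid2[OF inball])
    ultimately show "(\<lambda>n. 2 * f (of_real (\<rho> n) * cis t)) \<longlonglongrightarrow> G t + H t" by (simp only:)
  qed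

  define xn where "xn = (\<lambda>n s. cmod (g (of_real (\<rho> n) * cis s)))"
  define yn where "yn = (\<lambda>n s. cmod (h (of_real (\<rho> n) * cis s)))"
  \<comment> \<open>By \<open>mid2\<close> this is |g + h| on the circle, to be compared with
    \<open>xn\<close> plus \<open>yn\<close>.\<close>
  define bn where "bn = (\<lambda>n s. 2 * cmod (f (of_real (\<rho> n) * cis s)))"
  have xyc: "continuous_on A (xn n)" "continuous_on A (yn n)" "continuous_on A (bn n)" for n A
    unfolding xn_def yn_def bn_def
    by (intro continuous_on_norm continuous_on_mult continuous_on_const continuous_on_circle[OF hol(1) \<rho>(1,3)]
        continuous_on_circle[OF hol(2) \<rho>(1,3)] continuous_on_circle[OF hol(3) \<rho>(1,3)])+
  have [measurable]: "xn n \<in> borel_measurable circle_measure" "yn n \<in> borel_measurable circle_measure" "bn n \<in> borel_measurable circle_measure" for n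
    by (intro continuous_imp_measurable_on_sets_lebesgue xyc; simp)+
  have bn_le: "bn n s \<le> xn n s + yn n s" for n s
  proof -
    have "bn n s = cmod (2 * f (of_real (\<rho> n) * cis s))" by (simp add: bn_def norm_mult)
    also have "\<dots> \<le> xn n s + yn n s" unfolding mid2[OF inball] xn_def yn_def by (rule norm_triangle_ineq)
    finally show ?thesis .
  qed
  have xy0: "0 \<le> xn n s" "0 \<le> yn n s" for n s by (auto simp: xn_def yn_def)
  have bdd: "\<exists>C. \<forall>s\<in>{0..2*pi}. xn n s \<le> C \<and> yn n s \<le> C" for n
  proof -
    obtain C1 where C1: "\<And>s. s \<in> {0..2*pi} \<Longrightarrow> xn n s \<le> C1"
      using continuous_attains_sup[OF compact_Icc _ xyc(1)[of "{0..2*pi}" n]] by fastforce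
    obtain C2 where C2: "\<And>s. s \<in> {0..2*pi} \<Longrightarrow> yn n s \<le> C2"
      using continuous_attains_sup[OF compact_Icc _ xyc(2)[of "{0..2*pi}" n]] by fastforce
    show ?thesis using C1 C2 by (intro exI[of _ "max C1 C2"]) (auto simp: le_max_iff_disj)
  qed
  have Nxy: "?N (xn n) + ?N (yn n) \<le> 2" for n
  proof -
    have "?N (xn n) + ?N (yn n) \<le> 1 + 1"
      using le1[OF \<rho>(1,3)] unfolding circle_norm_def xn_def yn_def by (intro add_mono) auto
    then show ?thesis by simp
  qed
  \<comment> \<open>Circle norms increase with the radius and those of f have supremum 1, so they
    eventually exceed 1 - d/2. Together with \<open>Nxy\<close>, the norms of \<open>xn\<close> and
    \<open>yn\<close> add up to less than the norm of \<open>bn\<close> plus d.\<close>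
  have deficit: "\<forall>\<^sub>F n in sequentially. 2 < ?N (bn n) + ennreal d" if d: "0 < d" for d
  proof -
    have "ennreal (1 - d/2) < 1" using d by (simp add: ennreal_less_iff ennreal_lessI flip: ennreal_1)
    then obtain r where r: "0 \<le> r" "r < 1" "ennreal (1 - d/2) < circle_norm f r"
      unfolding sup[symmetric] less_SUP_iff by auto
    have "\<forall>\<^sub>F n in sequentially. r < \<rho> n" using \<rho>(4) r(2) by (rule order_tendstoD)
    then show ?thesis
    proof eventually_elim
      case (elim n)
      have "circle_norm f r \<le> circle_norm f (\<rho> n)"
        unfolding circle_norm_def by (rule choquet_circle_mono[OF hol(1) r(1) elim \<rho>(3)])
      then have 1: "ennreal (1 - d/2) < circle_norm f (\<rho> n)" using r(3) by simp
      have "?N (bn n) = ennreal 2 * circle_norm f (\<rho> n)"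
        unfolding circle_norm_def bn_def
        by (intro choquet_cmult continuous_imp_measurable_on_sets_lebesgue continuous_on_norm continuous_on_circle[OF hol(1) \<rho>(1,3)]) auto
      moreover obtain a where a: "circle_norm f (\<rho> n) = ennreal a" "0 \<le> a"
        using f_le1[OF \<rho>(1,3), of n] by (cases "circle_norm f (\<rho> n)") (auto simp: top_unique)
      moreover have "1 - d/2 < a"
      proof (rule ccontr)
        assume "\<not> 1 - d/2 < a"
        then have "ennreal a \<le> ennreal (1 - d/2)" by (intro ennreal_leI) simp
        then show False using 1 a(1) by simp
      qed
      ultimately have "?N (bn n) + ennreal d = ennreal (2 * a + d)" using d by (simp add: ennreal_mult[symmetric] flip: ennreal_numeral)
      moreover have "2 < 2 * a + d" using \<open>1 - d/2 < a\<close> by simp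
      ultimately show ?case by (simp add: ennreal_less_iff flip: ennreal_numeral)
    qed
  qed

  \<comment> \<open>\<open>boundary_value\<close> is under control only off \<open>Bad\<close>; the
    value 0 there makes these functions pointwise limits of measurable ones.\<close>
  define x where "x = (\<lambda>t. if t \<in> Bad then 0 else cmod (G t))"
  define y where "y = (\<lambda>t. if t \<in> Bad then 0 else cmod (H t))"
  define b where "b = (\<lambda>t. if t \<in> Bad then 0 else 2 * cmod (F t))"
  have Badm: "{t \<in> space circle_measure. t \<in> Bad} \<in> sets circle_measure"
  proof -
    have "Bad \<in> sets lebesgue" using Badn by (auto simp: negligible_iff_null_sets)
    moreover have "Bad \<subseteq> {0..2*pi}" by (auto simp: Bad_def bad_def)
    ultimately have "Bad \<in> sets circle_measure" by (simp add: sets_restrict_space_iff)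
    moreover have "{t \<in> space circle_measure. t \<in> Bad} = Bad" using \<open>Bad \<subseteq> {0..2*pi}\<close> by auto
    ultimately show ?thesis by (simp only:)
  qed
  have lims: "(\<lambda>n. xn n t) \<longlonglongrightarrow> x t" "(\<lambda>n. yn n t) \<longlonglongrightarrow> y t" "(\<lambda>n. bn n t) \<longlonglongrightarrow> b t" if "t \<in> {0..2*pi} - Bad" for t
    using limF[OF that] limG[OF that] limH[OF that] that
    by (auto simp: x_def y_def b_def xn_def yn_def bn_def intro!: tendsto_intros)
  have meas_lim: "u \<in> borel_measurable circle_measure"
    if un: "\<And>n. un n \<in> borel_measurable circle_measure" "\<And>t. t \<in> {0..2*pi} - Bad \<Longrightarrow> (\<lambda>n. un n t) \<longlonglongrightarrow> u t"
      "\<And>t. t \<in> Bad \<Longrightarrow> u t = 0" for un and u :: "real \<Rightarrow> real"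
  proof (rule borel_measurable_LIMSEQ_real)
    show "(\<lambda>t. if t \<in> Bad then 0 else un n t) \<in> borel_measurable circle_measure" for n
      by (intro measurable_If un Badm) auto
    show "(\<lambda>n. if t \<in> Bad then 0 else un n t) \<longlonglongrightarrow> u t" if "t \<in> space circle_measure" for t
      using un(2,3) that by (cases "t \<in> Bad") auto
  qed
  have xm [measurable]: "x \<in> borel_measurable circle_measure"
    by (rule meas_lim[of xn]) (use lims in \<open>auto simp: x_def\<close>)
  have [measurable]: "y \<in> borel_measurable circle_measure"
    by (rule meas_lim[of yn]) (use lims in \<open>auto simp: y_def\<close>)
  have [measurable]: "b \<in> borel_measurable circle_measure"
    by (rule meas_lim[of bn]) (use lims in \<open>auto simp: b_def\<close>)
  have offBad: "measure circle_measure (A - Bad) = measure circle_measure A" "A - Bad \<in> sets circle_measure"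
    if A: "A \<in> sets circle_measure" for A
  proof -
    have AS: "A \<in> sets lebesgue" "A \<subseteq> {0..2*pi}" using A by (auto simp: sets_restrict_space_iff)
    have BS: "Bad \<in> null_sets lebesgue" using Badn by (simp add: negligible_iff_null_sets)
    have "A - Bad \<in> sets lebesgue" using AS(1) null_setsD2[OF BS] by (rule sets.Diff)
    then show 1: "A - Bad \<in> sets circle_measure" using AS by (auto simp: sets_restrict_space_iff)
    show "measure circle_measure (A - Bad) = measure circle_measure A"
      using AS BS \<open>A - Bad \<in> sets lebesgue\<close> measure_circle_eq[of A] measure_circle_eq[of "A - Bad"]
      by (simp add: measure_Diff_null_set subset_iff)
  qed

  have nonempty: "A \<noteq> {}" if "0 < measure circle_measure A" for A
    using that by (cases "A = {}") simp_all
  \<comment> \<open>If a level q and a margin 1 / (k + 1) separated |g + h| from |g| + |h| on a set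
    of positive measure, they would do so on circles near the boundary for at least half of that
    measure, and \<open>choquet_gap_mono\<close> would yield a fixed amount contradicting
    \<open>deficit\<close>.\<close>
  have noD: "measure circle_measure {s \<in> space circle_measure. b s < q \<and> q + 1 / real (Suc k) < x s + y s} = 0" (is "measure _ ?A = 0") for q k
  proof (rule ccontr)
    assume "measure circle_measure ?A \<noteq> 0"
    then have pos: "0 < measure circle_measure ?A" by (simp add: zero_less_measure_iff)
    define \<eta> where "\<eta> = measure circle_measure ?A / 2"
    have \<eta>: "0 < \<eta>" using pos by (simp add: \<eta>_def)
    have Am: "?A \<in> sets circle_measure" by measurable
    have "?A \<noteq> {}" by (rule nonempty[OF pos])
    then obtain s0 where "b s0 < q" by blast
    moreover have "0 \<le> b s0" by (simp add: b_def)
    ultimately have q: "0 \<le> q" by linarith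
    obtain \<delta> where \<delta>: "0 < \<delta>" "\<And>c. 0 \<le> c \<Longrightarrow> c + \<eta> \<le> 2*pi \<Longrightarrow> \<phi> c + \<delta> \<le> \<phi> (c + \<eta>)"
      using weight_increment_bound[OF \<eta>] by blast
    have "\<forall>\<^sub>F n in sequentially. \<eta> \<le> measure circle_measure {s \<in> space circle_measure. q + 1 / real (Suc k) < xn n s + yn n s \<and> bn n s \<le> q}"
    proof (rule eventually_measure_ge[OF offBad(2)[OF Am]])
      show "\<eta> < measure circle_measure (?A - Bad)" unfolding offBad(1)[OF Am] using pos by (simp add: \<eta>_def)
      show "{s \<in> space circle_measure. q + 1 / real (Suc k) < xn n s + yn n s \<and> bn n s \<le> q} \<in> sets circle_measure" for n by measurable
      fix s assume s: "s \<in> ?A - Bad"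
      then have s': "s \<in> {0..2*pi} - Bad" by simp
      have "\<forall>\<^sub>F n in sequentially. q + 1 / real (Suc k) < xn n s + yn n s"
        using s by (intro order_tendstoD(1)[OF tendsto_add[OF lims(1,2)[OF s']]]) auto
      moreover have "\<forall>\<^sub>F n in sequentially. bn n s < q"
        using s by (intro order_tendstoD(2)[OF lims(3)[OF s']]) auto
      ultimately show "\<forall>\<^sub>F n in sequentially. q + 1 / real (Suc k) < xn n s + yn n s \<and> bn n s \<le> q"
        by eventually_elim auto
    qed
    moreover have "\<forall>\<^sub>F n in sequentially. 2 < ?N (bn n) + ennreal (1 / real (Suc k) * \<delta>)"
      using \<delta>(1) by (intro deficit) simp
    ultimately have "\<forall>\<^sub>F n in sequentially. False"
    proof eventually_elim
      case (elim n)
      obtain C where C: "\<forall>s\<in>{0..2*pi}. xn n s \<le> C \<and> yn n s \<le> C" using bdd by blast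
      have "?N (bn n) + ennreal (1 / real (Suc k) * \<delta>) \<le> ?N (\<lambda>s. xn n s + yn n s)"
        using bn_le q \<eta> elim(1) \<delta> by (intro choquet_gap_mono[of _ _ q _ \<eta>]) auto
      also have "\<dots> \<le> ?N (xn n) + ?N (yn n)" using xy0 C by (intro choquet_add[where C = C]) auto
      also have "\<dots> \<le> 2" by (rule Nxy)
      finally show ?case using elim(2) by simp
    qed
    then show False by simp
  qed
  define D where "D = {s \<in> space circle_measure. b s < x s + y s}"
  have Dm: "D \<in> sets circle_measure" unfolding D_def by measurable
  have Dn: "measure circle_measure D = 0"
  proof -
    have cnt: "countable (\<rat> \<times> (UNIV :: nat set) :: (real \<times> nat) set)" by (intro countable_SIGMA countable_rat) auto
    have nul: "{s \<in> space circle_measure. b s < q \<and> q + 1 / real (Suc k) < x s + y s} \<in> null_sets circle_measure" for q k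
      by (rule null_setsI) (unfold emeasure_eq_measure noD, simp, measurable)
    have nl: "(\<Union>p\<in>\<rat> \<times> UNIV. {s \<in> space circle_measure. b s < fst p \<and> fst p + 1 / real (Suc (snd p)) < x s + y s}) \<in> null_sets circle_measure"
      by (rule null_sets_UN'[OF cnt]) (rule nul)
    have sub: "D \<subseteq> (\<Union>p\<in>\<rat> \<times> UNIV. {s \<in> space circle_measure. b s < fst p \<and> fst p + 1 / real (Suc (snd p)) < x s + y s})"
    proof
      fix s assume s: "s \<in> D"
      then have "b s < x s + y s" by (simp add: D_def)
      then obtain q where q: "q \<in> \<rat>" "b s < q" "q < x s + y s" using Rats_dense_in_real by blast
      obtain k where "inverse (real (Suc k)) < x s + y s - q" using reals_Archimedean[of "x s + y s - q"] q by auto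
      then have "q + 1 / real (Suc k) < x s + y s" by (simp add: inverse_eq_divide)
      then show "s \<in> (\<Union>p\<in>\<rat> \<times> UNIV. {s \<in> space circle_measure. b s < fst p \<and> fst p + 1 / real (Suc (snd p)) < x s + y s})"
        using q s by (intro UN_I[of "(q, k)"]) (auto simp: D_def simp del: of_nat_Suc)
    qed
    have "D \<in> null_sets circle_measure" by (rule null_sets_subset[OF nl Dm sub])
    then show ?thesis by (simp add: null_sets_def measure_def)
  qed

  define E' where "E' = (E - D) - Bad"
  have Ec: "E \<in> sets circle_measure" using E by (simp add: sets_restrict_space_iff)
  have EDc: "E - D \<in> sets circle_measure" using Ec Dm by (rule sets.Diff)
  have E'm: "E' \<in> sets circle_measure" unfolding E'_def by (rule offBad(2)[OF EDc])
  have Epos: "0 < measure circle_measure E"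
  proof -
    have "0 < emeasure circle_measure E" using E by (simp add: emeasure_restrict_space)
    then show ?thesis by (simp add: emeasure_eq_measure)
  qed
  have E'pos: "0 < measure circle_measure E'"
  proof -
    have "measure circle_measure E \<le> measure circle_measure ((E - D) \<union> D)"
      by (rule finite_measure_mono[OF _ sets.Un[OF EDc Dm]]) auto
    also have "\<dots> \<le> measure circle_measure (E - D) + measure circle_measure D"
      using EDc Dm by (rule measure_Un_le)
    finally show ?thesis using Dn Epos unfolding E'_def offBad(1)[OF EDc] by simp
  qed
  have E'sub: "s \<in> {0..2*pi} - Bad" "s \<in> E" "s \<notin> D" "s \<notin> Bad" if "s \<in> E'" for s using that E(2) by (auto simp: E'_def)
  have E'cut: "E' \<inter> {s \<in> space circle_measure. P s} \<in> sets circle_measure" if "Measurable.pred circle_measure P" for P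
    using that by (intro sets.Int E'm) (simp add: pred_def)
  have emE: "0 < emeasure lebesgue A" "A \<in> sets lebesgue" "A \<subseteq> {0..2*pi}"
    if "A \<in> sets circle_measure" "0 < measure circle_measure A" for A
  proof -
    show A: "A \<in> sets lebesgue" "A \<subseteq> {0..2*pi}" using that(1) by (auto simp: sets_restrict_space_iff)
    have "0 < measure lebesgue A" using that(2) measure_circle_eq[OF A] by simp
    then have "emeasure lebesgue A \<noteq> 0" unfolding measure_def by force
    then show "0 < emeasure lebesgue A" unfolding zero_less_iff_neq_zero .
  qed
  have xyE: "x s + y s = 2 * c" "b s = 2 * c" if s: "s \<in> E'" for s
  proof -
    show b: "b s = 2 * c" using const[of s] E'sub[OF s] by (simp add: b_def F_def)
    have "x s + y s \<le> b s" using E'sub[OF s] by (auto simp: D_def)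
    moreover have "b s \<le> x s + y s"
    proof -
      have "b s = cmod (2 * F s)" using E'sub(4)[OF s] by (simp add: b_def norm_mult)
      also have "\<dots> \<le> x s + y s"
        unfolding FGH[OF E'sub(1)[OF s]] x_def y_def using E'sub(4)[OF s] norm_triangle_ineq[of "G s" "H s"] by simp
      finally show ?thesis .
    qed
    ultimately show "x s + y s = 2 * c" using b by simp
  qed
  have xy_nonneg: "0 \<le> x s" "0 \<le> y s" for s by (auto simp: x_def y_def)
  \<comment> \<open>For c = 0 the function f would vanish on a boundary set of positive measure,
    hence in the whole disc, against norm 1. The division by c below depends on this.\<close>
  have c0: "0 < c"
  proof (rule ccontr)
    assume "\<not> 0 < c"
    have "F s = 0" if s: "s \<in> E'" for s
      using xyE(2)[OF s] E'sub[OF s] \<open>\<not> 0 < c\<close> norm_ge_zero[of "F s"] by (simp add: b_def)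
    then have "f w = 0" if "w \<in> ball 0 1" for w
      using limF[OF E'sub(1)] that
      by (intro H1_boundary_uniqueness[OF hol(1) integral_circle_le[OF hol(1) _ _ f_le1] emE(2,3,1)[OF E'm E'pos]]) (auto simp: \<rho>_def)
    then have "circle_norm f r = 0" if "0 \<le> r" "r < 1" for r
      unfolding circle_norm_def using that choquet_const[of 0] by (simp add: norm_mult)
    then show False using sup by simp
  qed
  obtain \<kappa> where \<kappa>: "measure circle_measure {s \<in> E'. x s \<noteq> \<kappa>} = 0"
  proof -
    \<comment> \<open>On \<open>E'\<close> the sum x + y is 2 c, so x above \<alpha> means y below
      \<sigma> = 2 c - \<alpha> and vice versa. A split of x is thus an opposite ordering of x and
      y, which \<open>choquet_gap_add\<close> turns into a fixed deficit.\<close>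
    have nosplit: False if \<alpha>: "0 < measure circle_measure {s \<in> E'. \<alpha> < x s}" "0 < measure circle_measure {s \<in> E'. x s < \<alpha>}" for \<alpha>
    proof -
      define A1 where "A1 = (\<lambda>k. {s \<in> E'. \<alpha> + 1 / real (Suc k) < x s})"
      define A2 where "A2 = (\<lambda>k. {s \<in> E'. x s < \<alpha> - 1 / real (Suc k)})"
      have E's: "E' \<subseteq> space circle_measure" using E'm by (rule sets.sets_into_space)
      have Am: "A1 k \<in> sets circle_measure" "A2 k \<in> sets circle_measure" for k
      proof -
        have "A1 k = E' \<inter> {s \<in> space circle_measure. \<alpha> + 1 / real (Suc k) < x s}" "A2 k = E' \<inter> {s \<in> space circle_measure. x s < \<alpha> - 1 / real (Suc k)}"
          using E's by (auto simp: A1_def A2_def)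
        then show "A1 k \<in> sets circle_measure" "A2 k \<in> sets circle_measure"
          by (simp_all only:) (rule E'cut; measurable)+
      qed
      have ex: "\<exists>n. 1 / real (Suc n) < d" if "0 < d" for d :: real
        using reals_Archimedean[OF that] by (simp add: inverse_eq_divide)
      have "{s \<in> E'. \<alpha> < x s} = (\<Union>k. A1 k)"
      proof (intro equalityI subsetI)
        fix s assume s: "s \<in> {s \<in> E'. \<alpha> < x s}"
        then obtain n where "1 / real (Suc n) < x s - \<alpha>" using ex[of "x s - \<alpha>"] by auto
        then have "\<alpha> + 1 / real (Suc n) < x s" by linarith
        then show "s \<in> (\<Union>k. A1 k)" using s unfolding A1_def by blast
      next
        fix s assume "s \<in> (\<Union>k. A1 k)"
        then obtain k where k: "s \<in> E'" "\<alpha> + 1 / real (Suc k) < x s" unfolding A1_def by blast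
        moreover have "0 < 1 / real (Suc k)" by simp
        ultimately have "\<alpha> < x s" by linarith
        then show "s \<in> {s \<in> E'. \<alpha> < x s}" using k(1) by blast
      qed
      then obtain k1 where k1: "0 < measure circle_measure (A1 k1)"
        using measure_pos_countable_UN[of A1] \<alpha>(1) Am by auto
      have "{s \<in> E'. x s < \<alpha>} = (\<Union>k. A2 k)"
      proof (intro equalityI subsetI)
        fix s assume s: "s \<in> {s \<in> E'. x s < \<alpha>}"
        then obtain n where "1 / real (Suc n) < \<alpha> - x s" using ex[of "\<alpha> - x s"] by auto
        then have "x s < \<alpha> - 1 / real (Suc n)" by linarith
        then show "s \<in> (\<Union>k. A2 k)" using s unfolding A2_def by blast
      next
        fix s assume "s \<in> (\<Union>k. A2 k)"
        then obtain k where k: "s \<in> E'" "x s < \<alpha> - 1 / real (Suc k)" unfolding A2_def by blast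
        moreover have "0 < 1 / real (Suc k)" by simp
        ultimately have "x s < \<alpha>" by linarith
        then show "s \<in> {s \<in> E'. x s < \<alpha>}" using k(1) by blast
      qed
      then obtain k2 where k2: "0 < measure circle_measure (A2 k2)"
        using measure_pos_countable_UN[of A2] \<alpha>(2) Am by auto
      define e where "e = min (1 / real (Suc k1)) (1 / real (Suc k2))"
      have e: "0 < e" "e \<le> 1 / real (Suc k1)" "e \<le> 1 / real (Suc k2)" by (simp_all add: e_def)
      define \<sigma> where "\<sigma> = 2 * c - \<alpha>"
      define \<eta> where "\<eta> = min (measure circle_measure (A1 k1)) (measure circle_measure (A2 k2)) / 2"
      have \<eta>: "0 < \<eta>" "\<eta> < measure circle_measure (A1 k1)" "\<eta> < measure circle_measure (A2 k2)"
        using k1 k2 by (auto simp: \<eta>_def)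
      have A1D: "s \<in> {0..2*pi} - Bad" "\<alpha> + e < x s" "y s < \<sigma>" if "s \<in> A1 k1" for s
      proof -
        have s: "s \<in> E'" "\<alpha> + 1 / real (Suc k1) < x s" using that unfolding A1_def by blast+
        show "s \<in> {0..2*pi} - Bad" by (rule E'sub(1)[OF s(1)])
        show "\<alpha> + e < x s" "y s < \<sigma>" using s(2) e xyE(1)[OF s(1)] unfolding \<sigma>_def by linarith+
      qed
      have A2D: "s \<in> {0..2*pi} - Bad" "x s < \<alpha>" "\<sigma> + e < y s" if "s \<in> A2 k2" for s
      proof -
        have s: "s \<in> E'" "x s < \<alpha> - 1 / real (Suc k2)" using that unfolding A2_def by blast+
        show "s \<in> {0..2*pi} - Bad" by (rule E'sub(1)[OF s(1)])
        show "x s < \<alpha>" "\<sigma> + e < y s" using s(2) e xyE(1)[OF s(1)] unfolding \<sigma>_def by linarith+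
      qed
      have "A1 k1 \<noteq> {}" "A2 k2 \<noteq> {}" by (rule nonempty[OF k1], rule nonempty[OF k2])
      then obtain s1 s2 where "s1 \<in> A1 k1" "s2 \<in> A2 k2" by blast
      then have \<alpha>\<sigma>: "0 \<le> \<alpha>" "0 \<le> \<sigma>" using A1D(3)[of s1] A2D(2)[of s2] xy_nonneg[of s1] xy_nonneg[of s2] by linarith+
      obtain \<delta> where \<delta>: "0 < \<delta>" "\<And>c. 0 \<le> c \<Longrightarrow> c + 2 * \<eta> \<le> 2*pi \<Longrightarrow> \<phi> (c + 2 * \<eta>) + \<phi> c + \<delta> \<le> 2 * \<phi> (c + \<eta>)"
        using weight_second_difference_bound[OF \<eta>(1)] by blast
      have "\<forall>\<^sub>F n in sequentially. \<eta> \<le> measure circle_measure {s \<in> space circle_measure. \<alpha> + e < xn n s \<and> yn n s \<le> \<sigma>}"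
      proof (rule eventually_measure_ge[OF Am(1) \<eta>(2)])
        show "{s \<in> space circle_measure. \<alpha> + e < xn n s \<and> yn n s \<le> \<sigma>} \<in> sets circle_measure" for n by measurable
        fix s assume s: "s \<in> A1 k1"
        have "\<forall>\<^sub>F n in sequentially. \<alpha> + e < xn n s" "\<forall>\<^sub>F n in sequentially. yn n s < \<sigma>"
          by (rule order_tendstoD(1)[OF lims(1)[OF A1D(1)[OF s]] A1D(2)[OF s]], rule order_tendstoD(2)[OF lims(2)[OF A1D(1)[OF s]] A1D(3)[OF s]])
        then show "\<forall>\<^sub>F n in sequentially. \<alpha> + e < xn n s \<and> yn n s \<le> \<sigma>" by eventually_elim auto
      qed
      moreover have "\<forall>\<^sub>F n in sequentially. \<eta> \<le> measure circle_measure {s \<in> space circle_measure. xn n s \<le> \<alpha> \<and> \<sigma> + e < yn n s}"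
      proof (rule eventually_measure_ge[OF Am(2) \<eta>(3)])
        show "{s \<in> space circle_measure. xn n s \<le> \<alpha> \<and> \<sigma> + e < yn n s} \<in> sets circle_measure" for n by measurable
        fix s assume s: "s \<in> A2 k2"
        have "\<forall>\<^sub>F n in sequentially. xn n s < \<alpha>" "\<forall>\<^sub>F n in sequentially. \<sigma> + e < yn n s"
          by (rule order_tendstoD(2)[OF lims(1)[OF A2D(1)[OF s]] A2D(2)[OF s]], rule order_tendstoD(1)[OF lims(2)[OF A2D(1)[OF s]] A2D(3)[OF s]])
        then show "\<forall>\<^sub>F n in sequentially. xn n s \<le> \<alpha> \<and> \<sigma> + e < yn n s" by eventually_elim auto
      qed
      moreover have "\<forall>\<^sub>F n in sequentially. 2 < ?N (bn n) + ennreal (e * \<delta>)"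
        using \<delta>(1) e(1) by (intro deficit) simp
      ultimately have "\<forall>\<^sub>F n in sequentially. False"
      proof eventually_elim
        case (elim n)
        obtain C where C: "\<forall>s\<in>{0..2*pi}. xn n s \<le> C \<and> yn n s \<le> C" using bdd by blast
        have "?N (bn n) + ennreal (e * \<delta>) \<le> ?N (\<lambda>s. xn n s + yn n s) + ennreal (e * \<delta>)"
          using bn_le by (intro add_right_mono choquet_mono) auto
        also have "\<dots> \<le> ?N (xn n) + ?N (yn n)"
          using xy0 C \<alpha>\<sigma> e(1) \<eta>(1) elim(1,2) \<delta> by (intro choquet_gap_add[where C = C and \<alpha> = \<alpha> and \<sigma> = \<sigma> and \<eta> = \<eta>]) auto
        also have "\<dots> \<le> 2" by (rule Nxy)
        finally show ?case using elim(3) by simp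
      qed
      then show False by simp
    qed
    have xle: "x s \<le> 2 * c" if "s \<in> E'" for s using xyE(1)[OF that] xy_nonneg[of s] by linarith
    show thesis
      using ae_constant_or_split[OF xm E'm E'pos xy_nonneg(1) xle] nosplit that by blast
  qed
  define E2 where "E2 = {s \<in> E'. x s = \<kappa>}"
  have E's: "E' \<subseteq> space circle_measure" using E'm by (rule sets.sets_into_space)
  have m2: "E2 \<in> sets circle_measure" "{s \<in> E'. x s \<noteq> \<kappa>} \<in> sets circle_measure"
  proof -
    have "E2 = E' \<inter> {s \<in> space circle_measure. x s = \<kappa>}" "{s \<in> E'. x s \<noteq> \<kappa>} = E' \<inter> {s \<in> space circle_measure. x s \<noteq> \<kappa>}"
      using E's by (auto simp: E2_def)
    then show "E2 \<in> sets circle_measure" "{s \<in> E'. x s \<noteq> \<kappa>} \<in> sets circle_measure"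
      by (simp_all only:) (rule E'cut; measurable)+
  qed
  have E2pos: "0 < measure circle_measure E2"
  proof -
    have eq: "E2 \<union> {s \<in> E'. x s \<noteq> \<kappa>} = E'" by (auto simp: E2_def)
    have "measure circle_measure E' \<le> measure circle_measure E2 + measure circle_measure {s \<in> E'. x s \<noteq> \<kappa>}"
      using measure_Un_le[OF m2] unfolding eq .
    then show ?thesis using E'pos \<kappa> by simp
  qed
  \<comment> \<open>On \<open>E2\<close> the moduli of g and f have the constant values \<kappa> and
    c.\<close>
  define k where "k = \<kappa> / c"
  have "E2 \<noteq> {}" by (rule nonempty[OF E2pos])
  then obtain s0 where "s0 \<in> E2" by blast
  then have k: "0 \<le> k" "k \<le> 2"
    using xyE(1)[of s0] xy_nonneg[of s0] c0 by (auto simp: E2_def k_def divide_le_eq)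
  have Gk: "G s = of_real k * F s" if s: "s \<in> E2" for s
  proof -
    have s': "s \<in> E'" "x s = \<kappa>" using s by (auto simp: E2_def)
    have n: "cmod (G s) = \<kappa>" "cmod (H s) = 2 * c - \<kappa>" "cmod (F s) = c"
      using s' xyE[OF s'(1)] E'sub(4)[OF s'(1)] by (auto simp: x_def y_def b_def)
    have sum: "2 * F s = G s + H s" by (rule FGH[OF E'sub(1)[OF s'(1)]])
    \<comment> \<open>Equality in the triangle inequality puts G and H on one ray, and G + H = 2 F
      then makes G a real multiple of F.\<close>
    have "cmod (G s + H s) = cmod (G s) + cmod (H s)" unfolding sum[symmetric] using n by (simp add: norm_mult)
    then have "cmod (G s) *\<^sub>R H s = cmod (H s) *\<^sub>R G s" by (simp only: norm_triangle_eq)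
    then have "of_real \<kappa> * H s = of_real (2 * c - \<kappa>) * G s" unfolding n by (simp add: scaleR_conv_of_real)
    moreover have "H s = 2 * F s - G s" using sum by (simp add: algebra_simps)
    ultimately have "of_real \<kappa> * (2 * F s) = of_real (2 * c) * G s" by (simp add: algebra_simps)
    then have "of_real c * G s = of_real \<kappa> * F s" by simp
    then show ?thesis unfolding k_def using c0 by (simp add: field_simps)
  qed
  have gk: "g w = of_real k * f w" if w: "w \<in> ball 0 1" for w
  proof -
    have "(\<lambda>w. g w - of_real k * f w) w = 0"
    proof (rule H1_boundary_uniqueness[where M = "2*pi + k * (2*pi)", OF _ _ emE(2,3,1)[OF m2(1) E2pos] _ w])
      show "(\<lambda>w. g w - of_real k * f w) holomorphic_on ball 0 1" by (intro holomorphic_intros hol)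
      fix r :: real assume r: "0 \<le> r" "r < 1"
      have int: "integrable circle_measure (\<lambda>t. cmod (g (of_real r * cis t)))" "integrable circle_measure (\<lambda>t. cmod (f (of_real r * cis t)))"
        "integrable circle_measure (\<lambda>t. cmod (g (of_real r * cis t) - of_real k * f (of_real r * cis t)))"
        by (intro continuous_imp_integrable_real continuous_intros continuous_on_circle hol r)+
      have "(\<integral>t. cmod (g (of_real r * cis t) - of_real k * f (of_real r * cis t)) \<partial>circle_measure) \<le>
          (\<integral>t. cmod (g (of_real r * cis t)) + k * cmod (f (of_real r * cis t)) \<partial>circle_measure)"
      proof (rule integral_mono)
        show "cmod (g (of_real r * cis t) - of_real k * f (of_real r * cis t)) \<le> cmod (g (of_real r * cis t)) + k * cmod (f (of_real r * cis t))" for t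
          using norm_triangle_ineq4[of "g (of_real r * cis t)" "of_real k * f (of_real r * cis t)"] k(1) by (simp add: norm_mult)
      qed (use int in auto)
      also have "\<dots> = (\<integral>t. cmod (g (of_real r * cis t)) \<partial>circle_measure) + k * (\<integral>t. cmod (f (of_real r * cis t)) \<partial>circle_measure)"
        using int by simp
      also have "\<dots> \<le> 2*pi + k * (2*pi)"
        using k(1) r by (intro add_mono mult_left_mono integral_circle_le hol le1 f_le1)
      finally show "(\<integral>t. cmod (g (of_real r * cis t) - of_real k * f (of_real r * cis t)) \<partial>circle_measure) \<le> 2*pi + k * (2*pi)" .
    next
      fix t assume t: "t \<in> E2"
      then have t': "t \<in> {0..2*pi} - Bad" using E'sub(1) by (simp add: E2_def)
      have "(\<lambda>n. g (of_real (\<rho> n) * cis t) - of_real k * f (of_real (\<rho> n) * cis t)) \<longlonglongrightarrow> G t - of_real k * F t"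
        by (intro tendsto_intros limG limF t')
      then show "(\<lambda>n. g (of_real (1 - 1 / real (n + 2)) * cis t) - of_real k * f (of_real (1 - 1 / real (n + 2)) * cis t)) \<longlonglongrightarrow> 0"
        using Gk[OF t] by (simp add: \<rho>_def)
    qed
    then show ?thesis by simp
  qed
  have hk: "h w = of_real (2 - k) * f w" if w: "w \<in> ball 0 1" for w
    using mid2[OF w] gk[OF w] by (simp add: algebra_simps)
  have scale: "l \<le> 1" if l: "0 \<le> l" and u: "\<And>w. w \<in> ball 0 1 \<Longrightarrow> u w = of_real l * f w"
      "\<And>r. 0 \<le> r \<Longrightarrow> r < 1 \<Longrightarrow> circle_norm u r \<le> 1" for l u
  proof (cases "l = 0")
    case False
    then have "0 < l" using l by simp
    then have "ennreal l * circle_norm f r \<le> 1" if "0 \<le> r" "r < 1" for r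
      using circle_norm_cmult[OF hol(1) that, of u l] u(1) u(2)[OF that] by (simp add: norm_mult)
    then have "(SUP r\<in>{0..<1}. ennreal l * circle_norm f r) \<le> 1" by (intro SUP_least) auto
    then have "ennreal l * (SUP r\<in>{0..<1}. circle_norm f r) \<le> 1" unfolding SUP_mult_left_ennreal .
    then have "ennreal l \<le> 1" unfolding sup by simp
    then show ?thesis by simp
  qed simp
  \<comment> \<open>As f has norm 1, the norms of g and h are k and 2 - k, and both are at most
    1.\<close>
  have "k \<le> 1" using scale[OF k(1) gk le1(1)] .
  moreover have "2 - k \<le> 1" using k(2) by (intro scale[OF _ hk le1(2)]) auto
  ultimately have "k = 1" by simp
  then show ?thesis using gk[OF w] hk[OF w] by simp
qed

end

theorem theorem14:
  fixes \<phi> :: "real \<Rightarrow> real" and f :: "complex \<Rightarrow> complex"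
  assumes "continuous_on {0..2*pi} \<phi>"
    and "strict_mono_on {0..2*pi} \<phi>"
    and "strictly_concave_on {0..2*pi} \<phi>"
    and "\<phi> 0 = 0" and "\<phi> (2*pi) = 1"
    and "f \<in> hardy_lorentz \<phi>"
    and "hardy_lorentz_norm \<phi> f = 1"
    and "\<exists>E c. E \<in> sets lebesgue \<and> E \<subseteq> {0..2*pi} \<and> emeasure lebesgue E > 0 \<and>
           (\<forall>t\<in>E. cmod (boundary_value f t) = c)"
  shows "extreme_in_hardy_lorentz_ball \<phi> f"
proof -
  interpret lorentz_weight \<phi> using assms(1-5) by unfold_locales
  have f: "f holomorphic_on ball 0 1" using assms(6) by (simp add: hardy_lorentz_def analytic_imp_holomorphic)
  obtain E c where E: "E \<in> sets lebesgue" "E \<subseteq> {0..2*pi}" "0 < emeasure lebesgue E"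
    "\<And>t. t \<in> E \<Longrightarrow> cmod (boundary_value f t) = c" using assms(8) by blast
  have "g z = h z"
    if seg: "\<forall>u\<in>{0..1::real}. (\<lambda>z. of_real (1 - u) * g z + of_real u * h z) \<in> hardy_lorentz_unit_ball \<phi>"
      and mid: "\<forall>z\<in>ball 0 1. f z = (g z + h z) / 2" and z: "z \<in> ball 0 1" for g h z
  proof -
    have gh: "g \<in> hardy_lorentz_unit_ball \<phi>" "h \<in> hardy_lorentz_unit_ball \<phi>"
      using seg[rule_format, of 0] seg[rule_format, of 1] by simp_all
    then have hol: "g holomorphic_on ball 0 1" "h holomorphic_on ball 0 1"
      by (auto simp: hardy_lorentz_unit_ball_def hardy_lorentz_def analytic_imp_holomorphic)
    show ?thesis
    proof (rule midpoint_eq_endpoints[OF f hol _ circle_norm_le_1[OF gh(1)] circle_norm_le_1[OF gh(2)] _ E z])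
      show "(SUP r\<in>{0..<1}. circle_norm f r) = 1"
        using assms(7) hardy_lorentz_norm_eq_SUP[OF f] by simp
    qed (use mid in auto)
  qed
  moreover have "f \<in> hardy_lorentz_unit_ball \<phi>" using assms(6,7) by (simp add: hardy_lorentz_unit_ball_def)
  ultimately show ?thesis unfolding extreme_in_hardy_lorentz_ball_def by blast
qed

end
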